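(* Let $\rho$ be the autocovariance function of the weakly stationary solution $X$ of the ARCH($\infty$) equations with data $a$, $b$, $\xi$. Suppose that $\Omega<1$ and $\lambda_1\sum_{j=1}^\infty b(j)<1/2$. Then $b\in\mathcal{W}^{\downarrow}(1)$ if and only if $\rho\in\mathcal{W}^{\downarrow}(1)$ (i.e. $(\rho(n))_{n\ge 0}\in\mathcal{W}^{\downarrow}(1)$), and both statements imply that $\lim_{n\to\infty}\rho(n)/b(n)$ exists and $$\lim_{n\to\infty}\frac{\rho(n)}{b(n)}=\frac{\lambda_1}{1-\lambda_1B}\sum_{j=-\infty}^{\infty}\rho(j)=\frac{\lambda_1\,\mathbb{E}[\nu(0)^2]}{(1-\lambda_1B)^3}.$$
   Context: ARCH($\infty$) setting. Let $\xi=\{\xi(k)\}_{k\in\mathbb{Z}}$ be i.i.d. non-negative random variables, $a\ge 0$ a constant, and $b=\{b(j)\}_{j\ge1}$ a real sequence with $b(j)\ge 0$. A random sequence $X=\{X(k)\}_{k\in\mathbb{Z}}$ satisfies the ARCH($\infty$) equations if $X(k)=\varsigma(k)\xi(k)$, $\varsigma(k)=a+\sum_{j=1}^\infty b(j)X(k-j)$ for all $k\in\mathbb{Z}$. Put $\lambda_1=\mathbb{E}[\xi(0)]$, $\lambda_2=\mathbb{E}[\xi(0)^2]$, $\sigma^2=\mathrm{Var}[\xi(0)]=\lambda_2-\lambda_1^2$, $B=\sum_{j=1}^\infty b(j)$, $\nu(k)=X(k)-\lambda_1\varsigma(k)$. Standing assumptions: $\lambda_1\in(0,\infty)$, $a>0$,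 $\sigma\in(0,\infty)$, and $b$ is not identically zero. The sequence $z$ is defined by $z(0)=1$, $z(n)=\lambda_1\sum_{j=0}^{n-1}b(n-j)z(j)$ for $n\ge 1$ (when $\lambda_1B<1$, these are the power series coefficients of $1/(1-\lambda_1\sum_{j\ge1}b(j)\lambda^j)$ on $|\lambda|\le 1$), and $\Omega=\frac{\sigma}{\lambda_1}\big(\sum_{j=1}^\infty z(j)^2\big)^{1/2}$. A process is (weakly) stationary if it has constant finite mean and $\mathrm{Cov}[X(n),X(n+k)]$ depends only on $k$; $\rho(k)=\mathrm{Cov}[X(n),X(n+k)]$, $k\in\mathbb{Z}$, is its autocovariance function. Known fact: if $\lambda_1B<1$ and $\Omega<1$, there is a unique weakly stationary solution $X$ of the ARCH($\infty$) equations; it satisfies $\rho(k)=\mathbb{E}[\nu(0)^2]\sum_{j=0}^\infty z(j)z(j+|k|)$ for $k\in\mathbb{Z}$, with $\mathbb{E}[\nu(0)^2]=\big(\frac{a\sigma}{1-\lambda_1B}\big)^2\frac{1}{1-\Omega^2}$. Weight classes. For finite $r>0$, a real sequence $\gamma=\{\gamma(n)\}_{n\ge0}$ is in $\mathcal{W}(r)$ if $\gamma(n)>0$ for all $n\ge 0$, $\lim_{n\to\infty}\gamma(n-1)/\gamma(n)=1/r$, $\sum_{i=0}^\infty\gamma(i)r^{-i}<\infty$, and $\lim_{m\to\infty}\big(\limsup_{n\to\infty}\frac1{\gamma(n)}\sum_{i=m}^{n-m}\gamma(n-i)\gamma(i)\big)=0$. For $r\in(0,1]$, $\mathcal{W}^{\downarrow}(r)$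 is the set of $g\in\mathcal{W}(r)$ for which there is a non-increasing positive sequence $\gamma=\{\gamma(n)\}_{n\ge 0}$ with $g(n)/\gamma(n)\to1$ as $n\to\infty$. Since $b$ is indexed by $j\ge1$, the statement $b\in\mathcal{W}^{\downarrow}(1)$ means that $b$, extended to index $0$ by an arbitrary positive value, lies in $\mathcal{W}^{\downarrow}(1)$ (in particular $b(n)>0$ for every $n\ge1$; the choice of the value at index $0$ is immaterial).
   Formalization: The equivalence is proved as: b in W↓(1) iff ρ in W↓(1) and b(n)>0 for all n≥1 (the literal converse fails, e.g. b(1)=0, b(n)=εn^-3 for n≥2); without positivity, ρ in W↓(1) gives that b agrees from some index on with a member of W↓(1). *)

theory Defs
  imports "HOL-Probability.Probability"
begin

text \<open>
  Coefficient sequences \<open>b :: nat \<Rightarrow> real\<close> stand for families \<open>(b j)\<close> with \<open>j \<ge> 1\<close>; no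
  definition below reads the entry \<open>b 0\<close>.  The noise \<open>\<xi>\<close> and the process \<open>X\<close> are indexed by
  the integers.
\<close>

definition lam1 :: "'a measure \<Rightarrow> (int \<Rightarrow> 'a \<Rightarrow> real) \<Rightarrow> real" where
  "lam1 M \<xi> = (\<integral>\<omega>. \<xi> 0 \<omega> \<partial>M)"

definition noise_sd :: "'a measure \<Rightarrow> (int \<Rightarrow> 'a \<Rightarrow> real) \<Rightarrow> real" where
  "noise_sd M \<xi> = sqrt (\<integral>\<omega>. (\<xi> 0 \<omega> - lam1 M \<xi>)\<^sup>2 \<partial>M)"

definition bsum :: "(nat \<Rightarrow> real) \<Rightarrow> real" where
  "bsum b = (\<Sum>j. b (Suc j))"

text \<open>The noise is non-negative almost surely, i.i.d. and square integrable.\<close>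

definition iid_noise :: "'a measure \<Rightarrow> (int \<Rightarrow> 'a \<Rightarrow> real) \<Rightarrow> bool" where
  "iid_noise M \<xi> \<longleftrightarrow>
     prob_space.indep_vars M (\<lambda>_. borel) \<xi> UNIV \<and>
     (\<forall>k. distr M borel (\<xi> k) = distr M borel (\<xi> 0)) \<and>
     (\<forall>k. AE \<omega> in M. 0 \<le> \<xi> k \<omega>) \<and>
     integrable M (\<lambda>\<omega>. (\<xi> 0 \<omega>)\<^sup>2)"

definition varsig :: "real \<Rightarrow> (nat \<Rightarrow> real) \<Rightarrow> (int \<Rightarrow> 'a \<Rightarrow> real) \<Rightarrow> int \<Rightarrow> 'a \<Rightarrow> real" where
  "varsig a b X k \<omega> = a + (\<Sum>j. b (Suc j) * X (k - int (Suc j)) \<omega>)"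

text \<open>
  The equations hold almost surely, and convergence of the defining series is part of
  being a solution.  Neither causality nor a sign condition on \<open>X\<close> is imposed.
\<close>

definition arch_solution ::
  "'a measure \<Rightarrow> (int \<Rightarrow> 'a \<Rightarrow> real) \<Rightarrow> real \<Rightarrow> (nat \<Rightarrow> real) \<Rightarrow> (int \<Rightarrow> 'a \<Rightarrow> real) \<Rightarrow> bool" where
  "arch_solution M \<xi> a b X \<longleftrightarrow>
     (\<forall>k. X k \<in> borel_measurable M) \<and>
     (\<forall>k. AE \<omega> in M. summable (\<lambda>j. b (Suc j) * X (k - int (Suc j)) \<omega>) \<and>
                      X k \<omega> = varsig a b X k \<omega> * \<xi> k \<omega>)"

definition nu ::
  "'a measure \<Rightarrow> (int \<Rightarrow> 'a \<Rightarrow> real) \<Rightarrow> real \<Rightarrow> (nat \<Rightarrow> real) \<Rightarrow> (int \<Rightarrow> 'a \<Rightarrow> real) \<Rightarrow> int \<Rightarrow> 'a \<Rightarrow> real" where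
  "nu M \<xi> a b X k \<omega> = X k \<omega> - lam1 M \<xi> * varsig a b X k \<omega>"

fun zseq :: "real \<Rightarrow> (nat \<Rightarrow> real) \<Rightarrow> nat \<Rightarrow> real" where
  "zseq l b 0 = 1"
| "zseq l b (Suc n) = l * (\<Sum>j\<le>n. b (Suc n - j) * zseq l b j)"

text \<open>
  If \<open>b\<close> is non-negative and summable with \<open>lam1 M \<xi> * bsum b < 1\<close>, then \<open>zseq\<close> is summable,
  hence square summable, so the series below is then a genuine sum.
\<close>

definition Omega :: "'a measure \<Rightarrow> (int \<Rightarrow> 'a \<Rightarrow> real) \<Rightarrow> (nat \<Rightarrow> real) \<Rightarrow> real" where
  "Omega M \<xi> b = noise_sd M \<xi> / lam1 M \<xi> * sqrt (\<Sum>j. (zseq (lam1 M \<xi>) b (Suc j))\<^sup>2)"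

definition covariance :: "'a measure \<Rightarrow> ('a \<Rightarrow> real) \<Rightarrow> ('a \<Rightarrow> real) \<Rightarrow> real" where
  "covariance M U V = (\<integral>\<omega>. (U \<omega> - (\<integral>\<eta>. U \<eta> \<partial>M)) * (V \<omega> - (\<integral>\<eta>. V \<eta> \<partial>M)) \<partial>M)"

definition weakly_stationary :: "'a measure \<Rightarrow> (int \<Rightarrow> 'a \<Rightarrow> real) \<Rightarrow> bool" where
  "weakly_stationary M X \<longleftrightarrow>
     (\<forall>n. X n \<in> borel_measurable M \<and> integrable M (\<lambda>\<omega>. (X n \<omega>)\<^sup>2)) \<and>
     (\<forall>n. (\<integral>\<omega>. X n \<omega> \<partial>M) = (\<integral>\<omega>. X 0 \<omega> \<partial>M)) \<and>
     (\<forall>n k. covariance M (X n) (X (n + k)) = covariance M (X 0) (X k))"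

definition autocov :: "'a measure \<Rightarrow> (int \<Rightarrow> 'a \<Rightarrow> real) \<Rightarrow> int \<Rightarrow> real" where
  "autocov M X k = covariance M (X 0) (X k)"

text \<open>
  The inner upper limit is taken in the extended reals, so it need not be finite for each \<open>m\<close>.
  The truncated subtractions only affect terms that are irrelevant for the limits.
\<close>

definition Wclass :: "real \<Rightarrow> (nat \<Rightarrow> real) set" where
  "Wclass r = {\<gamma>. (\<forall>n. 0 < \<gamma> n) \<and>
     (\<lambda>n. \<gamma> (n - 1) / \<gamma> n) \<longlonglongrightarrow> 1 / r \<and>
     summable (\<lambda>i. \<gamma> i / r ^ i) \<and>
     (\<lambda>m. limsup (\<lambda>n. ereal (1 / \<gamma> n * (\<Sum>i=m..n-m. \<gamma> (n - i) * \<gamma> i)))) \<longlonglongrightarrow> 0}"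

definition Wdown :: "real \<Rightarrow> (nat \<Rightarrow> real) set" where
  "Wdown r = {g \<in> Wclass r. \<exists>\<gamma>. (\<forall>n. 0 < \<gamma> n) \<and> decseq \<gamma> \<and> (\<lambda>n. g n / \<gamma> n) \<longlonglongrightarrow> 1}"

end

theory Submission
  imports Defs
begin

text \<open>
  Write \<open>l\<close> and \<open>sd\<close> for mean and standard deviation of the noise, and put
  \<open>q = l * bsum b < 1/2\<close>.  The proof has a probabilistic half, which expresses the autocovariance
  \<open>\<rho>\<close> through \<open>b\<close>, and an analytic half, which compares the decay of the two sequences.

  \<^bold>\<open>Probability.\<close>  Let \<open>z\<close> be the resolvent \<open>zseq l b\<close>.  The aim is
  \<open>\<rho> n = V * (\<Sum>j. z j * z (j + \<bar>n\<bar>))\<close>, where \<open>V\<close> is the second moment of \<open>nu\<close> at time \<open>0\<close>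
  (\<open>autocov_formula\<close>).  Since a solution may depend on the future of the noise a priori, its
  causality has to be proved.  Iterating the equation gives
  \<open>X k = (\<Sum>i\<le>n. G k i * (a + R))\<close>, where the Green function \<open>G k i\<close> collects all products of
  coefficients and noise along paths from time \<open>k\<close> down to \<open>k - i\<close>, and the remainder \<open>R\<close> is a tail
  of the series \<open>\<Sum>j. b j * X (k - i - j)\<close>.  By Cauchy-Schwarz the remainders vanish in \<open>L\<^sup>1\<close> as
  soon as the \<open>L\<^sup>2\<close> norms of \<open>G k i\<close> are summable in \<open>i\<close>.  Expanding \<open>G\<close> in orthogonal martingale
  differences shows that the squares of these norms are dominated by a renewal sequence with kernel
  \<open>(sd / l)\<^sup>2 * (z i)\<^sup>2\<close> (\<open>i \<ge> 1\<close>), whose total mass is the square of \<open>Omega\<close>; the square roots of such a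
  sequence are summable by a Wiener-type argument in the algebra \<open>l\<^sup>1\<^sup>/\<^sup>2\<close>
  (\<open>sqrt_renewal_summable\<close>).  Hence \<open>X k\<close> is the increasing limit of \<open>a * (\<Sum>i\<le>n. G k i)\<close>, which
  depends on the noise up to time \<open>k\<close> only.  Independence then yields the Yule-Walker equations, and
  their bounded symmetric solutions are unique up to a factor (\<open>yule_walker_solution\<close>).

  \<^bold>\<open>Analysis.\<close>  Put \<open>z\<^sub>+ n = z n\<close> (\<open>zpos\<close> below) for \<open>n \<ge> 1\<close> and \<open>z\<^sub>+ 0 = 0\<close>.  The sequences \<open>x = l * b\<close>
  (\<open>kern\<close> below, with \<open>x 0 = 0\<close>) and
  \<open>z\<^sub>+\<close> are related by \<open>z\<^sub>+ = x + x * z\<^sub>+\<close> and equally by \<open>x = z\<^sub>+ - z\<^sub>+ * x\<close> (convolutions).  A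
  kernel of total mass \<open>< 1\<close> which is asymptotically proportional to a subexponential weight passes
  this property on to the solution of the renewal equation, for either sign of the convolution term
  (\<open>renewal_asymptotics\<close>).  The mass of \<open>x\<close> is \<open>q\<close> and the mass of \<open>z\<^sub>+\<close> is \<open>q / (1 - q)\<close>, so the
  condition \<open>q < 1/2\<close> is what permits the passage from \<open>z\<close> back to \<open>b\<close>.  Between \<open>z\<close> and \<open>\<rho>\<close>
  one has \<open>\<rho> n / V = z n + (\<Sum>j\<ge>1. z j * z (n + j))\<close>.  For a decreasing weight \<open>\<gamma>\<close> the sum is
  asymptotic to \<open>(\<Sum>j\<ge>1. z j) * z n\<close> once \<open>z\<close> is asymptotically proportional to \<open>\<gamma>\<close>, and since
  \<open>(\<Sum>j\<ge>1. z j) < 1\<close>, the map that subtracts it is a contraction with respect to \<open>\<gamma>\<close>; this recovers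
  the asymptotics of \<open>z\<close> from those of \<open>\<rho>\<close> (\<open>correlation_asymptotics_inverse\<close>).  The same
  contraction principle, applied to upper limits of quotients by \<open>\<gamma>\<close>
  (\<open>contraction_tendsto_zero\<close>), settles both the renewal and the correlation equation.
\<close>

section \<open>Limits of sequences and series\<close>

lemma tannery_sequential:
  fixes f :: "nat \<Rightarrow> nat \<Rightarrow> real"
  assumes "\<And>k. (\<lambda>n. f k n) \<longlonglongrightarrow> l k"
    and "\<forall>\<^sub>F n in sequentially. \<forall>k. \<bar>f k n\<bar> \<le> M k" and "summable M"
  shows "(\<lambda>n. \<Sum>k. f k n) \<longlonglongrightarrow> (\<Sum>k. l k)"
proof -
  have "\<forall>\<^sub>F (k, n) in sequentially \<times>\<^sub>F sequentially. norm (f k n) \<le> M k"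
    unfolding eventually_prod_filter
    by (rule exI[of _ "\<lambda>_. True"], rule exI[of _ "\<lambda>n. \<forall>k. \<bar>f k n\<bar> \<le> M k"]) (use assms(2) in auto)
  from tannerys_theorem[OF assms(1) this assms(3)] show ?thesis by simp
qed

text \<open>
  The hypothesis says that every eventual bound \<open>w\<close> of \<open>\<bar>v\<bar>\<close> can be improved to \<open>\<theta> * w + \<epsilon>\<close>; the
  infimum \<open>W\<close> of all eventual bounds (the upper limit of \<open>\<bar>v\<bar>\<close>) then satisfies \<open>W \<le> \<theta> * W\<close>.
\<close>
lemma contraction_tendsto_zero:
  fixes v :: "nat \<Rightarrow> real"
  assumes \<theta>: "0 \<le> \<theta>" "\<theta> < 1"
    and bdd: "\<forall>\<^sub>F n in sequentially. \<bar>v n\<bar> \<le> K"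
    and step: "\<And>w \<epsilon>. 0 < \<epsilon> \<Longrightarrow> \<forall>\<^sub>F n in sequentially. \<bar>v n\<bar> \<le> w \<Longrightarrow>
                 \<forall>\<^sub>F n in sequentially. \<bar>v n\<bar> \<le> \<theta> * w + \<epsilon>"
  shows "v \<longlonglongrightarrow> 0"
proof -
  define I where "I = {w. \<forall>\<^sub>F n in sequentially. \<bar>v n\<bar> \<le> w}"
  have nonneg: "0 \<le> w" if "w \<in> I" for w
  proof -
    from that have "\<forall>\<^sub>F n in sequentially. \<bar>v n\<bar> \<le> w" by (simp add: I_def)
    from eventually_happens[OF this] show ?thesis by auto
  qed
  have "K \<in> I" using bdd by (simp add: I_def)
  have bb: "bdd_below I" using nonneg by (auto simp: bdd_below_def)
  define W where "W = Inf I"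
  have small: "\<exists>w\<in>I. w < W + \<epsilon>" if "0 < \<epsilon>" for \<epsilon>
    using cInf_lessD[of I "W + \<epsilon>"] \<open>K \<in> I\<close> that by (auto simp: W_def)
  have "W \<le> 0 + \<epsilon>" if "0 < \<epsilon>" for \<epsilon>
  proof -
    define d where "d = \<epsilon> * (1 - \<theta>) / 2"
    have "0 < d" using that \<theta> by (simp add: d_def)
    from small[OF this] obtain w where w: "w \<in> I" "w < W + d" by auto
    have "\<theta> * w + d \<in> I" using step[OF \<open>0 < d\<close>] w(1) by (simp add: I_def)
    then have "W \<le> \<theta> * w + d" unfolding W_def by (rule cInf_lower[OF _ bb])
    also have "\<theta> * w \<le> \<theta> * (W + d)" using w \<theta> by (intro mult_left_mono) auto
    finally have "W \<le> \<theta> * (W + d) + d" by simp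
    moreover have "\<theta> * d \<le> d" using \<theta> \<open>0 < d\<close> by (simp add: mult_left_le_one_le)
    moreover have "\<epsilon> * (1 - \<theta>) = 2 * d" by (simp add: d_def)
    ultimately have "(1 - \<theta>) * W \<le> (1 - \<theta>) * \<epsilon>" by (simp add: algebra_simps)
    then show ?thesis using \<theta> by simp
  qed
  then have "W \<le> 0" by (rule field_le_epsilon)
  show ?thesis
  proof (rule LIMSEQ_I)
    fix r :: real assume "0 < r"
    from small[OF this] \<open>W \<le> 0\<close> obtain w where w: "w \<in> I" "w < r" by fastforce
    then obtain N where "\<forall>n\<ge>N. \<bar>v n\<bar> \<le> w" by (auto simp: I_def eventually_sequentially)
    then show "\<exists>no. \<forall>n\<ge>no. norm (v n - 0) < r" using w(2) by fastforce
  qed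
qed

lemma convolution_tendsto_zero:
  fixes w t :: "nat \<Rightarrow> real"
  assumes w: "\<And>i. 0 \<le> w i" "summable w" and t: "t \<longlonglongrightarrow> 0"
  shows "(\<lambda>n. \<Sum>i\<le>n. w i * t (n - i)) \<longlonglongrightarrow> 0"
proof -
  obtain K where K: "0 < K" "\<And>n. norm (t n) \<le> K"
    using t by (metis Bseq_def convergent_def convergent_imp_Bseq)
  define f where "f i n = (if i \<le> n then w i * t (n - i) else 0)" for i n
  have "(\<lambda>n. \<Sum>i. f i n) \<longlonglongrightarrow> (\<Sum>i. 0)"
  proof (rule tannery_sequential)
    fix i
    have "(\<lambda>n. w i * t (n - i)) \<longlonglongrightarrow> w i * 0"
      by (intro tendsto_intros filterlim_compose[OF t filterlim_minus_const_nat_at_top])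
    moreover have "\<forall>\<^sub>F n in sequentially. w i * t (n - i) = f i n"
      using eventually_ge_at_top[of i] by eventually_elim (simp add: f_def)
    ultimately show "f i \<longlonglongrightarrow> 0" by (simp add: Lim_transform_eventually)
  next
    show "summable (\<lambda>i. w i * K)" by (intro summable_mult2 w)
    show "\<forall>\<^sub>F n in sequentially. \<forall>i. \<bar>f i n\<bar> \<le> w i * K"
      by (intro always_eventually allI) (use K w in \<open>auto simp: f_def abs_mult intro!: mult_left_mono mult_nonneg_nonneg\<close>)
  qed
  moreover have "(\<Sum>i. f i n) = (\<Sum>i\<le>n. w i * t (n - i))" for n
  proof -
    have "(\<Sum>i. f i n) = (\<Sum>i\<le>n. f i n)" by (rule suminf_finite) (auto simp: f_def)
    then show ?thesis by (simp add: f_def)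
  qed
  ultimately show ?thesis by simp
qed

text \<open>
  Absolutely convergent double series, by Tannery's theorem applied to the partial sums over \<open>m\<close>.
\<close>
lemma suminf_swap:
  fixes \<beta> y :: "nat \<Rightarrow> real" and c :: "nat \<Rightarrow> nat \<Rightarrow> real"
  assumes "\<And>j. 0 \<le> \<beta> j" "summable \<beta>" "\<And>m. 0 \<le> y m" "summable y" "\<And>j m. \<bar>c j m\<bar> \<le> C"
  shows "(\<Sum>j. \<beta> j * (\<Sum>m. y m * c j m)) = (\<Sum>m. y m * (\<Sum>j. \<beta> j * c j m))"
proof -
  have "0 \<le> C" using order_trans[OF abs_ge_zero assms(5)] .
  have s1: "summable (\<lambda>m. \<beta> j * (y m * c j m))" for j
    by (intro summable_mult summable_comparison_test'[OF summable_mult2[OF assms(4), of C], of 0])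
       (use assms in \<open>auto simp: abs_mult mult_left_mono\<close>)
  then have s1': "summable (\<lambda>m. y m * c j m)" for j
    by (intro summable_comparison_test'[OF summable_mult2[OF assms(4), of C], of 0])
       (use assms in \<open>auto simp: abs_mult mult_left_mono\<close>)
  have s2: "summable (\<lambda>j. \<beta> j * c j m)" for m
    by (intro summable_comparison_test'[OF summable_mult2[OF assms(2), of C], of 0])
       (use assms in \<open>auto simp: abs_mult mult_left_mono\<close>)
  have "(\<lambda>N. \<Sum>j. \<beta> j * (\<Sum>m<N. y m * c j m)) \<longlonglongrightarrow> (\<Sum>j. \<beta> j * (\<Sum>m. y m * c j m))"
  proof (rule tannery_sequential)
    show "(\<lambda>N. \<beta> j * (\<Sum>m<N. y m * c j m)) \<longlonglongrightarrow> \<beta> j * (\<Sum>m. y m * c j m)" for j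
      by (intro tendsto_intros summable_LIMSEQ s1')
    show "summable (\<lambda>j. \<beta> j * ((\<Sum>m. y m) * C))" by (intro summable_mult2 assms)
    have "\<bar>\<beta> j * (\<Sum>m<N. y m * c j m)\<bar> \<le> \<beta> j * ((\<Sum>m. y m) * C)" for j N
    proof -
      have "\<bar>\<Sum>m<N. y m * c j m\<bar> \<le> (\<Sum>m<N. y m * C)"
        by (intro order_trans[OF sum_abs] sum_mono) (use assms in \<open>auto simp: abs_mult mult_left_mono\<close>)
      also have "\<dots> = (\<Sum>m<N. y m) * C" by (simp add: sum_distrib_right)
      also have "\<dots> \<le> (\<Sum>m. y m) * C" by (intro mult_right_mono sum_le_suminf) (use assms \<open>0 \<le> C\<close> in auto)
      finally show ?thesis using assms(1)[of j] by (simp add: abs_mult mult_left_mono)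
    qed
    then show "\<forall>\<^sub>F N in sequentially. \<forall>j. \<bar>\<beta> j * (\<Sum>m<N. y m * c j m)\<bar> \<le> \<beta> j * ((\<Sum>m. y m) * C)" by simp
  qed
  moreover have "(\<Sum>j. \<beta> j * (\<Sum>m<N. y m * c j m)) = (\<Sum>m<N. y m * (\<Sum>j. \<beta> j * c j m))" for N
  proof -
    have "(\<Sum>j. \<beta> j * (\<Sum>m<N. y m * c j m)) = (\<Sum>j. \<Sum>m<N. y m * (\<beta> j * c j m))"
      by (simp add: sum_distrib_left mult.left_commute)
    also have "\<dots> = (\<Sum>m<N. \<Sum>j. y m * (\<beta> j * c j m))" by (intro suminf_sum summable_mult s2)
    also have "\<dots> = (\<Sum>m<N. y m * (\<Sum>j. \<beta> j * c j m))" by (simp add: suminf_mult[OF s2])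
    finally show ?thesis .
  qed
  ultimately have "(\<lambda>m. y m * (\<Sum>j. \<beta> j * c j m)) sums (\<Sum>j. \<beta> j * (\<Sum>m. y m * c j m))"
    by (simp add: sums_def)
  then show ?thesis by (rule sums_unique)
qed

text \<open>
  The sequences compared below often differ in finitely many entries, mostly in the entry at \<open>0\<close>.
\<close>
lemma tendsto_ratio_change_finite:
  fixes f g \<gamma> :: "nat \<Rightarrow> real"
  assumes "(\<lambda>n. f n / \<gamma> n) \<longlonglongrightarrow> L" and "\<And>n. N \<le> n \<Longrightarrow> f n = g n"
  shows "(\<lambda>n. g n / \<gamma> n) \<longlonglongrightarrow> L"
proof (rule Lim_transform_eventually[OF assms(1)])
  show "\<forall>\<^sub>F n in sequentially. f n / \<gamma> n = g n / \<gamma> n"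
    using eventually_ge_at_top[of N] by eventually_elim (simp add: assms(2))
qed

section \<open>Subexponential weight classes\<close>

lemma Wclass_pos: "\<gamma> \<in> Wclass 1 \<Longrightarrow> 0 < \<gamma> n"
  by (simp add: Wclass_def)

lemma Wclass_summable: "\<gamma> \<in> Wclass 1 \<Longrightarrow> summable \<gamma>"
  by (simp add: Wclass_def)

lemma ratio_shift_left:
  assumes pos: "\<And>n. 0 < \<gamma> n" and lim: "(\<lambda>n. \<gamma> (n - 1) / \<gamma> n :: real) \<longlonglongrightarrow> 1"
  shows "(\<lambda>n. \<gamma> (n - j) / \<gamma> n) \<longlonglongrightarrow> 1"
proof (induction j)
  case 0
  then show ?case using pos by (simp add: less_imp_neq[THEN not_sym])
next
  case (Suc j)
  have "filterlim (\<lambda>n. n - j) sequentially sequentially"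
    by (rule filterlim_minus_const_nat_at_top)
  from filterlim_compose[OF lim this] 
  have "(\<lambda>n. \<gamma> (n - j - 1) / \<gamma> (n - j) * (\<gamma> (n - j) / \<gamma> n)) \<longlonglongrightarrow> 1 * 1"
    by (intro tendsto_mult Suc.IH)
  moreover have "\<gamma> (n - j - 1) / \<gamma> (n - j) * (\<gamma> (n - j) / \<gamma> n) = \<gamma> (n - Suc j) / \<gamma> n" for n
    using pos[of "n - j"] by simp
  ultimately show ?case by (simp only: mult_1_right)
qed

lemma ratio_shift_right:
  assumes pos: "\<And>n. 0 < \<gamma> n" and lim: "(\<lambda>n. \<gamma> (n - 1) / \<gamma> n :: real) \<longlonglongrightarrow> 1"
  shows "(\<lambda>n. \<gamma> (n + j) / \<gamma> n) \<longlonglongrightarrow> 1"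
proof -
  have "(\<lambda>n. \<gamma> (n + j - j) / \<gamma> (n + j)) \<longlonglongrightarrow> 1"
    using LIMSEQ_ignore_initial_segment[OF ratio_shift_left[OF pos lim, of j], of j] by simp
  then have "(\<lambda>n. inverse (\<gamma> n / \<gamma> (n + j))) \<longlonglongrightarrow> inverse 1"
    by (intro tendsto_inverse) auto
  then show ?thesis by (simp add: field_simps)
qed

lemmas Wclass_shift_left = ratio_shift_left[OF Wclass_pos]

lemma Wclass_ratio: "\<gamma> \<in> Wclass 1 \<Longrightarrow> (\<lambda>n. \<gamma> (n - 1) / \<gamma> n) \<longlonglongrightarrow> 1"
  by (simp add: Wclass_def)

text \<open>
  The fourth condition on the class in a usable form: terms of the self-convolution of \<open>\<gamma>\<close> with both
  indices large are negligible against \<open>\<gamma> n\<close>.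
\<close>
lemma Wclass_middle:
  assumes "\<gamma> \<in> Wclass 1" "0 < \<delta>"
  shows "\<forall>\<^sub>F m in sequentially. \<forall>\<^sub>F n in sequentially. (\<Sum>i=m..n-m. \<gamma> (n - i) * \<gamma> i) \<le> \<delta> * \<gamma> n"
proof -
  let ?L = "\<lambda>m. limsup (\<lambda>n. ereal (1 / \<gamma> n * (\<Sum>i=m..n-m. \<gamma> (n - i) * \<gamma> i)))"
  have "?L \<longlonglongrightarrow> 0" using assms(1) by (simp add: Wclass_def)
  then have "\<forall>\<^sub>F m in sequentially. ?L m < ereal \<delta>"
    by (rule order_tendstoD(2)) (use assms in simp)
  then show ?thesis
  proof eventually_elim
    case (elim m)
    from Limsup_lessD[OF elim] show ?case
    proof eventually_elim
      case (elim n)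
      then show ?case using Wclass_pos[OF assms(1), of n] by (simp add: field_simps)
    qed
  qed
qed

lemma convergent_ratio_bounded:
  fixes x \<gamma> :: "nat \<Rightarrow> real"
  assumes "\<And>n. 0 < \<gamma> n" "(\<lambda>n. x n / \<gamma> n) \<longlonglongrightarrow> L"
  obtains K where "0 < K" "\<And>n. \<bar>x n\<bar> \<le> K * \<gamma> n"
proof -
  have "Bseq (\<lambda>n. x n / \<gamma> n)" using assms(2) by (auto intro: convergent_imp_Bseq convergentI)
  then obtain K where K: "0 < K" "\<And>n. norm (x n / \<gamma> n) \<le> K" by (auto simp: Bseq_def)
  moreover have "\<bar>x n\<bar> \<le> K * \<gamma> n" for n
    using assms(1)[of n] K(2)[of n] by (simp add: pos_divide_le_eq)
  ultimately show ?thesis using that by blast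
qed

text \<open>
  The sum in the fourth condition on the class changes by a bounded factor only, and the quotients in
  the second one keep their limit.
\<close>
lemma Wclass_asymp_equiv:
  assumes g: "g \<in> Wclass 1" and pos: "\<And>n. 0 < h n" and lim: "(\<lambda>n. h n / g n) \<longlonglongrightarrow> L" and L: "0 < L"
  shows "h \<in> Wclass 1"
proof -
  note gpos = Wclass_pos[OF g]
  obtain K where K: "0 < K" "\<And>n. \<bar>h n\<bar> \<le> K * g n" using convergent_ratio_bounded[OF gpos lim] by blast
  have "(\<lambda>n. inverse (h n / g n)) \<longlonglongrightarrow> inverse L" using lim L by (intro tendsto_inverse) auto
  then have "(\<lambda>n. g n / h n) \<longlonglongrightarrow> inverse L" by (simp add: field_simps)
  from convergent_ratio_bounded[OF pos this]
  obtain K' where K': "0 < K'" "\<And>n. \<bar>g n\<bar> \<le> K' * h n" by blast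
  have ratio: "(\<lambda>n. h (n - 1) / h n) \<longlonglongrightarrow> 1"
  proof -
    have "filterlim (\<lambda>n::nat. n - 1) sequentially sequentially"
      by (rule filterlim_minus_const_nat_at_top)
    from filterlim_compose[OF lim this] 
    have "(\<lambda>n. (h (n - 1) / g (n - 1)) * (g (n - 1) / g n) / (h n / g n)) \<longlonglongrightarrow> L * 1 / L"
      using L by (intro tendsto_intros lim Wclass_ratio g) auto
    moreover have "(h (n - 1) / g (n - 1)) * (g (n - 1) / g n) / (h n / g n) = h (n - 1) / h n" for n
      using gpos[of n] gpos[of "n - 1"] by (simp add: field_simps)
    ultimately show ?thesis using L by (simp only:) simp
  qed
  have summ: "summable h"
    by (rule summable_comparison_test'[of "\<lambda>n. K * g n" 0])
       (use K Wclass_summable[OF g] in \<open>auto intro: summable_mult\<close>)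
  have "(\<lambda>m. limsup (\<lambda>n. ereal (1 / h n * (\<Sum>i=m..n-m. h (n - i) * h i)))) \<longlonglongrightarrow> 0"
  proof (rule order_tendstoI)
    fix y :: ereal assume "y < 0"
    have "0 \<le> limsup (\<lambda>n. ereal (1 / h n * (\<Sum>i=m..n-m. h (n - i) * h i)))" for m
      by (rule le_Limsup) (auto intro!: always_eventually mult_nonneg_nonneg sum_nonneg divide_nonneg_nonneg less_imp_le[OF pos])
    then show "\<forall>\<^sub>F m in sequentially. y < limsup (\<lambda>n. ereal (1 / h n * (\<Sum>i=m..n-m. h (n - i) * h i)))"
      using \<open>y < 0\<close> by (intro always_eventually allI) (rule less_le_trans)
  next
    fix y :: ereal assume "0 < y"
    then obtain \<delta> where \<delta>: "0 < \<delta>" "ereal \<delta> < y" by (metis ereal_dense2 ereal_less(2))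
    define d where "d = \<delta> / (K * K * K')"
    have "0 < d" using K K' \<delta> by (simp add: d_def)
    from Wclass_middle[OF g this]
    show "\<forall>\<^sub>F m in sequentially. limsup (\<lambda>n. ereal (1 / h n * (\<Sum>i=m..n-m. h (n - i) * h i))) < y"
    proof eventually_elim
      case (elim m)
      have "limsup (\<lambda>n. ereal (1 / h n * (\<Sum>i=m..n-m. h (n - i) * h i))) \<le> ereal \<delta>"
        using elim
      proof (intro Limsup_bounded, eventually_elim)
        case (elim n)
        have "(\<Sum>i=m..n-m. h (n - i) * h i) \<le> (\<Sum>i=m..n-m. (K * g (n - i)) * (K * g i))"
          by (intro sum_mono mult_mono) (use K pos less_imp_le[OF pos] gpos in \<open>auto simp: abs_of_pos less_imp_le\<close>)
        also have "\<dots> = K * K * (\<Sum>i=m..n-m. g (n - i) * g i)" by (simp add: sum_distrib_left mult_ac)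
        also have "\<dots> \<le> K * K * (d * g n)" using elim K by (intro mult_left_mono) auto
        also have "\<dots> \<le> K * K * (d * (K' * h n))" 
          using K(1) K'(1) K'(2)[of n] \<open>0 < d\<close> by (intro mult_left_mono) auto
        also have "\<dots> = \<delta> * h n" using K K' by (simp add: d_def)
        finally show ?case using pos[of n] by (simp add: field_simps)
      qed
      then show ?case using \<delta>(2) by (rule le_less_trans)
    qed
  qed
  then show ?thesis using pos ratio summ by (simp add: Wclass_def)
qed

lemma Wdown_asymp_equiv:
  assumes \<gamma>: "\<gamma> \<in> Wclass 1" "decseq \<gamma>"
    and pos: "\<And>n. 0 < h n" and lim: "(\<lambda>n. h n / \<gamma> n) \<longlonglongrightarrow> L" and L: "0 < L"
  shows "h \<in> Wdown 1"
proof -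
  have "(\<lambda>n. (h n / \<gamma> n) / L) \<longlonglongrightarrow> L / L" using L by (intro tendsto_intros lim) auto
  then have "(\<lambda>n. h n / (L * \<gamma> n)) \<longlonglongrightarrow> 1" using L by (simp add: mult.commute)
  moreover have "decseq (\<lambda>n. L * \<gamma> n)" using \<gamma>(2) L by (auto simp: decseq_def)
  moreover have "\<forall>n. 0 < L * \<gamma> n" using Wclass_pos[OF \<gamma>(1)] L by simp
  ultimately show ?thesis
    unfolding Wdown_def using Wclass_asymp_equiv[OF \<gamma>(1) pos lim L]
    by (intro CollectI conjI exI[of _ "\<lambda>n. L * \<gamma> n"]) simp_all
qed

text \<open>
  The definition asks for a decreasing sequence asymptotic to \<open>g\<close>; that this sequence lies in the class
  as well lets it serve as the weight against which all other sequences are measured.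
\<close>
lemma Wdown_obtain:
  assumes "g \<in> Wdown 1"
  obtains \<gamma> where "\<gamma> \<in> Wclass 1" "decseq \<gamma>" "(\<lambda>n. g n / \<gamma> n) \<longlonglongrightarrow> 1"
proof -
  from assms obtain \<gamma> where \<gamma>: "g \<in> Wclass 1" "\<And>n. 0 < \<gamma> n" "decseq \<gamma>" "(\<lambda>n. g n / \<gamma> n) \<longlonglongrightarrow> 1"
    by (auto simp: Wdown_def)
  have "(\<lambda>n. inverse (g n / \<gamma> n)) \<longlonglongrightarrow> inverse 1" using \<gamma> by (intro tendsto_inverse) auto
  then have "(\<lambda>n. \<gamma> n / g n) \<longlonglongrightarrow> 1" by (simp add: field_simps)
  from Wclass_asymp_equiv[OF \<gamma>(1) \<gamma>(2) this] show ?thesis using \<gamma> that by simp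
qed

section \<open>Convolutions and renewal equations with subexponential weights\<close>

lemma sum_split_ends:
  fixes g :: "nat \<Rightarrow> real"
  assumes "2 * m \<le> n"
  shows "(\<Sum>i\<le>n. g i) = (\<Sum>i<m. g i) + (\<Sum>i=m..n-m. g i) + (\<Sum>j<m. g (n - j))"
proof -
  have "{..n} = ({..<m} \<union> {m..n-m}) \<union> {n-m<..n}" using assms by auto
  then have "(\<Sum>i\<le>n. g i) = (\<Sum>i<m. g i) + (\<Sum>i=m..n-m. g i) + (\<Sum>i\<in>{n-m<..n}. g i)"
    using assms by (simp add: sum.union_disjoint[symmetric] ivl_disj_int) 
      (subst sum.union_disjoint; auto)+
  also have "(\<Sum>i\<in>{n-m<..n}. g i) = (\<Sum>j<m. g (n - j))"
    using assms by (intro sum.reindex_bij_witness[of _ "\<lambda>j. n - j" "\<lambda>j. n - j"]) auto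
  finally show ?thesis .
qed

text \<open>
  Only the two ends of a convolution matter: where the index of \<open>x\<close> is small, \<open>f (n - i) / \<gamma> n\<close> is
  within about \<open>w\<close> of \<open>\<Lambda>\<close>, which contributes \<open>(\<Sum>n. x n) * \<Lambda>\<close> with error \<open>(\<Sum>n. x n) * w\<close>; where the
  index of \<open>f\<close> is small, \<open>x (n - j) / \<gamma> n\<close> tends to \<open>L\<close>, which contributes \<open>L * (\<Sum>n. f n)\<close>.  The
  error \<open>w\<close> is kept explicit because in a renewal equation \<open>f\<close> is the unknown, and the factor
  \<open>\<Sum>n. x n < 1\<close> in front of it makes the equation a contraction.
\<close>
lemma convolution_near_limit:
  fixes x f \<gamma> :: "nat \<Rightarrow> real"
  assumes \<gamma>: "\<gamma> \<in> Wclass 1"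
    and x: "\<And>n. 0 \<le> x n" "(\<lambda>n. x n / \<gamma> n) \<longlonglongrightarrow> L"
    and f: "\<And>n. \<bar>f n\<bar> \<le> K * \<gamma> n" "\<forall>\<^sub>F n in sequentially. \<bar>f n / \<gamma> n - \<Lambda>\<bar> \<le> w"
    and "0 < \<epsilon>"
  shows "\<forall>\<^sub>F n in sequentially.
    \<bar>(\<Sum>i\<le>n. x i * f (n - i)) / \<gamma> n - (L * (\<Sum>n. f n) + (\<Sum>n. x n) * \<Lambda>)\<bar> \<le> (\<Sum>n. x n) * w + \<epsilon>"
proof -
  note pos = Wclass_pos[OF \<gamma>]
  let ?E = "\<lambda>i n. w * (\<gamma> (n - i) / \<gamma> n) + \<bar>\<Lambda>\<bar> * \<bar>\<gamma> (n - i) / \<gamma> n - 1\<bar>"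
  obtain K' where K': "0 < K'" "\<And>n. \<bar>x n\<bar> \<le> K' * \<gamma> n" using convergent_ratio_bounded[OF pos x(2)] by blast
  have "0 \<le> K" using order_trans[OF abs_ge_zero f(1)[of 0]] pos[of 0] by (simp add: zero_le_mult_iff)
  from eventually_happens[OF f(2)] have "0 \<le> w" by auto
  have sx: "summable x"
    by (rule summable_comparison_test'[of "\<lambda>n. K' * \<gamma> n" 0])
       (use K' Wclass_summable[OF \<gamma>] in \<open>auto intro: summable_mult\<close>)
  have sf: "summable f"
    by (rule summable_comparison_test'[of "\<lambda>n. K * \<gamma> n" 0])
       (use f Wclass_summable[OF \<gamma>] in \<open>auto intro: summable_mult\<close>)
  define \<theta> where "\<theta> = (\<Sum>n. x n)"
  define F where "F = (\<Sum>n. f n)"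
  have lim_ends: "(\<lambda>m. (\<Sum>i<m. x i) * \<Lambda> + L * (\<Sum>i<m. f i)) \<longlonglongrightarrow> \<theta> * \<Lambda> + L * F"
    unfolding \<theta>_def F_def by (intro tendsto_intros summable_LIMSEQ sx sf)
  \<comment> \<open>The total error is split into four parts of size \<open>\<epsilon> / 4\<close>.\<close>
  define d where "d = \<epsilon> / (4 * (K * K' + 1))"
  have "0 < d" using \<open>0 \<le> K\<close> K' \<open>0 < \<epsilon>\<close> by (simp add: d_def add_nonneg_pos)
  have KKd: "K * K' * d \<le> \<epsilon> / 4" using \<open>0 \<le> K\<close> K' \<open>0 < \<epsilon>\<close>
    by (simp add: d_def divide_le_eq add_nonneg_pos add.commute[of 4])
  have "\<forall>\<^sub>F m in sequentially. \<bar>((\<Sum>i<m. x i) * \<Lambda> + L * (\<Sum>i<m. f i)) - (\<theta> * \<Lambda> + L * F)\<bar> < \<epsilon> / 4"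
    using tendstoD[OF lim_ends, of "\<epsilon> / 4"] \<open>0 < \<epsilon>\<close> by (simp add: dist_real_def)
  with Wclass_middle[OF \<gamma> \<open>0 < d\<close>]
  have "\<forall>\<^sub>F m in sequentially. (\<forall>\<^sub>F n in sequentially. (\<Sum>i=m..n-m. \<gamma> (n - i) * \<gamma> i) \<le> d * \<gamma> n)
     \<and> \<bar>((\<Sum>i<m. x i) * \<Lambda> + L * (\<Sum>i<m. f i)) - (\<theta> * \<Lambda> + L * F)\<bar> < \<epsilon> / 4"
    by eventually_elim auto
  from eventually_happens[OF this] obtain m
    where mid: "\<forall>\<^sub>F n in sequentially. (\<Sum>i=m..n-m. \<gamma> (n - i) * \<gamma> i) \<le> d * \<gamma> n"
      and tail: "\<bar>((\<Sum>i<m. x i) * \<Lambda> + L * (\<Sum>i<m. f i)) - (\<theta> * \<Lambda> + L * F)\<bar> < \<epsilon> / 4" by auto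
  have shift: "(\<lambda>n. \<gamma> (n - i) / \<gamma> n) \<longlonglongrightarrow> 1" for i
    by (rule Wclass_shift_left[OF \<gamma> Wclass_ratio[OF \<gamma>]])
  have minus: "filterlim (\<lambda>n. n - i) sequentially sequentially" for i :: nat
    by (rule filterlim_minus_const_nat_at_top)
  have "(\<lambda>n. (x (n - j) / \<gamma> (n - j)) * (\<gamma> (n - j) / \<gamma> n)) \<longlonglongrightarrow> L * 1" for j
    by (intro tendsto_mult shift filterlim_compose[OF x(2) minus])
  then have "(\<lambda>n. x (n - j) / \<gamma> n) \<longlonglongrightarrow> L" for j using pos by (simp add: less_imp_neq[THEN not_sym])
  then have "(\<lambda>n. \<Sum>j<m. (x (n - j) / \<gamma> n) * f j) \<longlonglongrightarrow> (\<Sum>j<m. L * f j)" by (intro tendsto_intros)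
  from tendstoD[OF this, of "\<epsilon> / 4"] \<open>0 < \<epsilon>\<close>
  have right: "\<forall>\<^sub>F n in sequentially. \<bar>(\<Sum>j<m. (x (n - j) / \<gamma> n) * f j) - L * (\<Sum>j<m. f j)\<bar> < \<epsilon> / 4"
    by (simp add: dist_real_def sum_distrib_left)
  have "(\<lambda>n. \<Sum>i<m. x i * ?E i n) \<longlonglongrightarrow>
        (\<Sum>i<m. x i * (w * 1 + \<bar>\<Lambda>\<bar> * \<bar>1 - 1\<bar>))"
    by (intro tendsto_intros shift)
  moreover have "(\<Sum>i<m. x i * (w * 1 + \<bar>\<Lambda>\<bar> * \<bar>1 - 1\<bar>)) < (\<Sum>i<m. x i) * w + \<epsilon> / 4"
    using \<open>0 < \<epsilon>\<close> by (simp add: sum_distrib_right)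
  ultimately have left: "\<forall>\<^sub>F n in sequentially. (\<Sum>i<m. x i * ?E i n)
       < (\<Sum>i<m. x i) * w + \<epsilon> / 4"
    by (rule order_tendstoD(2))
  have near: "\<forall>\<^sub>F n in sequentially. \<forall>i<m. \<bar>f (n - i) / \<gamma> (n - i) - \<Lambda>\<bar> \<le> w"
  proof -
    have "\<forall>\<^sub>F n in sequentially. \<forall>i\<in>{..<m}. \<bar>f (n - i) / \<gamma> (n - i) - \<Lambda>\<bar> \<le> w"
      by (intro eventually_ball_finite ballI) (auto intro: eventually_compose_filterlim[OF f(2) minus])
    then show ?thesis by (simp only: Ball_def lessThan_iff)
  qed
  have "(\<Sum>i<m. x i) * w \<le> \<theta> * w"
    unfolding \<theta>_def by (intro mult_right_mono sum_le_suminf sx) (use x \<open>0 \<le> w\<close> in auto)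
  show ?thesis
    using mid right left near eventually_ge_at_top[of "2 * m"]
  proof eventually_elim
    case (elim n)
    note p = pos[of n]
    let ?A = "\<Sum>i<m. x i * f (n - i)" and ?B = "\<Sum>i=m..n-m. x i * f (n - i)" and ?C = "\<Sum>j<m. x (n - j) * f j"
    have split: "(\<Sum>i\<le>n. x i * f (n - i)) = ?A + ?B + ?C"
    proof -
      have "(\<Sum>j<m. x (n - j) * f (n - (n - j))) = ?C" using elim(5) by (intro sum.cong) auto
      then show ?thesis using sum_split_ends[OF elim(5), of "\<lambda>i. x i * f (n - i)"] by simp
    qed
    have A: "\<bar>?A / \<gamma> n - (\<Sum>i<m. x i) * \<Lambda>\<bar> \<le> (\<Sum>i<m. x i) * w + \<epsilon> / 4"
    proof -
      have "\<bar>?A / \<gamma> n - (\<Sum>i<m. x i) * \<Lambda>\<bar> = \<bar>\<Sum>i<m. x i * (f (n - i) / \<gamma> n - \<Lambda>)\<bar>"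
        by (simp add: sum_divide_distrib sum_distrib_right sum_subtractf right_diff_distrib)
      also have "\<dots> \<le> (\<Sum>i<m. \<bar>x i * (f (n - i) / \<gamma> n - \<Lambda>)\<bar>)" by (rule sum_abs)
      also have "\<dots> \<le> (\<Sum>i<m. x i * ?E i n)"
      proof (rule sum_mono)
        fix i assume "i \<in> {..<m}"
        define r where "r = \<gamma> (n - i) / \<gamma> n"
        have "0 < r" using pos by (simp add: r_def)
        have e: "f (n - i) / \<gamma> n - \<Lambda> = (f (n - i) / \<gamma> (n - i) - \<Lambda>) * r + \<Lambda> * (r - 1)"
        proof -
          have "f (n - i) / \<gamma> (n - i) * r = f (n - i) / \<gamma> n" using pos[of "n - i"] by (simp add: r_def)
          then show ?thesis by (simp add: left_diff_distrib right_diff_distrib)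
        qed
        have "\<bar>f (n - i) / \<gamma> n - \<Lambda>\<bar> \<le> \<bar>f (n - i) / \<gamma> (n - i) - \<Lambda>\<bar> * r + \<bar>\<Lambda>\<bar> * \<bar>r - 1\<bar>"
          unfolding e using \<open>0 < r\<close> by (intro order_trans[OF abs_triangle_ineq]) (simp add: abs_mult)
        also have "\<dots> \<le> w * r + \<bar>\<Lambda>\<bar> * \<bar>r - 1\<bar>"
          using elim(4) \<open>i \<in> _\<close> \<open>0 < r\<close> by (intro add_right_mono mult_right_mono) auto
        finally show "\<bar>x i * (f (n - i) / \<gamma> n - \<Lambda>)\<bar> \<le> x i * ?E i n"
          using x(1)[of i] by (simp add: abs_mult r_def mult_left_mono)
      qed
      finally show ?thesis using elim(3) by simp
    qed
    have B: "\<bar>?B / \<gamma> n\<bar> \<le> \<epsilon> / 4"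
    proof -
      have "\<bar>?B\<bar> \<le> (\<Sum>i=m..n-m. \<bar>x i * f (n - i)\<bar>)" by (rule sum_abs)
      also have "\<dots> \<le> (\<Sum>i=m..n-m. (K' * \<gamma> i) * (K * \<gamma> (n - i)))"
        unfolding abs_mult by (intro sum_mono mult_mono K' f) (use K' less_imp_le[OF pos] in auto)
      also have "\<dots> = K * K' * (\<Sum>i=m..n-m. \<gamma> (n - i) * \<gamma> i)" by (simp add: sum_distrib_left mult_ac)
      also have "\<dots> \<le> K * K' * (d * \<gamma> n)" using elim(1) \<open>0 \<le> K\<close> K' by (intro mult_left_mono) auto
      also have "\<dots> \<le> \<epsilon> / 4 * \<gamma> n" using KKd p by (simp add: mult_right_mono mult.assoc[symmetric])
      finally show ?thesis using p by (simp add: field_simps)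
    qed
    have C: "?C / \<gamma> n = (\<Sum>j<m. (x (n - j) / \<gamma> n) * f j)" by (simp add: sum_divide_distrib)
    have "(\<Sum>i\<le>n. x i * f (n - i)) / \<gamma> n - (L * F + \<theta> * \<Lambda>) =
       (?A / \<gamma> n - (\<Sum>i<m. x i) * \<Lambda>) + ?B / \<gamma> n + (?C / \<gamma> n - L * (\<Sum>j<m. f j))
       + (((\<Sum>i<m. x i) * \<Lambda> + L * (\<Sum>i<m. f i)) - (\<theta> * \<Lambda> + L * F))"
      unfolding split by (simp add: add_divide_distrib)
    then show ?case using A B elim(2) tail C \<open>(\<Sum>i<m. x i) * w \<le> \<theta> * w\<close>
      unfolding \<theta>_def[symmetric] F_def[symmetric] by linarith
  qed
qed

text \<open>
  In the convolution, the terms with small index of \<open>x\<close> multiply an inductive bound \<open>K\<close> for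
  \<open>\<bar>y n\<bar> / \<gamma> n\<close> by about \<open>\<theta>\<close>, the middle terms multiply it by an arbitrarily small number, and the
  finitely many terms with small index of \<open>y\<close> contribute a constant.
\<close>
lemma renewal_bounded:
  fixes x y \<gamma> :: "nat \<Rightarrow> real"
  assumes \<gamma>: "\<gamma> \<in> Wclass 1"
    and x: "\<And>n. 0 \<le> x n" "x 0 = 0" "x sums \<theta>" "\<theta> < 1" "\<And>n. x n \<le> K' * \<gamma> n"
    and y: "\<And>n. y n = x n + s * (\<Sum>i\<le>n. x i * y (n - i))" and s: "\<bar>s\<bar> \<le> 1"
  obtains K where "0 \<le> K" "\<And>n. \<bar>y n\<bar> \<le> K * \<gamma> n"
proof -
  note pos = Wclass_pos[OF \<gamma>]
  have "0 \<le> K'" using order_trans[OF x(1)[of 0] x(5)[of 0]] pos[of 0] by (simp add: zero_le_mult_iff)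
  have "0 \<le> \<theta>" using x(1,3) suminf_nonneg sums_unique sums_summable by metis
  \<comment> \<open>With this choice the factor in front of \<open>K\<close> in the induction step is \<open>\<eta> = (1 + \<theta>) / 2 < 1\<close>.\<close>
  define \<delta> where "\<delta> = (1 - \<theta>) / (2 * (1 + K'))"
  have "0 < \<delta>" using x(4) \<open>0 \<le> K'\<close> by (simp add: \<delta>_def)
  define \<eta> where "\<eta> = (1 + \<theta>) / 2"
  have \<eta>: "\<theta> + \<delta> + K' * \<delta> = \<eta>" "0 \<le> \<eta>" "\<eta> < 1"
  proof -
    have "\<delta> + K' * \<delta> = (1 + K') * \<delta>" by (simp add: algebra_simps)
    also have "\<dots> = (1 - \<theta>) / 2 * ((1 + K') / (1 + K'))" by (simp only: \<delta>_def times_divide_eq_right times_divide_eq_left divide_divide_eq_left mult.commute mult.assoc)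
    also have "\<dots> = (1 - \<theta>) / 2" using \<open>0 \<le> K'\<close> by simp
    finally show "\<theta> + \<delta> + K' * \<delta> = \<eta>" by (simp add: \<eta>_def field_simps)
  qed (use \<open>0 \<le> \<theta>\<close> x(4) in \<open>auto simp: \<eta>_def\<close>)
  from eventually_conj[OF Wclass_middle[OF \<gamma> \<open>0 < \<delta>\<close>] eventually_ge_at_top[of 1]]
  obtain m where mid: "\<forall>\<^sub>F n in sequentially. (\<Sum>i=m..n-m. \<gamma> (n - i) * \<gamma> i) \<le> \<delta> * \<gamma> n" and "1 \<le> m"
    using eventually_happens by force
  have shift: "(\<lambda>n. \<gamma> (n - i) / \<gamma> n) \<longlonglongrightarrow> 1" for i
    by (rule Wclass_shift_left[OF \<gamma> Wclass_ratio[OF \<gamma>]])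
  have "(\<lambda>n. \<Sum>i<m. x i * (\<gamma> (n - i) / \<gamma> n)) \<longlonglongrightarrow> (\<Sum>i<m. x i * 1)"
    by (intro tendsto_intros shift)
  moreover have "(\<Sum>i<m. x i * 1) < \<theta> + \<delta>"
    using sum_le_suminf[of x "{..<m}"] x(1,3) \<open>0 < \<delta>\<close> by (auto simp: sums_iff)
  ultimately have left: "\<forall>\<^sub>F n in sequentially. (\<Sum>i<m. x i * (\<gamma> (n - i) / \<gamma> n)) < \<theta> + \<delta>"
    by (rule order_tendstoD(2))
  define D where "D = (\<Sum>j<m. K' * \<bar>y j\<bar>) + 1"
  have "(\<lambda>n. \<Sum>j<m. K' * (\<gamma> (n - j) / \<gamma> n) * \<bar>y j\<bar>) \<longlonglongrightarrow> (\<Sum>j<m. K' * 1 * \<bar>y j\<bar>)"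
    by (intro tendsto_intros shift)
  then have right: "\<forall>\<^sub>F n in sequentially. (\<Sum>j<m. K' * (\<gamma> (n - j) / \<gamma> n) * \<bar>y j\<bar>) < D"
    by (rule order_tendstoD(2)) (simp add: D_def)
  from eventually_conj[OF eventually_conj[OF mid left] eventually_conj[OF right eventually_ge_at_top[of "2*m"]]]
  obtain N where N: "\<And>n. N \<le> n \<Longrightarrow> (\<Sum>i=m..n-m. \<gamma> (n - i) * \<gamma> i) \<le> \<delta> * \<gamma> n"
      "\<And>n. N \<le> n \<Longrightarrow> (\<Sum>i<m. x i * (\<gamma> (n - i) / \<gamma> n)) < \<theta> + \<delta>"
      "\<And>n. N \<le> n \<Longrightarrow> (\<Sum>j<m. K' * (\<gamma> (n - j) / \<gamma> n) * \<bar>y j\<bar>) < D"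
      "\<And>n. N \<le> n \<Longrightarrow> 2 * m \<le> n"
    unfolding eventually_sequentially by blast
  \<comment> \<open>The first entry covers the indices below \<open>N\<close>; the second one is the fixed point of \<open>K = K' + D + \<eta> * K\<close>.\<close>
  define K where "K = max (\<Sum>i<N. \<bar>y i\<bar> / \<gamma> i) ((K' + D) / (1 - \<eta>))"
  have "0 \<le> (\<Sum>i<N. \<bar>y i\<bar> / \<gamma> i)" by (intro sum_nonneg divide_nonneg_nonneg) (use less_imp_le[OF pos] in auto)
  then have "0 \<le> K" by (simp add: K_def)
  have K2: "K' + D + \<eta> * K \<le> K"
  proof -
    have "(K' + D) / (1 - \<eta>) \<le> K" by (simp add: K_def)
    then show ?thesis using \<eta> by (simp add: field_simps)
  qed
  have "\<bar>y n\<bar> \<le> K * \<gamma> n" for n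
  proof (induction n rule: less_induct)
    case (less n)
    note p = pos[of n]
    show ?case
    proof (cases "n < N")
      case True
      have "\<bar>y n\<bar> / \<gamma> n \<le> (\<Sum>i<N. \<bar>y i\<bar> / \<gamma> i)"
        by (rule member_le_sum[of n _ "\<lambda>i. \<bar>y i\<bar> / \<gamma> i"]) (use True pos in \<open>auto simp: less_imp_le\<close>)
      also have "\<dots> \<le> K" by (simp add: K_def)
      finally show ?thesis using p by (simp add: field_simps)
    next
      case False
      then have n: "N \<le> n" by simp
      have n2: "2 * m \<le> n" using N(4)[OF n] .
      let ?A = "\<Sum>i<m. x i * \<bar>y (n - i)\<bar>" and ?B = "\<Sum>i=m..n-m. x i * \<bar>y (n - i)\<bar>"
        and ?C = "\<Sum>j<m. x (n - j) * \<bar>y (n - (n - j))\<bar>"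
      have IH: "x i * \<bar>y (n - i)\<bar> \<le> x i * (K * \<gamma> (n - i))" for i
      proof (cases "i = 0")
        case True then show ?thesis using x(2) by simp
      next
        case False
        then show ?thesis using less[of "n - i"] n2 \<open>1 \<le> m\<close> x(1)[of i] by (intro mult_left_mono) auto
      qed
      have "\<bar>y n\<bar> \<le> x n + \<bar>s * (\<Sum>i\<le>n. x i * y (n - i))\<bar>"
        using arg_cong[OF y[of n], of abs] abs_triangle_ineq[of "x n" "s * (\<Sum>i\<le>n. x i * y (n - i))"] x(1)[of n]
        by linarith
      also have "\<bar>s * (\<Sum>i\<le>n. x i * y (n - i))\<bar> \<le> 1 * (\<Sum>i\<le>n. x i * \<bar>y (n - i)\<bar>)"
        unfolding abs_mult[of s] using s x(1)
        by (intro mult_mono order_trans[OF sum_abs] sum_mono) (auto simp: abs_mult)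
      also have "(\<Sum>i\<le>n. x i * \<bar>y (n - i)\<bar>) = ?A + ?B + ?C"
        by (rule sum_split_ends[OF n2])
      finally have total: "\<bar>y n\<bar> \<le> x n + (?A + ?B + ?C)" by simp
      have "?A \<le> (\<Sum>i<m. x i * (K * \<gamma> (n - i)))"
        by (intro sum_mono IH)
      also have "\<dots> = K * \<gamma> n * (\<Sum>i<m. x i * (\<gamma> (n - i) / \<gamma> n))"
        using p by (simp add: sum_distrib_left mult_ac)
      also have "\<dots> \<le> K * \<gamma> n * (\<theta> + \<delta>)" using N(2)[OF n] \<open>0 \<le> K\<close> p by (intro mult_left_mono) auto
      finally have A: "?A \<le> K * \<gamma> n * (\<theta> + \<delta>)" .
      have "?B \<le> (\<Sum>i=m..n-m. K' * \<gamma> i * (K * \<gamma> (n - i)))"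
        by (intro sum_mono order_trans[OF IH] mult_right_mono x) (use \<open>0 \<le> K\<close> less_imp_le[OF pos] in auto)
      also have "\<dots> = K * K' * (\<Sum>i=m..n-m. \<gamma> (n - i) * \<gamma> i)" by (simp add: sum_distrib_left mult_ac)
      also have "\<dots> \<le> K * K' * (\<delta> * \<gamma> n)" using N(1)[OF n] \<open>0 \<le> K\<close> \<open>0 \<le> K'\<close> by (intro mult_left_mono) auto
      finally have B: "?B \<le> K * K' * (\<delta> * \<gamma> n)" .
      have "?C \<le> (\<Sum>j<m. K' * \<gamma> (n - j) * \<bar>y j\<bar>)"
        using n2 by (intro sum_mono mult_mono x) (use less_imp_le[OF pos] \<open>0 \<le> K'\<close> in auto)
      also have "\<dots> = \<gamma> n * (\<Sum>j<m. K' * (\<gamma> (n - j) / \<gamma> n) * \<bar>y j\<bar>)"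
        using p by (simp add: sum_distrib_left mult_ac)
      also have "\<dots> \<le> \<gamma> n * D" using N(3)[OF n] p by (intro mult_left_mono) auto
      finally have C: "?C \<le> \<gamma> n * D" .
      have "\<bar>y n\<bar> \<le> K' * \<gamma> n + (K * \<gamma> n * (\<theta> + \<delta>) + K * K' * (\<delta> * \<gamma> n) + \<gamma> n * D)"
        by (rule order_trans[OF total add_mono[OF x(5) add_mono[OF add_mono[OF A B] C]]])
      also have "\<dots> = (K' + D + (\<theta> + \<delta> + K' * \<delta>) * K) * \<gamma> n" by (simp add: algebra_simps)
      also have "\<dots> \<le> K * \<gamma> n" using K2 p \<eta>(1) by (intro mult_right_mono) auto
      finally show ?thesis .
    qed
  qed
  then show ?thesis using that \<open>0 \<le> K\<close> by blast
qed

text \<open>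
  The convolution lemma improves an eventual bound \<open>w\<close> for \<open>\<bar>y n / \<gamma> n - \<Lambda>\<bar>\<close> to \<open>\<theta> * w + \<epsilon>\<close>, where
  \<open>\<Lambda>\<close> is the value forced by passing to the limit in the equation.  The sign \<open>s\<close> covers both the
  passage from a kernel to its resolvent and the passage back.
\<close>
lemma renewal_asymptotics:
  fixes x y \<gamma> :: "nat \<Rightarrow> real"
  assumes \<gamma>: "\<gamma> \<in> Wclass 1"
    and x: "\<And>n. 0 \<le> x n" "x 0 = 0" "x sums \<theta>" "\<theta> < 1" "(\<lambda>n. x n / \<gamma> n) \<longlonglongrightarrow> L"
    and y: "\<And>n. y n = x n + s * (\<Sum>i\<le>n. x i * y (n - i))" and s: "\<bar>s\<bar> \<le> 1"
  shows "(\<lambda>n. y n / \<gamma> n) \<longlonglongrightarrow> L / (1 - s * \<theta>)\<^sup>2"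
proof -
  note pos = Wclass_pos[OF \<gamma>]
  obtain K' where "0 < K'" and K': "\<And>n. \<bar>x n\<bar> \<le> K' * \<gamma> n" using convergent_ratio_bounded[OF pos x(5)] by blast
  have K'': "x n \<le> K' * \<gamma> n" for n using K'[of n] by linarith
  obtain K where K: "0 \<le> K" "\<And>n. \<bar>y n\<bar> \<le> K * \<gamma> n"
    using renewal_bounded[OF \<gamma> x(1-4) K'' y s] by blast
  have sy: "summable (\<lambda>n. \<bar>y n\<bar>)"
    by (rule summable_comparison_test'[of "\<lambda>n. K * \<gamma> n" 0])
       (use K Wclass_summable[OF \<gamma>] in \<open>auto intro: summable_mult\<close>)
  have sx: "summable x" "(\<Sum>n. x n) = \<theta>" using x(3) by (auto simp: sums_iff)
  have "0 \<le> \<theta>" using sx x(1) suminf_nonneg by metis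
  have "\<bar>s * \<theta>\<bar> \<le> 1 * \<theta>" unfolding abs_mult using s \<open>0 \<le> \<theta>\<close> by (intro mult_mono) auto
  then have s\<theta>: "s * \<theta> < 1" using x(4) by linarith
  define Y where "Y = (\<Sum>n. y n)"
  have Y: "Y = \<theta> + s * (\<theta> * Y)"
  proof -
    have c: "(\<lambda>n. \<Sum>i\<le>n. x i * y (n - i)) sums (\<theta> * Y)"
      unfolding Y_def sx(2)[symmetric] by (rule Cauchy_product_sums) (use sx sy x(1) in auto)
    have "(\<lambda>n. x n + s * (\<Sum>i\<le>n. x i * y (n - i))) sums (\<theta> + s * (\<theta> * Y))"
      by (intro sums_add x(3) sums_mult c)
    moreover have "(\<lambda>n. x n + s * (\<Sum>i\<le>n. x i * y (n - i))) = y" by (rule ext) (rule y[symmetric])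
    ultimately have "y sums (\<theta> + s * (\<theta> * Y))" by (simp only:)
    from sums_unique[OF this] show ?thesis by (simp only: Y_def)
  qed
  \<comment> \<open>The solution of the equation that the limit of \<open>y n / \<gamma> n\<close> must satisfy.\<close>
  define \<Lambda> where "\<Lambda> = L * (1 + s * Y) / (1 - s * \<theta>)"
  have \<Lambda>: "\<Lambda> = L + s * (L * Y + \<theta> * \<Lambda>)" using s\<theta> by (simp add: \<Lambda>_def field_simps)
  have "(1 - s * \<theta>) * (1 + s * Y) = 1 + s * (Y - (\<theta> + s * (\<theta> * Y)))" by (simp add: algebra_simps)
  moreover have "Y - (\<theta> + s * (\<theta> * Y)) = 0" using Y by linarith
  ultimately have "(1 - s * \<theta>) * (1 + s * Y) = 1" by simp
  moreover have ne: "1 - s * \<theta> \<noteq> 0" using s\<theta> by simp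
  ultimately have "1 + s * Y = 1 / (1 - s * \<theta>)"
    by (subst nonzero_eq_divide_eq[OF ne], subst mult.commute)
  then have \<Lambda>_eq: "\<Lambda> = L / (1 - s * \<theta>)\<^sup>2" by (simp add: \<Lambda>_def power2_eq_square)
  have "(\<lambda>n. y n / \<gamma> n - \<Lambda>) \<longlonglongrightarrow> 0"
  proof (rule contraction_tendsto_zero[OF \<open>0 \<le> \<theta>\<close> x(4)])
    have "\<bar>y n / \<gamma> n - \<Lambda>\<bar> \<le> K + \<bar>\<Lambda>\<bar>" for n
    proof -
      have "\<bar>y n / \<gamma> n\<bar> \<le> K" using K(2)[of n] pos[of n] by (simp add: field_simps abs_divide)
      then show ?thesis by linarith
    qed
    then show "\<forall>\<^sub>F n in sequentially. \<bar>y n / \<gamma> n - \<Lambda>\<bar> \<le> K + \<bar>\<Lambda>\<bar>" by simp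
  next
    fix w \<epsilon> :: real
    assume "0 < \<epsilon>" and near: "\<forall>\<^sub>F n in sequentially. \<bar>y n / \<gamma> n - \<Lambda>\<bar> \<le> w"
    then have "0 < \<epsilon> / 2" by simp
    have "\<forall>\<^sub>F n in sequentially. \<bar>x n / \<gamma> n - L\<bar> < \<epsilon> / 2"
      using tendstoD[OF x(5) \<open>0 < \<epsilon> / 2\<close>] by (simp add: dist_real_def)
    with convolution_near_limit[OF \<gamma> x(1,5) K(2) near \<open>0 < \<epsilon> / 2\<close>]
    show "\<forall>\<^sub>F n in sequentially. \<bar>y n / \<gamma> n - \<Lambda>\<bar> \<le> \<theta> * w + \<epsilon>"
    proof eventually_elim
      case (elim n)
      define c where "c = (\<Sum>i\<le>n. x i * y (n - i)) / \<gamma> n - (L * Y + \<theta> * \<Lambda>)"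
      have "\<bar>c\<bar> \<le> \<theta> * w + \<epsilon> / 2" using elim(1) unfolding sx(2) Y_def[symmetric] c_def .
      moreover have "y n / \<gamma> n - \<Lambda> = (x n / \<gamma> n - L) + s * c" unfolding c_def
        unfolding arg_cong2[OF y[of n] \<Lambda>, of "\<lambda>u v. u / \<gamma> n - v"]
        by (simp add: add_divide_distrib right_diff_distrib)
      moreover have "\<bar>s * c\<bar> \<le> \<bar>c\<bar>" using mult_right_mono[OF s, of "\<bar>c\<bar>"] by (simp add: abs_mult)
      ultimately show ?case using elim(2) by linarith
    qed
  qed
  then show ?thesis unfolding \<Lambda>_eq[symmetric] by (rule LIM_zero_cancel)
qed

section \<open>Correlations with decreasing weights\<close>

text \<open>
  The counterpart of the convolution lemma for correlations.  Monotonicity of \<open>\<gamma>\<close> bounds the quotients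
  \<open>\<gamma> (n + j) / \<gamma> n\<close> by \<open>1\<close>, so that Tannery's theorem applies.
\<close>
lemma correlation_near_limit:
  fixes y f \<gamma> :: "nat \<Rightarrow> real"
  assumes \<gamma>: "\<gamma> \<in> Wclass 1" "decseq \<gamma>"
    and y: "\<And>n. 0 \<le> y n" "summable y"
    and f: "\<And>n. \<bar>f n\<bar> \<le> K * \<gamma> n" "\<forall>\<^sub>F n in sequentially. \<bar>f n / \<gamma> n - \<Lambda>\<bar> \<le> w"
    and "0 < \<epsilon>"
  shows "\<forall>\<^sub>F n in sequentially. \<bar>(\<Sum>j. y j * f (n + j)) / \<gamma> n - (\<Sum>j. y j) * \<Lambda>\<bar> \<le> (\<Sum>j. y j) * w + \<epsilon>"
proof -
  note pos = Wclass_pos[OF \<gamma>(1)]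
  have dec: "\<gamma> (n + j) / \<gamma> n \<le> 1" for n j
    using decseqD[OF \<gamma>(2), of n "n + j"] pos[of n] by simp
  have rnn: "0 \<le> \<gamma> (n + j) / \<gamma> n" for n j using pos by (simp add: less_imp_le)
  from eventually_happens[OF f(2)] have "0 \<le> w" by auto
  have "0 \<le> K" using order_trans[OF abs_ge_zero f(1)[of 0]] pos[of 0] by (simp add: zero_le_mult_iff)
  define e where "e = (\<lambda>n. \<Sum>j. y j * (1 - \<gamma> (n + j) / \<gamma> n))"
  have se: "summable (\<lambda>j. y j * (1 - \<gamma> (n + j) / \<gamma> n))" for n
  proof (rule summable_comparison_test'[OF y(2), of 0])
    fix j :: nat
    have "y j * (1 - \<gamma> (n + j) / \<gamma> n) \<le> y j * 1" using y(1) rnn[of n j] by (intro mult_left_mono) auto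
    then show "norm (y j * (1 - \<gamma> (n + j) / \<gamma> n)) \<le> y j" using y(1)[of j] dec[of n j] by simp
  qed
  have "e \<longlonglongrightarrow> (\<Sum>j. y j * (1 - 1))"
    unfolding e_def
  proof (rule tannery_sequential[OF _ _ y(2)])
    show "(\<lambda>n. y k * (1 - \<gamma> (n + k) / \<gamma> n)) \<longlonglongrightarrow> y k * (1 - 1)" for k
      by (intro tendsto_intros ratio_shift_right[OF pos Wclass_ratio[OF \<gamma>(1)]])
    have "\<bar>y j * (1 - \<gamma> (n + j) / \<gamma> n)\<bar> \<le> y j" for n j
    proof -
      have "y j * (1 - \<gamma> (n + j) / \<gamma> n) \<le> y j * 1" using y(1) rnn[of n j] by (intro mult_left_mono) auto
      then show ?thesis using y(1)[of j] dec[of n j] by simp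
    qed
    then show "\<forall>\<^sub>F n in sequentially. \<forall>k. \<bar>y k * (1 - \<gamma> (n + k) / \<gamma> n)\<bar> \<le> y k" by simp
  qed
  then have "(\<lambda>n. \<bar>\<Lambda>\<bar> * e n) \<longlonglongrightarrow> \<bar>\<Lambda>\<bar> * 0" by (intro tendsto_intros) simp
  then have "\<forall>\<^sub>F n in sequentially. \<bar>\<Lambda>\<bar> * e n < \<epsilon>" by (rule order_tendstoD(2)) (use \<open>0 < \<epsilon>\<close> in simp)
  moreover have "\<forall>\<^sub>F n in sequentially. \<forall>k\<ge>n. \<bar>f k / \<gamma> k - \<Lambda>\<bar> \<le> w"
    using f(2) by (auto simp: eventually_sequentially) (meson order_trans)
  ultimately show ?thesis
  proof eventually_elim
    case (elim n)
    have sf: "summable (\<lambda>j. y j * f (n + j) / \<gamma> n)"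
    proof (rule summable_comparison_test'[of "\<lambda>j. y j * K" 0])
      show "summable (\<lambda>j. y j * K)" by (intro summable_mult2 y)
      fix j :: nat
      have "\<bar>f (n + j)\<bar> / \<gamma> n \<le> K * \<gamma> (n + j) / \<gamma> n" using f(1)[of "n + j"] pos[of n] by (simp add: divide_right_mono)
      also have "\<dots> \<le> K * 1" using dec[of n j] \<open>0 \<le> K\<close> by (simp only: times_divide_eq_right[symmetric] mult_left_mono)
      finally have "y j * (\<bar>f (n + j)\<bar> / \<gamma> n) \<le> y j * (K * 1)" using y(1) by (intro mult_left_mono) auto
      then show "norm (y j * f (n + j) / \<gamma> n) \<le> y j * K" using pos[of n] y(1)[of j] by (simp add: abs_mult abs_divide)
    qed
    have sL: "summable (\<lambda>j. y j * \<Lambda>)" by (intro summable_mult2 y)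
    have pw: "\<bar>y j * f (n + j) / \<gamma> n - y j * \<Lambda>\<bar> \<le> y j * w + \<bar>\<Lambda>\<bar> * (y j * (1 - \<gamma> (n + j) / \<gamma> n))" for j
    proof -
      define r where "r = \<gamma> (n + j) / \<gamma> n"
      have r: "0 \<le> r" "r \<le> 1" using rnn dec by (auto simp: r_def)
      have e: "f (n + j) / \<gamma> n - \<Lambda> = (f (n + j) / \<gamma> (n + j) - \<Lambda>) * r + \<Lambda> * (r - 1)"
      proof -
        have "f (n + j) / \<gamma> (n + j) * r = f (n + j) / \<gamma> n" using pos[of "n + j"] by (simp add: r_def)
        then show ?thesis by (simp add: left_diff_distrib right_diff_distrib)
      qed
      have "\<bar>f (n + j) / \<gamma> n - \<Lambda>\<bar> \<le> \<bar>f (n + j) / \<gamma> (n + j) - \<Lambda>\<bar> * r + \<bar>\<Lambda>\<bar> * (1 - r)"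
        unfolding e using r by (intro order_trans[OF abs_triangle_ineq]) (simp add: abs_mult)
      also have "\<dots> \<le> w * 1 + \<bar>\<Lambda>\<bar> * (1 - r)"
        using elim(2) r by (intro add_right_mono mult_mono) auto
      finally have "y j * \<bar>f (n + j) / \<gamma> n - \<Lambda>\<bar> \<le> y j * (w * 1 + \<bar>\<Lambda>\<bar> * (1 - r))"
        using y(1) by (intro mult_left_mono) auto
      moreover have "\<bar>y j * f (n + j) / \<gamma> n - y j * \<Lambda>\<bar> = y j * \<bar>f (n + j) / \<gamma> n - \<Lambda>\<bar>"
        using y(1)[of j] by (simp add: abs_mult right_diff_distrib[symmetric] times_divide_eq_right[symmetric] del: times_divide_eq_right)
      ultimately show ?thesis by (simp add: r_def distrib_left mult_ac)
    qed
    have "(\<Sum>j. y j * f (n + j)) / \<gamma> n - (\<Sum>j. y j) * \<Lambda> = (\<Sum>j. y j * f (n + j) / \<gamma> n - y j * \<Lambda>)"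
    proof -
      have "summable (\<lambda>j. y j * f (n + j))" using summable_mult2[OF sf, of "\<gamma> n"] pos[of n] by simp
      then show ?thesis using suminf_diff[OF sf sL] suminf_mult2[OF y(2), of \<Lambda>] by (simp add: suminf_divide)
    qed
    also have "\<bar>\<dots>\<bar> \<le> (\<Sum>j. y j * w + \<bar>\<Lambda>\<bar> * (y j * (1 - \<gamma> (n + j) / \<gamma> n)))"
    proof -
      have s1: "summable (\<lambda>j. y j * w + \<bar>\<Lambda>\<bar> * (y j * (1 - \<gamma> (n + j) / \<gamma> n)))"
        by (intro summable_add summable_mult2 summable_mult y se)
      have s2: "summable (\<lambda>j. \<bar>y j * f (n + j) / \<gamma> n - y j * \<Lambda>\<bar>)"
        by (rule summable_comparison_test'[OF s1, of 0]) (use pw in simp)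
      show ?thesis
        by (rule order_trans[OF summable_rabs[OF s2] suminf_le[OF pw s2 s1]])
    qed
    also have "\<dots> = (\<Sum>j. y j) * w + \<bar>\<Lambda>\<bar> * e n"
      unfolding e_def by (simp add: suminf_add[symmetric] suminf_mult[OF se, symmetric] suminf_mult2[OF y(2), symmetric] summable_mult2 summable_mult y se)
    also have "\<dots> \<le> (\<Sum>j. y j) * w + \<epsilon>" using elim(1) by simp
    finally show ?case .
  qed
qed

lemma correlation_asymptotics:
  fixes y f \<gamma> :: "nat \<Rightarrow> real"
  assumes \<gamma>: "\<gamma> \<in> Wclass 1" "decseq \<gamma>"
    and y: "\<And>n. 0 \<le> y n" "summable y"
    and f: "(\<lambda>n. f n / \<gamma> n) \<longlonglongrightarrow> L"
  shows "(\<lambda>n. (\<Sum>j. y j * f (n + j)) / \<gamma> n) \<longlonglongrightarrow> (\<Sum>j. y j) * L"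
proof (rule tendstoI)
  fix e :: real assume "0 < e"
  obtain K where "0 < K" and K: "\<And>n. \<bar>f n\<bar> \<le> K * \<gamma> n" using convergent_ratio_bounded[OF Wclass_pos[OF \<gamma>(1)] f] by blast
  have Y: "0 \<le> (\<Sum>j. y j)" using y by (simp add: suminf_nonneg)
  define w where "w = e / 4 / ((\<Sum>j. y j) + 1)"
  have "0 < w" using \<open>0 < e\<close> Y by (simp add: w_def)
  have "(\<Sum>j. y j) + 1 \<noteq> 0" using Y by simp
  then have "((\<Sum>j. y j) + 1) * w = e / 4" unfolding w_def by (rule nonzero_mult_div_cancel_left[of _ "e / 4", unfolded times_divide_eq_right[symmetric]])
  then have Yw: "(\<Sum>j. y j) * w \<le> e / 4" using \<open>0 < w\<close> by (simp add: distrib_right)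
  have near: "\<forall>\<^sub>F n in sequentially. \<bar>f n / \<gamma> n - L\<bar> \<le> w"
    using tendstoD[OF f \<open>0 < w\<close>] by eventually_elim (simp add: dist_real_def)
  have "0 < e / 4" using \<open>0 < e\<close> by simp
  from correlation_near_limit[OF \<gamma> y K near this]
  show "\<forall>\<^sub>F n in sequentially. dist ((\<Sum>j. y j * f (n + j)) / \<gamma> n) ((\<Sum>j. y j) * L) < e"
    by eventually_elim (use Yw \<open>0 < e\<close> in \<open>simp add: dist_real_def\<close>)
qed

text \<open>
  Since \<open>0 \<le> z n \<le> r n\<close>, the quotients \<open>z n / \<gamma> n\<close> are bounded; the equation
  \<open>z n = r n - (\<Sum>j\<ge>1. z j * z (n + j))\<close> is then a contraction with constant \<open>\<Sum>j\<ge>1. z j\<close>.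
\<close>
lemma correlation_asymptotics_inverse:
  fixes z r \<gamma> :: "nat \<Rightarrow> real"
  assumes \<gamma>: "\<gamma> \<in> Wclass 1" "decseq \<gamma>"
    and z: "\<And>n. 0 \<le> z n" "summable z" "z 0 = 1" "(\<Sum>j. z (Suc j)) < 1"
    and r: "\<And>n. r n = (\<Sum>j. z j * z (n + j))" "(\<lambda>n. r n / \<gamma> n) \<longlonglongrightarrow> L"
  shows "(\<lambda>n. z n / \<gamma> n) \<longlonglongrightarrow> L / (\<Sum>j. z j)"
proof -
  note pos = Wclass_pos[OF \<gamma>(1)]
  obtain K where "0 < K" and K: "\<And>n. \<bar>r n\<bar> \<le> K * \<gamma> n" using convergent_ratio_bounded[OF pos r(2)] by blast
  define y where "y = (\<lambda>n. if n = 0 then 0 else z n)"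
  have y: "\<And>n. 0 \<le> y n" "y 0 = 0" "\<And>n. y (Suc n) = z (Suc n)" using z by (auto simp: y_def)
  have sy: "summable y" using z(2) y(3) by (subst summable_Suc_iff[symmetric]) (simp add: summable_Suc_iff)
  define \<theta> where "\<theta> = (\<Sum>j. y j)"
  have \<theta>: "\<theta> = (\<Sum>j. z (Suc j))" unfolding \<theta>_def using suminf_split_head[OF sy] y by simp
  have \<theta>1: "0 \<le> \<theta>" "\<theta> < 1" using z(4) \<theta> suminf_nonneg[OF sy y(1)] by (simp_all only: \<theta>_def)
  have Z: "(\<Sum>j. z j) = 1 + \<theta>" using suminf_split_head[OF z(2)] z(3) \<theta> by simp
  have zle: "z n \<le> (\<Sum>j. z j)" for n
    using sum_le_suminf[OF z(2), of "{n}"] z(1) by simp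
  have sz: "summable (\<lambda>j. z j * z (n + j))" for n
  proof (rule summable_comparison_test'[OF summable_mult2[OF z(2), of "\<Sum>j. z j"], of 0])
    fix j :: nat
    show "norm (z j * z (n + j)) \<le> z j * (\<Sum>j. z j)" using z(1) zle[of "n + j"] by (simp add: abs_mult mult_left_mono)
  qed
  have syz: "summable (\<lambda>j. y j * z (n + j))" for n
    by (rule summable_comparison_test'[OF sz[of n], of 0]) (use z in \<open>auto simp: y_def\<close>)
  have rec: "r n = z n + (\<Sum>j. y j * z (n + j))" for n
    unfolding r(1) using suminf_split_head[OF sz[of n]] suminf_split_head[OF syz[of n]] z(3) y by simp
  have zK: "\<bar>z n\<bar> \<le> K * \<gamma> n" for n
  proof -
    have "0 \<le> (\<Sum>j. y j * z (n + j))"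
      by (rule suminf_nonneg[OF syz]) (use y z in auto)
    then have "z n \<le> r n" using rec[of n] by simp
    then show ?thesis using K[of n] z(1)[of n] by simp
  qed
  define \<Lambda> where "\<Lambda> = L / (\<Sum>j. z j)"
  have "(1 + \<theta>) * \<Lambda> = L" using \<theta>1 by (simp add: \<Lambda>_def Z)
  then have \<Lambda>: "\<Lambda> + \<theta> * \<Lambda> = L" by (simp add: distrib_right)
  have "(\<lambda>n. z n / \<gamma> n - \<Lambda>) \<longlonglongrightarrow> 0"
  proof (rule contraction_tendsto_zero[OF \<theta>1])
    have "\<bar>z n / \<gamma> n - \<Lambda>\<bar> \<le> K + \<bar>\<Lambda>\<bar>" for n
    proof -
      have "\<bar>z n / \<gamma> n\<bar> \<le> K" using zK[of n] pos[of n] by (simp add: abs_divide pos_divide_le_eq)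
      then show ?thesis by linarith
    qed
    then show "\<forall>\<^sub>F n in sequentially. \<bar>z n / \<gamma> n - \<Lambda>\<bar> \<le> K + \<bar>\<Lambda>\<bar>" by simp
  next
    fix w \<epsilon> :: real
    assume "0 < \<epsilon>" and near: "\<forall>\<^sub>F n in sequentially. \<bar>z n / \<gamma> n - \<Lambda>\<bar> \<le> w"
    then have "0 < \<epsilon> / 2" by simp
    have "\<forall>\<^sub>F n in sequentially. \<bar>r n / \<gamma> n - L\<bar> < \<epsilon> / 2"
      using tendstoD[OF r(2) \<open>0 < \<epsilon> / 2\<close>] by (simp add: dist_real_def)
    with correlation_near_limit[OF \<gamma> y(1) sy zK near \<open>0 < \<epsilon> / 2\<close>]
    show "\<forall>\<^sub>F n in sequentially. \<bar>z n / \<gamma> n - \<Lambda>\<bar> \<le> \<theta> * w + \<epsilon>"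
    proof eventually_elim
      case (elim n)
      have "z n / \<gamma> n - \<Lambda> = (r n / \<gamma> n - L) - ((\<Sum>j. y j * z (n + j)) / \<gamma> n - \<theta> * \<Lambda>)"
        using \<Lambda> by (simp add: rec add_divide_distrib)
      then show ?case using elim unfolding \<theta>_def[symmetric] by linarith
    qed
  qed
  then show ?thesis unfolding \<Lambda>_def by (rule LIM_zero_cancel)
qed

section \<open>Square roots of renewal sequences\<close>

lemma sum_Cauchy_product_le:
  fixes f g :: "nat \<Rightarrow> real"
  assumes "\<And>n. 0 \<le> f n" "\<And>n. 0 \<le> g n"
  shows "(\<Sum>n\<le>K. \<Sum>i\<le>n. f i * g (n - i)) \<le> (\<Sum>n\<le>K. f n) * (\<Sum>n\<le>K. g n)"
proof -
  have "(\<Sum>n\<le>K. \<Sum>i\<le>n. f i * g (n - i)) = (\<Sum>(i,j)\<in>{(i,j). i + j \<le> K}. f i * g j)"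
    by (rule sum.triangle_reindex_eq[symmetric])
  also have "\<dots> \<le> (\<Sum>(i,j)\<in>{..K} \<times> {..K}. f i * g j)"
    by (rule sum_mono2) (use assms in auto)
  also have "\<dots> = (\<Sum>n\<le>K. f n) * (\<Sum>n\<le>K. g n)" by (simp add: sum_product sum.cartesian_product)
  finally show ?thesis .
qed

lemma sqrt_sum_le_sum_sqrt:
  assumes "\<And>i. i \<in> A \<Longrightarrow> 0 \<le> f i"
  shows "sqrt (\<Sum>i\<in>A. f i) \<le> (\<Sum>i\<in>A. sqrt (f i))"
  using assms
proof (induction A rule: infinite_finite_induct)
  case (insert x A)
  have "sqrt (f x + sum f A) \<le> sqrt (f x) + sqrt (sum f A)"
    by (rule sqrt_add_le_add_sqrt) (auto intro!: sum_nonneg insert)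
  also have "sqrt (sum f A) \<le> (\<Sum>i\<in>A. sqrt (f i))" using insert by auto
  finally show ?case using insert by simp
qed auto

text \<open>
  On series with non-negative coefficients, the sum of the square roots of the coefficients is
  subadditive and submultiplicative, like a norm (it is the square root of the quasi-norm of
  \<open>l\<^sup>1\<^sup>/\<^sup>2\<close>).  Truncating at \<open>K\<close> keeps these properties and makes every quantity finite, so that
  bounds uniform in \<open>K\<close> yield summability.
\<close>
definition sqrt_mass :: "nat \<Rightarrow> real fps \<Rightarrow> real" where
  "sqrt_mass K f = (\<Sum>n\<le>K. sqrt (fps_nth f n))"

lemma sqrt_mass_nonneg: "(\<And>n. 0 \<le> fps_nth f n) \<Longrightarrow> 0 \<le> sqrt_mass K f"
  by (simp add: sqrt_mass_def sum_nonneg)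

lemma sqrt_mass_add:
  assumes "\<And>n. 0 \<le> fps_nth f n" "\<And>n. 0 \<le> fps_nth g n"
  shows "sqrt_mass K (f + g) \<le> sqrt_mass K f + sqrt_mass K g"
  unfolding sqrt_mass_def sum.distrib[symmetric]
  by (intro sum_mono) (simp add: assms sqrt_add_le_add_sqrt)

lemma fps_mult_nonneg:
  fixes f g :: "real fps"
  assumes "\<And>n. 0 \<le> fps_nth f n" "\<And>n. 0 \<le> fps_nth g n"
  shows "0 \<le> fps_nth (f * g) n"
  by (simp add: fps_mult_nth sum_nonneg assms)

lemma fps_power_nonneg:
  fixes f :: "real fps"
  assumes "\<And>n. 0 \<le> fps_nth f n"
  shows "0 \<le> fps_nth (f ^ k) n"
proof (induction k arbitrary: n)
  case (Suc k)
  then show ?case using fps_mult_nonneg[OF assms, of "f ^ k"] by simp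
qed (simp add: fps_one_nth)

lemma sqrt_mass_mult:
  assumes f: "\<And>n. 0 \<le> fps_nth f n" and g: "\<And>n. 0 \<le> fps_nth g n"
  shows "sqrt_mass K (f * g) \<le> sqrt_mass K f * sqrt_mass K g"
proof -
  have "sqrt_mass K (f * g) \<le> (\<Sum>n\<le>K. \<Sum>i\<le>n. sqrt (fps_nth f i) * sqrt (fps_nth g (n - i)))"
    unfolding sqrt_mass_def fps_mult_nth atLeast0AtMost
    by (intro sum_mono order_trans[OF sqrt_sum_le_sum_sqrt]) (auto simp: f g real_sqrt_mult)
  also have "\<dots> \<le> sqrt_mass K f * sqrt_mass K g"
    unfolding sqrt_mass_def by (rule sum_Cauchy_product_le) (auto simp: f g)
  finally show ?thesis .
qed

text \<open>
  The mass with exponential weight \<open>R ^ n\<close>.  For \<open>R > 1\<close> it controls \<open>sqrt_mass\<close> by Cauchy-Schwarz,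
  with a constant that depends on \<open>R\<close> only.
\<close>
definition weighted_mass :: "real \<Rightarrow> nat \<Rightarrow> real fps \<Rightarrow> real" where
  "weighted_mass R K f = (\<Sum>n\<le>K. fps_nth f n * R ^ n)"

lemma weighted_mass_mult:
  assumes f: "\<And>n. 0 \<le> fps_nth f n" and g: "\<And>n. 0 \<le> fps_nth g n" and R: "0 \<le> R"
  shows "weighted_mass R K (f * g) \<le> weighted_mass R K f * weighted_mass R K g"
proof -
  have "weighted_mass R K (f * g) = (\<Sum>n\<le>K. \<Sum>i\<le>n. (fps_nth f i * R ^ i) * (fps_nth g (n - i) * R ^ (n - i)))"
    unfolding weighted_mass_def fps_mult_nth atLeast0AtMost sum_distrib_right
  proof (intro sum.cong refl)
    fix n i :: nat assume "i \<in> {..n}"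
    then have "R ^ n = R ^ i * R ^ (n - i)" by (simp flip: power_add)
    then show "fps_nth f i * fps_nth g (n - i) * R ^ n = (fps_nth f i * R ^ i) * (fps_nth g (n - i) * R ^ (n - i))"
      by simp
  qed
  also have "\<dots> \<le> weighted_mass R K f * weighted_mass R K g"
    unfolding weighted_mass_def by (rule sum_Cauchy_product_le) (auto simp: f g R)
  finally show ?thesis .
qed

lemma sqrt_mass_le_weighted_mass:
  assumes f: "\<And>n. 0 \<le> fps_nth f n" and R: "1 < R"
  shows "sqrt_mass K f \<le> sqrt (1 / (1 - 1 / R)) * sqrt (weighted_mass R K f)"
proof -
  have "(\<Sum>n\<le>K. sqrt (fps_nth f n * R ^ n) * sqrt ((1 / R) ^ n))\<^sup>2
      \<le> (\<Sum>n\<le>K. (sqrt (fps_nth f n * R ^ n))\<^sup>2) * (\<Sum>n\<le>K. (sqrt ((1 / R) ^ n))\<^sup>2)"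
    by (rule Cauchy_Schwarz_ineq_sum)
  also have "(\<Sum>n\<le>K. (sqrt (fps_nth f n * R ^ n))\<^sup>2) = weighted_mass R K f"
    unfolding weighted_mass_def using f R by (intro sum.cong) auto
  also have "(\<Sum>n\<le>K. (sqrt ((1 / R) ^ n))\<^sup>2) = (\<Sum>n\<le>K. (1 / R) ^ n)"
    using R by (intro sum.cong) auto
  also have "weighted_mass R K f * (\<Sum>n\<le>K. (1 / R) ^ n) \<le> weighted_mass R K f * (1 / (1 - 1 / R))"
  proof (rule mult_left_mono)
    have "norm (1 / R) < 1" using R by simp
    from sum_le_suminf[OF summable_geometric[OF this], of "{..K}"] suminf_geometric[OF this]
    show "(\<Sum>n\<le>K. (1 / R) ^ n) \<le> 1 / (1 - 1 / R)" using R by simp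
    show "0 \<le> weighted_mass R K f" using f R by (auto simp: weighted_mass_def intro!: sum_nonneg)
  qed
  finally have "(\<Sum>n\<le>K. sqrt (fps_nth f n * R ^ n) * sqrt ((1 / R) ^ n))\<^sup>2 \<le> 1 / (1 - 1 / R) * weighted_mass R K f"
    by (simp add: mult.commute)
  moreover have "(\<Sum>n\<le>K. sqrt (fps_nth f n * R ^ n) * sqrt ((1 / R) ^ n)) = sqrt_mass K f"
    unfolding sqrt_mass_def real_sqrt_mult[symmetric] using R by (intro sum.cong) (auto simp: power_divide)
  ultimately have "(sqrt_mass K f)\<^sup>2 \<le> 1 / (1 - 1 / R) * weighted_mass R K f" by simp
  then have "sqrt_mass K f \<le> sqrt (1 / (1 - 1 / R) * weighted_mass R K f)" by (rule real_le_rsqrt)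
  then show ?thesis by (simp only: real_sqrt_mult)
qed

lemma exp_weight_exists:
  fixes p :: "nat \<Rightarrow> real"
  assumes "(\<Sum>n<M. p n) < s"
  obtains R where "1 < R" "(\<Sum>n<M. p n * R ^ n) < s"
proof -
  have "((\<lambda>R. \<Sum>n<M. p n * R ^ n) \<longlongrightarrow> (\<Sum>n<M. p n * 1 ^ n)) (at_right 1)"
    by (intro tendsto_intros)
  then have "\<forall>\<^sub>F R in at_right 1. (\<Sum>n<M. p n * R ^ n) < s"
    by (rule order_tendstoD(2)) (use assms in simp)
  moreover have "\<forall>\<^sub>F R in at_right 1. (1::real) < R" by (simp add: eventually_at_right_less)
  ultimately have "\<forall>\<^sub>F R in at_right 1. 1 < R \<and> (\<Sum>n<M. p n * R ^ n) < s" by eventually_elim auto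
  from eventually_happens[OF this] show ?thesis using that by auto
qed

text \<open>
  Wiener's argument: split the kernel as \<open>P = P1 + P2\<close> with a polynomial \<open>P1\<close> and a tail \<open>P2\<close> of small
  \<open>sqrt_mass\<close>.  Powers of \<open>P1\<close> are controlled by an exponentially weighted mass below \<open>1\<close>, and the
  powers of \<open>P\<close> are reached by exchanging one factor \<open>P\<close> for \<open>P1\<close> or \<open>P2\<close> at a time.
\<close>
lemma sqrt_mass_power_decay:
  fixes p :: "nat \<Rightarrow> real"
  assumes p: "\<And>n. 0 \<le> p n" "summable p" "(\<Sum>n. p n) < 1" "summable (\<lambda>n. sqrt (p n))"
  obtains C \<eta> where "0 \<le> C" "0 \<le> \<eta>" "\<eta> < 1" "\<And>K N. sqrt_mass K (Abs_fps p ^ N) \<le> C * \<eta> ^ N"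
proof -
  define s where "s = ((\<Sum>n. p n) + 1) / 2"
  have s: "(\<Sum>n. p n) < s" "s < 1" "0 < s" using p(3) suminf_nonneg[OF p(2,1)] by (auto simp: s_def)
  define \<epsilon> where "\<epsilon> = (1 - sqrt s) / 2"
  have "sqrt s < 1" using s by simp
  then have \<epsilon>: "0 < \<epsilon>" "sqrt s + \<epsilon> < 1" by (simp_all add: \<epsilon>_def field_simps)
  have "(\<lambda>M. (\<Sum>n. sqrt (p n)) - (\<Sum>n<M. sqrt (p n))) \<longlonglongrightarrow> (\<Sum>n. sqrt (p n)) - (\<Sum>n. sqrt (p n))"
    by (intro tendsto_intros summable_LIMSEQ p)
  then have "\<forall>\<^sub>F M in sequentially. (\<Sum>n. sqrt (p n)) - (\<Sum>n<M. sqrt (p n)) < \<epsilon>"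
    by (rule order_tendstoD(2)) (use \<epsilon> in simp)
  from eventually_happens[OF this] obtain M where M: "(\<Sum>n. sqrt (p n)) - (\<Sum>n<M. sqrt (p n)) < \<epsilon>" by auto
  have "(\<Sum>n<M. p n) < s" using sum_le_suminf[OF p(2), of "{..<M}"] p(1) s by auto
  from exp_weight_exists[OF this] obtain R where R: "1 < R" "(\<Sum>n<M. p n * R ^ n) < s" .
  define C where "C = sqrt (1 / (1 - 1 / R))"
  have "0 \<le> C" using R by (simp add: C_def)
  define P1 where "P1 = Abs_fps (\<lambda>n. if n < M then p n else 0)"
  define P2 where "P2 = Abs_fps (\<lambda>n. if n < M then 0 else p n)"
  define P where "P = Abs_fps p"
  have P: "P = P1 + P2" by (simp add: P_def P1_def P2_def fps_eq_iff)
  have nn: "0 \<le> fps_nth P1 n" "0 \<le> fps_nth P2 n" "0 \<le> fps_nth P n" for n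
    using p(1) by (auto simp: P1_def P2_def P_def)
  have nn1: "0 \<le> fps_nth (P1 ^ k) n" and nnP: "0 \<le> fps_nth (P ^ k) n" for k n by (intro fps_power_nonneg nn)+
  have P2: "sqrt_mass K P2 \<le> \<epsilon>" for K
  proof -
    have "sqrt_mass K P2 = (\<Sum>n\<in>{..K} - {..<M}. sqrt (p n))"
      unfolding sqrt_mass_def P2_def by (intro sum.mono_neutral_cong_right) auto
    also have "\<dots> = (\<Sum>n\<in>{..K} \<union> {..<M}. sqrt (p n)) - (\<Sum>n<M. sqrt (p n))"
      by (subst sum_diff[symmetric]) (auto intro!: sum.cong)
    also have "\<dots> \<le> \<epsilon>" using sum_le_suminf[OF p(4), of "{..K} \<union> {..<M}"] p(1) M by auto
    finally show ?thesis .
  qed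
  have P1: "weighted_mass R K (P1 ^ k) \<le> s ^ k" for K k
  proof (induction k)
    case 0
    have "weighted_mass R K 1 = (\<Sum>n\<le>K. if n = 0 then 1 else 0)"
      unfolding weighted_mass_def by (intro sum.cong) auto
    then show ?case by simp
  next
    case (Suc k)
    have "weighted_mass R K P1 = (\<Sum>n\<in>{..K} \<inter> {..<M}. p n * R ^ n)"
      unfolding weighted_mass_def P1_def by (intro sum.mono_neutral_cong_right) auto
    also have "\<dots> \<le> (\<Sum>n<M. p n * R ^ n)" by (intro sum_mono2) (use p(1) R in auto)
    finally have "weighted_mass R K P1 \<le> s" using R by simp
    then have "weighted_mass R K P1 * weighted_mass R K (P1 ^ k) \<le> s * s ^ k"
      using Suc s nn1[of k] R by (intro mult_mono) (auto simp: weighted_mass_def intro!: sum_nonneg)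
    then show ?case using weighted_mass_mult[OF nn(1) nn1[of k], of R K] R by simp
  qed
  \<comment> \<open>Powers of \<open>P1\<close> have to be carried along: they admit a bound with the constant \<open>C\<close> occurring once,
    whereas repeated use of submultiplicativity would produce a power of \<open>C\<close>.\<close>
  have "sqrt_mass K (P1 ^ k * P ^ N) \<le> C * sqrt s ^ k * (sqrt s + \<epsilon>) ^ N" for K k N
  proof (induction N arbitrary: k)
    case 0
    have "sqrt_mass K (P1 ^ k) \<le> C * sqrt (weighted_mass R K (P1 ^ k))"
      unfolding C_def by (rule sqrt_mass_le_weighted_mass[OF nn1 R(1)])
    also have "\<dots> \<le> C * sqrt (s ^ k)" using P1[of K k] \<open>0 \<le> C\<close> by (intro mult_left_mono) auto
    finally show ?case by (simp add: real_sqrt_power)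
  next
    case (Suc N)
    have nn3: "0 \<le> fps_nth (P1 ^ k * P ^ N) n" for k n by (rule fps_mult_nonneg[OF nn1 nnP])
    have "P1 ^ k * P ^ Suc N = P1 ^ Suc k * P ^ N + P2 * (P1 ^ k * P ^ N)"
    proof -
      have "P1 ^ k * P ^ Suc N = P * (P1 ^ k * P ^ N)" by (simp add: mult.left_commute)
      also have "\<dots> = P1 * (P1 ^ k * P ^ N) + P2 * (P1 ^ k * P ^ N)"
        by (subst (1) P) (rule distrib_right)
      finally show ?thesis by (simp add: mult.assoc)
    qed
    then have "sqrt_mass K (P1 ^ k * P ^ Suc N) \<le> sqrt_mass K (P1 ^ Suc k * P ^ N) + sqrt_mass K (P2 * (P1 ^ k * P ^ N))"
      using sqrt_mass_add[OF nn3 fps_mult_nonneg[OF nn(2) nn3], of K "Suc k" k] by simp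
    also have "sqrt_mass K (P2 * (P1 ^ k * P ^ N)) \<le> sqrt_mass K P2 * sqrt_mass K (P1 ^ k * P ^ N)"
      by (rule sqrt_mass_mult[OF nn(2) nn3])
    also have "\<dots> \<le> \<epsilon> * (C * sqrt s ^ k * (sqrt s + \<epsilon>) ^ N)"
      by (intro mult_mono P2 Suc.IH) (use \<epsilon> sqrt_mass_nonneg[OF nn3] in auto)
    also have "sqrt_mass K (P1 ^ Suc k * P ^ N) \<le> C * sqrt s ^ Suc k * (sqrt s + \<epsilon>) ^ N" by (rule Suc.IH)
    finally show ?case by (simp add: algebra_simps)
  qed
  from this[of _ 0] have "sqrt_mass K (P ^ N) \<le> C * (sqrt s + \<epsilon>) ^ N" for K N by simp
  then show ?thesis using that[OF \<open>0 \<le> C\<close>, of "sqrt s + \<epsilon>"] \<epsilon> s unfolding P_def by simp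
qed

text \<open>
  Iterating \<open>U = c + P * U\<close> up to the power \<open>N\<close> with \<open>sqrt_mass K (P ^ N) < 1/2\<close> lets the last term be
  absorbed into the left-hand side.
\<close>
lemma sqrt_renewal_summable:
  fixes p e :: "nat \<Rightarrow> real"
  assumes p: "\<And>n. 0 \<le> p n" "summable p" "(\<Sum>n. p n) < 1" "summable (\<lambda>n. sqrt (p n))"
    and e: "\<And>n. 0 \<le> e n" "\<And>n. e n = (if n = 0 then c else 0) + (\<Sum>i\<le>n. p i * e (n - i))" and "0 \<le> c"
  shows "summable (\<lambda>n. sqrt (e n))"
proof -
  obtain C \<eta> where C: "0 \<le> C" "0 \<le> \<eta>" "\<eta> < 1" "\<And>K N. sqrt_mass K (Abs_fps p ^ N) \<le> C * \<eta> ^ N"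
    using sqrt_mass_power_decay[OF p] by blast
  define P where "P = Abs_fps p"
  define U where "U = Abs_fps e"
  have nn: "0 \<le> fps_nth U n" "0 \<le> fps_nth P n" "0 \<le> fps_nth (fps_const c) n" for n
    using p(1) e(1) \<open>0 \<le> c\<close> by (auto simp: P_def U_def)
  have nnP: "0 \<le> fps_nth (P ^ k) n" for k n by (rule fps_power_nonneg[OF nn(2)])
  have U: "U = fps_const c + P * U"
  proof (rule fps_ext)
    fix n
    have "fps_nth (fps_const c + P * U) n = (if n = 0 then c else 0) + (\<Sum>i\<le>n. p i * e (n - i))"
      by (simp add: U_def P_def fps_mult_nth atLeast0AtMost)
    also have "\<dots> = fps_nth U n" by (simp only: e(2)[symmetric] U_def fps_nth_Abs_fps)
    finally show "fps_nth U n = fps_nth (fps_const c + P * U) n" by (rule sym)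
  qed
  have "sqrt_mass K (fps_const c) = sqrt c" for K
  proof -
    have "sqrt_mass K (fps_const c) = (\<Sum>n\<le>K. if n = 0 then sqrt c else 0)"
      unfolding sqrt_mass_def by (intro sum.cong) auto
    then show ?thesis by simp
  qed
  note mc = this
  have bound: "sqrt_mass K U \<le> sqrt c * (\<Sum>i<N. C * \<eta> ^ i) + sqrt_mass K (P ^ N * U)" for K N
  proof (induction N)
    case (Suc N)
    have "P ^ N * U = fps_const c * P ^ N + P ^ Suc N * U"
    proof -
      have "P ^ N * U = P ^ N * (fps_const c + P * U)" by (rule arg_cong[OF U])
      also have "\<dots> = fps_const c * P ^ N + P ^ Suc N * U" by (simp only: power_Suc algebra_simps)
      finally show ?thesis .
    qed
    then have "sqrt_mass K (P ^ N * U) \<le> sqrt_mass K (fps_const c * P ^ N) + sqrt_mass K (P ^ Suc N * U)"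
      using sqrt_mass_add[OF fps_mult_nonneg[OF nn(3) nnP] fps_mult_nonneg[OF nnP nn(1)], of K N "Suc N"]
      by (simp only:)
    also have "sqrt_mass K (fps_const c * P ^ N) \<le> sqrt_mass K (fps_const c) * sqrt_mass K (P ^ N)"
      by (rule sqrt_mass_mult[OF nn(3) nnP])
    also have "\<dots> \<le> sqrt c * (C * \<eta> ^ N)"
      unfolding mc P_def by (intro mult_left_mono C) (use \<open>0 \<le> c\<close> in auto)
    finally have "sqrt_mass K (P ^ N * U) \<le> sqrt c * (C * \<eta> ^ N) + sqrt_mass K (P ^ Suc N * U)" by simp
    with Suc.IH have "sqrt_mass K U \<le> sqrt c * (\<Sum>i<N. C * \<eta> ^ i) + (sqrt c * (C * \<eta> ^ N) + sqrt_mass K (P ^ Suc N * U))"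
      by linarith
    then show ?case by (simp only: sum.lessThan_Suc distrib_left add.assoc)
  qed simp
  have "(\<lambda>N. C * \<eta> ^ N) \<longlonglongrightarrow> C * 0" using C by (intro tendsto_intros LIMSEQ_realpow_zero) auto
  then have "\<forall>\<^sub>F N in sequentially. C * \<eta> ^ N < 1 / 2" by (rule order_tendstoD(2)) simp
  from eventually_happens[OF this] obtain N where N: "C * \<eta> ^ N < 1 / 2" by auto
  define A where "A = sqrt c * (\<Sum>i<N. C * \<eta> ^ i)"
  have "sqrt_mass K U \<le> 2 * A" for K
  proof -
    have "sqrt_mass K (P ^ N * U) \<le> sqrt_mass K (P ^ N) * sqrt_mass K U" by (rule sqrt_mass_mult[OF nnP nn(1)])
    also have "\<dots> \<le> 1 / 2 * sqrt_mass K U"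
      using C(4)[of K N] N sqrt_mass_nonneg[OF nn(1)] unfolding P_def by (intro mult_right_mono) auto
    finally show ?thesis using bound[of K N] by (simp add: A_def)
  qed
  then have "(\<Sum>n\<le>K. sqrt (e n)) \<le> 2 * A" for K by (simp add: sqrt_mass_def U_def)
  then show ?thesis
    by (intro bounded_imp_summable[of _ "2 * A"]) (simp_all add: e(1))
qed

section \<open>Resolvent of a summable kernel\<close>

text \<open>
  The deterministic data: the constant \<open>l\<close> plays the role of the mean of the noise.
\<close>
locale kernel =
  fixes l :: real and b :: "nat \<Rightarrow> real"
  assumes l_pos: "0 < l" and b_nonneg: "\<And>j. 0 \<le> b (Suc j)"
    and b_summable: "summable (\<lambda>j. b (Suc j))" and l_bsum: "l * bsum b < 1"
begin

definition kern :: "nat \<Rightarrow> real" where "kern n = (if n = 0 then 0 else l * b n)"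

abbreviation z :: "nat \<Rightarrow> real" where "z \<equiv> zseq l b"

abbreviation zsum :: real where "zsum \<equiv> 1 / (1 - l * bsum b)"

definition zpos :: "nat \<Rightarrow> real" where "zpos n = (if n = 0 then 0 else z n)"

lemma kern_nonneg: "0 \<le> kern n"
  using b_nonneg[of "n - 1"] l_pos by (auto simp: kern_def)

lemma kern_0 [simp]: "kern 0 = 0" by (simp add: kern_def)

lemma kern_Suc: "kern (Suc n) = l * b (Suc n)" by (simp add: kern_def)

lemma kern_sums: "kern sums (l * bsum b)"
proof -
  have "(\<lambda>n. kern (Suc n)) sums (l * bsum b)"
    unfolding kern_Suc bsum_def by (intro sums_mult summable_sums b_summable)
  then show ?thesis by (subst (asm) sums_Suc_iff) simp
qed

lemma zseq_renewal: "z n = (if n = 0 then 1 else 0) + (\<Sum>i\<le>n. kern i * z (n - i))"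
proof (cases n)
  case (Suc m)
  have "(\<Sum>i\<le>Suc m. kern i * z (Suc m - i)) = (\<Sum>i\<le>m. kern (Suc i) * z (m - i))"
    by (subst sum.atMost_Suc_shift) simp
  also have "\<dots> = (\<Sum>j\<le>m. kern (Suc m - j) * z j)"
    by (rule sum.reindex_bij_witness[of _ "\<lambda>j. m - j" "\<lambda>j. m - j"]) (auto simp: Suc_diff_le)
  also have "\<dots> = (\<Sum>j\<le>m. l * (b (Suc m - j) * z j))"
    by (intro sum.cong) (auto simp: kern_def)
  also have "\<dots> = z (Suc m)" by (simp add: sum_distrib_left)
  finally show ?thesis using Suc by simp
qed simp

lemma zseq_nonneg: "0 \<le> z n"
proof (induction n rule: less_induct)
  case (less n)
  show ?case
  proof (cases n)
    case (Suc m)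
    have "0 \<le> b (Suc m - j)" if "j \<le> m" for j
      using b_nonneg[of "m - j"] that by (simp add: Suc_diff_le)
    then show ?thesis using less Suc l_pos by (auto intro!: mult_nonneg_nonneg sum_nonneg)
  qed simp
qed

lemma zpos_nonneg: "0 \<le> zpos n" by (simp add: zpos_def zseq_nonneg)

lemma zpos_0 [simp]: "zpos 0 = 0" by (simp add: zpos_def)

lemma zseq_summable: "summable z"
proof (rule bounded_imp_summable)
  fix N
  let ?q = "l * bsum b"
  have "(\<Sum>n\<le>N. z n) = (\<Sum>n\<le>N. if n = 0 then 1 else 0) + (\<Sum>n\<le>N. \<Sum>i\<le>n. kern i * z (n - i))"
    by (subst zseq_renewal) (simp only: sum.distrib)
  also have "(\<Sum>n\<le>N. if n = 0 then 1 else 0) = (1::real)" by simp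
  also have "(\<Sum>n\<le>N. \<Sum>i\<le>n. kern i * z (n - i)) \<le> (\<Sum>n\<le>N. kern n) * (\<Sum>n\<le>N. z n)"
    by (rule sum_Cauchy_product_le[OF kern_nonneg zseq_nonneg])
  also have "\<dots> \<le> ?q * (\<Sum>n\<le>N. z n)"
    using sum_le_suminf[of kern "{..N}"] kern_sums kern_nonneg zseq_nonneg
    by (intro mult_right_mono) (auto simp: sums_iff intro!: sum_nonneg)
  finally have "(1 - ?q) * (\<Sum>n\<le>N. z n) \<le> 1" by (simp add: algebra_simps)
  then show "(\<Sum>n\<le>N. z n) \<le> 1 / (1 - ?q)" using l_bsum by (simp add: pos_le_divide_eq mult.commute)
qed (rule zseq_nonneg)

lemma zseq_sums: "z sums zsum"
proof -
  let ?q = "l * bsum b"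
  have "(\<lambda>n. \<Sum>i\<le>n. kern i * z (n - i)) sums ((\<Sum>n. kern n) * (\<Sum>n. z n))"
    by (rule Cauchy_product_sums) (use kern_sums kern_nonneg zseq_nonneg zseq_summable in \<open>auto simp: sums_iff\<close>)
  then have "(\<lambda>n. \<Sum>i\<le>n. kern i * z (n - i)) sums (?q * (\<Sum>n. z n))" using kern_sums by (simp add: sums_iff)
  moreover have "(\<lambda>n. if n = 0 then 1 else 0) sums (1::real)"
    using sums_single[of 0 "\<lambda>_. 1::real"] by simp
  ultimately have "(\<lambda>n. (if n = 0 then 1 else 0) + (\<Sum>i\<le>n. kern i * z (n - i))) sums (1 + ?q * (\<Sum>n. z n))"
    by (intro sums_add)
  then have "z sums (1 + ?q * (\<Sum>n. z n))" by (simp only: zseq_renewal[symmetric])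
  then have "(1 - ?q) * (\<Sum>n. z n) = 1" by (simp add: sums_iff algebra_simps)
  then have "(\<Sum>n. z n) = 1 / (1 - ?q)" using l_bsum by (simp add: nonzero_eq_divide_eq mult.commute)
  then show ?thesis using summable_sums[OF zseq_summable] by simp
qed

lemma zpos_sums: "zpos sums (l * bsum b / (1 - l * bsum b))"
proof -
  have "(\<lambda>n. z (Suc n)) sums (zsum - 1)"
    using zseq_sums sums_Suc_iff[of z] by simp
  then have "(\<lambda>n. zpos (Suc n)) sums (zsum - 1)" by (simp add: zpos_def)
  then have "zpos sums (zsum - 1)" by (simp add: sums_Suc_iff)
  moreover have "zsum - 1 = l * bsum b / (1 - l * bsum b)"
    using l_bsum by (simp add: field_simps)
  ultimately show ?thesis by simp
qed

lemma zpos_renewal: "zpos n = kern n + 1 * (\<Sum>i\<le>n. kern i * zpos (n - i))"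
proof (cases "n = 0")
  case False
  have "zpos n = (\<Sum>i\<le>n. kern i * z (n - i))" using False zseq_renewal[of n] by (simp add: zpos_def)
  also have "\<dots> = (\<Sum>i\<le>n. (if i = n then kern n else 0) + kern i * zpos (n - i))"
    by (intro sum.cong) (auto simp: zpos_def)
  also have "\<dots> = kern n + (\<Sum>i\<le>n. kern i * zpos (n - i))" by (simp add: sum.distrib)
  finally show ?thesis by simp
qed simp

lemma kern_renewal: "kern n = zpos n + (-1) * (\<Sum>i\<le>n. zpos i * kern (n - i))"
proof -
  have "(\<Sum>i\<le>n. kern i * zpos (n - i)) = (\<Sum>i\<le>n. zpos i * kern (n - i))"
    by (rule sum.reindex_bij_witness[of _ "\<lambda>i. n - i" "\<lambda>i. n - i"]) auto
  then show ?thesis using zpos_renewal[of n] by simp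
qed

text \<open>
  In formal power series, the equation reads \<open>(1 - K) * H = D\<close>, while \<open>(1 - K) * Z = 1\<close>.
\<close>
lemma resolvent_solution:
  assumes h: "\<And>n. h n = d n + (\<Sum>i\<le>n. kern i * h (n - i))"
  shows "h n = (\<Sum>i\<le>n. z i * d (n - i))"
proof -
  define H D K Z where "H = Abs_fps h" and "D = Abs_fps d" and "K = Abs_fps kern" and "Z = Abs_fps z"
  have "H = D + K * H"
  proof (rule fps_ext)
    fix n
    have "fps_nth H n = h n" by (simp add: H_def)
    also have "\<dots> = d n + (\<Sum>i\<le>n. kern i * h (n - i))" by (rule h)
    also have "\<dots> = fps_nth (D + K * H) n" by (simp add: H_def D_def K_def fps_mult_nth atLeast0AtMost)
    finally show "fps_nth H n = fps_nth (D + K * H) n" .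
  qed
  then have H: "H - K * H = D" by (simp only: diff_eq_eq)
  have "Z = 1 + K * Z"
  proof (rule fps_ext)
    fix n
    have "fps_nth Z n = z n" by (simp add: Z_def)
    also have "\<dots> = (if n = 0 then 1 else 0) + (\<Sum>i\<le>n. kern i * z (n - i))" by (rule zseq_renewal)
    also have "\<dots> = fps_nth (1 + K * Z) n" by (simp add: Z_def K_def fps_mult_nth atLeast0AtMost)
    finally show "fps_nth Z n = fps_nth (1 + K * Z) n" .
  qed
  then have "Z - K * Z = 1" by (simp only: diff_eq_eq)
  then have "H = (Z - K * Z) * H" by simp
  also have "\<dots> = Z * (H - K * H)" by (simp only: algebra_simps)
  finally have "H = Z * D" by (simp only: H)
  then have "fps_nth H n = fps_nth (Z * D) n" by simp
  then show ?thesis by (simp add: H_def Z_def D_def fps_mult_nth atLeast0AtMost)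
qed

section \<open>Yule-Walker equations\<close>

text \<open>
  Extending \<open>z\<close> by zero to negative times turns the recursion of \<open>z\<close> into one with an infinite sum and
  without case distinctions on the range of summation.
\<close>
definition zint :: "int \<Rightarrow> real" where "zint k = (if k < 0 then 0 else z (nat k))"

lemma zint_nonneg: "0 \<le> zint k" by (simp add: zint_def zseq_nonneg)

lemma zseq_le: "z n \<le> zsum"
  using sum_le_suminf[OF zseq_summable, of "{n}"] zseq_nonneg zseq_sums by (simp add: sums_iff)

lemma zint_le: "zint k \<le> zsum"
  using l_bsum by (auto simp: zint_def zseq_le)

lemma zint_renewal: "(\<Sum>j. l * b (Suc j) * zint (k - int (Suc j))) = zint k - (if k = 0 then 1 else 0)"
proof (cases "k \<le> 0")
  case True
  then show ?thesis by (simp add: zint_def)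
next
  case False
  then obtain m where m: "k = int (Suc m)" by (metis gr0_implies_Suc not_le zero_less_imp_eq_int of_nat_0_less_iff)
  have "(\<Sum>j. l * b (Suc j) * zint (k - int (Suc j))) = (\<Sum>j\<le>m. l * b (Suc j) * zint (k - int (Suc j)))"
    by (rule suminf_finite) (auto simp: m zint_def)
  also have "\<dots> = (\<Sum>j\<le>m. kern (Suc j) * z (Suc m - Suc j))"
    by (rule sum.cong) (auto simp: m zint_def kern_Suc simp flip: of_nat_diff)
  also have "\<dots> = (\<Sum>i\<le>Suc m. kern i * z (Suc m - i))" by (subst sum.atMost_Suc_shift) simp
  also have "\<dots> = z (Suc m)" using zseq_renewal[of "Suc m"] by (simp del: zseq.simps)
  also have "\<dots> = zint k" unfolding m zint_def by (simp only: nat_int of_nat_less_0_iff if_False)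
  finally show ?thesis using m by simp
qed

definition zcorr :: "int \<Rightarrow> real" where "zcorr n = (\<Sum>m. z m * zint (int m + n))"

lemma zcorr_summable: "summable (\<lambda>m. z m * zint (int m + n))"
proof (rule summable_comparison_test'[OF summable_mult2[OF zseq_summable, of "zsum"], of 0])
  fix m :: nat
  show "norm (z m * zint (int m + n)) \<le> z m * zsum"
    using zseq_nonneg[of m] zint_nonneg[of "int m + n"] zint_le[of "int m + n"] by (simp add: abs_mult mult_left_mono del: times_divide_eq_right)
qed

lemma zcorr_of_nat: "zcorr (int n) = (\<Sum>m. z m * z (n + m))"
  unfolding zcorr_def by (simp add: zint_def nat_add_distrib add.commute)

lemma zcorr_minus: "zcorr (- n) = zcorr n"
proof -
  have *: "zcorr (- int n) = zcorr (int n)" for n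
  proof -
    have "zcorr (- int n) = (\<Sum>m. z (m + n) * zint (int (m + n) - int n)) + (\<Sum>m<n. z m * zint (int m - int n))"
      unfolding zcorr_def using suminf_split_initial_segment[OF zcorr_summable, of "- int n" n] by simp
    also have "(\<Sum>m<n. z m * zint (int m - int n)) = 0" by (intro sum.neutral) (auto simp: zint_def)
    also have "(\<Sum>m. z (m + n) * zint (int (m + n) - int n)) = zcorr (int n)"
      unfolding zcorr_of_nat by (simp add: zint_def mult.commute add.commute)
    finally show ?thesis by simp
  qed
  show ?thesis
  proof (cases "0 \<le> n")
    case True then show ?thesis using *[of "nat n"] by simp
  next
    case False then show ?thesis using *[of "nat (- n)"] by simp
  qed
qed

lemma zcorr_bound: "\<bar>zcorr n\<bar> \<le> zsum * zsum"
proof -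
  have "0 \<le> zcorr n" unfolding zcorr_def
    by (intro suminf_nonneg zcorr_summable mult_nonneg_nonneg zseq_nonneg zint_nonneg)
  moreover have "zcorr n \<le> (\<Sum>m. z m * zsum)"
    unfolding zcorr_def by (intro suminf_le mult_left_mono zint_le zseq_nonneg zcorr_summable summable_mult2 zseq_summable)
  moreover have "(\<Sum>m. z m * zsum) = zsum * zsum"
    using suminf_mult2[OF zseq_summable, of "zsum"] zseq_sums by (simp add: sums_iff)
  ultimately show ?thesis by simp
qed

lemma zcorr_pos:
  assumes "0 < z n"
  shows "0 < zcorr (int n)"
proof -
  have "z 0 * zint (int 0 + int n) \<le> zcorr (int n)"
    unfolding zcorr_def
    using sum_le_suminf[OF zcorr_summable[of "int n"], of "{0}"] zseq_nonneg zint_nonneg by simp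
  then show ?thesis using assms by (simp add: zint_def)
qed

lemma kernel_summable: "summable (\<lambda>j. l * b (Suc j))"
  by (intro summable_mult b_summable)

lemma kernel_suminf: "(\<Sum>j. l * b (Suc j)) = l * bsum b"
  unfolding bsum_def by (rule suminf_mult[OF b_summable])

lemma kernel_nonneg: "0 \<le> l * b (Suc j)"
  using l_pos b_nonneg by simp

text \<open>
  Exchanging the two sums reduces the claim to the recursion of \<open>zint\<close>; the inhomogeneity of that
  recursion at time \<open>0\<close> leaves the term \<open>zint (- n)\<close>, which vanishes for \<open>n \<ge> 1\<close>.
\<close>
lemma zcorr_yule_walker:
  "(\<Sum>j. l * b (Suc j) * zcorr (n - int (Suc j))) = zcorr n - zint (- n)"
proof -
  have "(\<Sum>j. l * b (Suc j) * zcorr (n - int (Suc j)))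
      = (\<Sum>j. l * b (Suc j) * (\<Sum>m. z m * zint (int m + (n - int (Suc j)))))"
    by (simp add: zcorr_def)
  also have "\<dots> = (\<Sum>m. z m * (\<Sum>j. l * b (Suc j) * zint (int m + (n - int (Suc j)))))"
    by (rule suminf_swap[OF kernel_nonneg kernel_summable zseq_nonneg zseq_summable])
       (use zint_le zint_nonneg in \<open>simp add: abs_of_nonneg\<close>)
  also have "\<dots> = (\<Sum>m. z m * (zint (int m + n) - (if int m + n = 0 then 1 else 0)))"
    by (simp only: add_diff_eq zint_renewal)
  also have "\<dots> = (\<Sum>m. z m * zint (int m + n) - z m * (if int m + n = 0 then 1 else 0))"
    by (simp only: right_diff_distrib)
  also have "\<dots> = zcorr n - (\<Sum>m. z m * (if int m + n = 0 then 1 else 0))"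
    unfolding zcorr_def
    by (rule suminf_diff[symmetric, OF zcorr_summable])
       (rule summable_finite[of "{nat (- n)}"]; auto)
  also have "(\<Sum>m. z m * (if int m + n = 0 then 1 else 0)) = zint (- n)"
  proof (cases "n \<le> 0")
    case True
    have "(\<Sum>m. z m * (if int m + n = 0 then 1 else 0)) = (\<Sum>m\<in>{nat (- n)}. z m * (if int m + n = 0 then 1 else 0))"
      by (rule suminf_finite) auto
    then show ?thesis using True by (simp add: zint_def)
  next
    case False
    then have "(\<lambda>m. z m * (if int m + n = 0 then 1 else 0)) = (\<lambda>_. 0)" by auto
    then show ?thesis using False by (simp add: zint_def)
  qed
  finally show ?thesis .
qed

text \<open>
  The equation multiplies a bound for \<open>\<bar>f\<bar>\<close> at positive times by \<open>l * bsum b < 1\<close>; symmetry and the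
  value at \<open>0\<close> carry the improved bound over to all times.
\<close>
lemma yule_walker_zero:
  fixes f :: "int \<Rightarrow> real"
  assumes sym: "\<And>n. f (- n) = f n" and bdd: "\<And>n. \<bar>f n\<bar> \<le> C" and "f 0 = 0"
    and yw: "\<And>n. 1 \<le> n \<Longrightarrow> f n = (\<Sum>j. l * b (Suc j) * f (n - int (Suc j)))"
  shows "f n = 0"
proof -
  let ?q = "l * bsum b"
  have q: "0 \<le> ?q" "?q < 1" using kernel_suminf suminf_nonneg[OF kernel_summable kernel_nonneg] l_bsum by auto
  have "0 \<le> C" using order_trans[OF abs_ge_zero bdd] .
  have "\<bar>f n\<bar> \<le> ?q ^ k * C" for n k
  proof (induction k arbitrary: n)
    case (Suc k)
    have pos: "\<bar>f n\<bar> \<le> ?q ^ Suc k * C" if "1 \<le> n" for n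
    proof -
      have s1: "summable (\<lambda>j. l * b (Suc j) * (?q ^ k * C))" by (intro summable_mult2 kernel_summable)
      have le: "\<bar>l * b (Suc j) * f (n - int (Suc j))\<bar> \<le> l * b (Suc j) * (?q ^ k * C)" for j
        unfolding abs_mult[of "l * b (Suc j)"] using kernel_nonneg[of j] Suc.IH by (intro mult_mono) auto
      have s2: "summable (\<lambda>j. \<bar>l * b (Suc j) * f (n - int (Suc j))\<bar>)"
        by (rule summable_comparison_test'[OF s1, of 0]) (use le in simp)
      have "\<bar>f n\<bar> \<le> (\<Sum>j. \<bar>l * b (Suc j) * f (n - int (Suc j))\<bar>)"
        unfolding yw[OF that] by (rule summable_rabs[OF s2])
      also have "\<dots> \<le> (\<Sum>j. l * b (Suc j) * (?q ^ k * C))" by (rule suminf_le[OF le s2 s1])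
      also have "\<dots> = ?q * (?q ^ k * C)" using suminf_mult2[OF kernel_summable] kernel_suminf by metis
      finally show ?thesis by (simp add: mult.assoc)
    qed
    consider "1 \<le> n" | "n = 0" | "1 \<le> - n" by linarith
    then show ?case
    proof cases
      case 1 then show ?thesis by (rule pos)
    next
      case 2 then show ?thesis using \<open>f 0 = 0\<close> q \<open>0 \<le> C\<close> by simp
    next
      case 3 then show ?thesis using pos[of "- n"] sym[of n] by simp
    qed
  qed (use bdd in simp)
  moreover have "(\<lambda>k. ?q ^ k * C) \<longlonglongrightarrow> 0 * C" using q by (intro tendsto_intros LIMSEQ_realpow_zero) auto
  ultimately have "\<bar>f n\<bar> \<le> 0 * C" by (intro LIMSEQ_le_const) auto
  then show ?thesis by simp
qed

text \<open>
  Subtracting the multiple of \<open>zcorr\<close> with the same value at \<open>0\<close> leaves a solution that vanishes at \<open>0\<close>.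
  The factor is read off from the equation at \<open>n = 0\<close>, where \<open>zcorr\<close> has inhomogeneity \<open>1\<close>.
\<close>
lemma yule_walker_solution:
  fixes \<rho> :: "int \<Rightarrow> real"
  assumes sym: "\<And>n. \<rho> (- n) = \<rho> n" and bdd: "\<And>n. \<bar>\<rho> n\<bar> \<le> C"
    and yw: "\<And>n. 1 \<le> n \<Longrightarrow> \<rho> n = (\<Sum>j. l * b (Suc j) * \<rho> (n - int (Suc j)))"
  shows "\<rho> n = (\<rho> 0 - (\<Sum>j. l * b (Suc j) * \<rho> (- int (Suc j)))) * zcorr n"
proof -
  define Q where "Q = zsum * zsum"
  have z0: "0 < zcorr 0" using zcorr_pos[of 0] by simp
  define t where "t = \<rho> 0 / zcorr 0"
  have ssum: "summable (\<lambda>j. l * b (Suc j) * g (n - int (Suc j)))" if "\<And>n. \<bar>g n\<bar> \<le> D" for g :: "int \<Rightarrow> real" and D n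
  proof (rule summable_comparison_test'[OF summable_mult2[OF kernel_summable, of D], of 0])
    fix j :: nat
    have "norm (l * b (Suc j) * g (n - int (Suc j))) = l * b (Suc j) * \<bar>g (n - int (Suc j))\<bar>"
      using kernel_nonneg[of j] by (simp only: real_norm_def abs_mult[of "l * b (Suc j)"] abs_of_nonneg)
    also have "\<dots> \<le> l * b (Suc j) * D" using kernel_nonneg that by (rule mult_left_mono[rotated])
    finally show "norm (l * b (Suc j) * g (n - int (Suc j))) \<le> l * b (Suc j) * D" .
  qed
  note s\<rho> = ssum[of \<rho> C, OF bdd] and sz = ssum[of zcorr Q, folded Q_def, OF zcorr_bound[folded Q_def]]
  have eq: "\<rho> n = t * zcorr n" for n
  proof -
    have "\<rho> n - t * zcorr n = 0"
    proof (rule yule_walker_zero[where f = "\<lambda>n. \<rho> n - t * zcorr n"])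
      show "\<rho> (- n) - t * zcorr (- n) = \<rho> n - t * zcorr n" for n by (simp add: sym zcorr_minus)
      show "\<rho> 0 - t * zcorr 0 = 0" using z0 by (simp add: t_def)
      show "\<bar>\<rho> n - t * zcorr n\<bar> \<le> C + \<bar>t\<bar> * Q" for n
      proof -
        have "\<bar>t * zcorr n\<bar> \<le> \<bar>t\<bar> * Q" unfolding abs_mult Q_def by (intro mult_left_mono zcorr_bound) auto
        then show ?thesis using bdd[of n] by linarith
      qed
      fix n :: int assume "1 \<le> n"
      have "(\<Sum>j. l * b (Suc j) * (\<rho> (n - int (Suc j)) - t * zcorr (n - int (Suc j))))
         = (\<Sum>j. l * b (Suc j) * \<rho> (n - int (Suc j)) - t * (l * b (Suc j) * zcorr (n - int (Suc j))))"
        by (simp only: right_diff_distrib mult.left_commute)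
      also have "\<dots> = (\<Sum>j. l * b (Suc j) * \<rho> (n - int (Suc j))) - t * (\<Sum>j. l * b (Suc j) * zcorr (n - int (Suc j)))"
        by (simp only: suminf_diff[OF s\<rho> summable_mult[OF sz], symmetric] suminf_mult[OF sz])
      also have "\<dots> = \<rho> n - t * zcorr n"
        using \<open>1 \<le> n\<close> by (simp only: yw[OF \<open>1 \<le> n\<close>, symmetric] zcorr_yule_walker) (simp add: zint_def)
      finally show "\<rho> n - t * zcorr n = (\<Sum>j. l * b (Suc j) * (\<rho> (n - int (Suc j)) - t * zcorr (n - int (Suc j))))" ..
    qed
    then show ?thesis by simp
  qed
  have "(\<Sum>j. l * b (Suc j) * \<rho> (- int (Suc j))) = (\<Sum>j. t * (l * b (Suc j) * zcorr (0 - int (Suc j))))"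
    by (simp add: eq mult_ac)
  also have "\<dots> = t * (zcorr 0 - 1)"
    by (simp only: suminf_mult[OF sz] zcorr_yule_walker) (simp add: zint_def)
  finally have "\<rho> 0 - (\<Sum>j. l * b (Suc j) * \<rho> (- int (Suc j))) = t" by (simp add: eq right_diff_distrib)
  then show ?thesis by (simp only: eq)
qed

text \<open>
  The pairs \<open>(m, m + n)\<close> with \<open>m \<ge> 0\<close> and \<open>m + n \<ge> 0\<close> run through all pairs of natural numbers once, so
  the total is the square of the sum of \<open>z\<close>.
\<close>
lemma zcorr_has_sum: "(zcorr has_sum zsum\<^sup>2) UNIV"
proof -
  let ?S = "zsum"
  have zs: "(z has_sum ?S) UNIV" by (rule sums_nonneg_imp_has_sum[OF zseq_sums zseq_nonneg])
  have p1: "((\<lambda>j. z i * z j) has_sum z i * ?S) UNIV" for i by (intro has_sum_cmult_right zs)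
  have p2: "((\<lambda>i. z i * ?S) has_sum ?S * ?S) UNIV" by (intro has_sum_cmult_left zs)
  have prod: "((\<lambda>(i, j). z i * z j) has_sum ?S * ?S) (UNIV \<times> UNIV)"
  proof (rule has_sum_SigmaI)
    show "(\<lambda>(i, j). z i * z j) summable_on UNIV \<times> UNIV"
      by (rule summable_on_SigmaI[where g = "\<lambda>i. z i * ?S"])
         (use p1 p2 zseq_nonneg in \<open>auto simp: summable_on_def\<close>)
  qed (use p1 p2 in auto)
  have "((\<lambda>(n, m). z m * zint (int m + n)) has_sum ?S * ?S) {(n, m). 0 \<le> int m + n}"
  proof (subst has_sum_reindex_bij_witness[where i = "\<lambda>(i, j). (int j - int i, i)" and j = "\<lambda>(n, m). (m, nat (int m + n))"
        and T = "UNIV \<times> UNIV" and h = "\<lambda>(i, j). z i * z j" and s' = "?S * ?S"])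
    show "((\<lambda>(i, j). z i * z j) has_sum ?S * ?S) (UNIV \<times> UNIV)" by (rule prod)
  qed (auto simp: zint_def)
  then have "((\<lambda>(n, m). z m * zint (int m + n)) has_sum ?S * ?S) (UNIV \<times> UNIV)"
    by (subst (asm) has_sum_cong_neutral[where T = "UNIV \<times> UNIV" and g = "\<lambda>(n, m). z m * zint (int m + n)"])
       (auto simp: zint_def)
  from has_sum_SigmaD[OF this, of zcorr]
  have "(zcorr has_sum ?S * ?S) UNIV"
    unfolding zcorr_def
    using sums_nonneg_imp_has_sum[OF summable_sums[OF zcorr_summable]] zseq_nonneg zint_nonneg by simp
  then show ?thesis by (simp add: power2_eq_square)
qed

section \<open>Asymptotics of the autocorrelation of the resolvent\<close>

lemma zcorr_asymptotics:
  assumes \<gamma>: "\<gamma> \<in> Wclass 1" "decseq \<gamma>" and b: "(\<lambda>n. b n / \<gamma> n) \<longlonglongrightarrow> L"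
  shows "(\<lambda>n. zcorr (int n) / \<gamma> n) \<longlonglongrightarrow> l * L / (1 - l * bsum b) ^ 3"
proof -
  have "(\<lambda>n. l * (b n / \<gamma> n)) \<longlonglongrightarrow> l * L" by (intro tendsto_intros b)
  then have "(\<lambda>n. (l * b n) / \<gamma> n) \<longlonglongrightarrow> l * L" by simp
  then have "(\<lambda>n. kern n / \<gamma> n) \<longlonglongrightarrow> l * L"
    by (rule tendsto_ratio_change_finite[where N = 1]) (simp add: kern_def)
  from renewal_asymptotics[OF \<gamma>(1) kern_nonneg kern_0 kern_sums l_bsum this zpos_renewal]
  have "(\<lambda>n. zpos n / \<gamma> n) \<longlonglongrightarrow> l * L / (1 - l * bsum b)\<^sup>2" by simp
  then have "(\<lambda>n. z n / \<gamma> n) \<longlonglongrightarrow> l * L / (1 - l * bsum b)\<^sup>2"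
    by (rule tendsto_ratio_change_finite[where N = 1]) (simp add: zpos_def)
  from correlation_asymptotics[OF \<gamma> zseq_nonneg zseq_summable this]
  have "(\<lambda>n. zcorr (int n) / \<gamma> n) \<longlonglongrightarrow> 1 / (1 - l * bsum b) * (l * L / (1 - l * bsum b)\<^sup>2)"
    using zseq_sums by (simp add: zcorr_of_nat sums_iff)
  then show ?thesis by (simp add: power2_eq_square power3_eq_cube mult.assoc)
qed

text \<open>
  The mass of \<open>zpos\<close> is \<open>q / (1 - q)\<close> with \<open>q = l * bsum b\<close>; it is less than \<open>1\<close> exactly when \<open>q < 1/2\<close>.
  This is used twice: to pass from \<open>zcorr\<close> to \<open>z\<close>, and from \<open>z\<close> to \<open>b\<close>.
\<close>
lemma coefficient_asymptotics:
  assumes \<gamma>: "\<gamma> \<in> Wclass 1" "decseq \<gamma>" and half: "l * bsum b < 1 / 2"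
    and zc: "(\<lambda>n. zcorr (int n) / \<gamma> n) \<longlonglongrightarrow> L"
  shows "(\<lambda>n. b n / \<gamma> n) \<longlonglongrightarrow> L * (1 - l * bsum b) ^ 3 / l"
proof -
  define q where "q = l * bsum b"
  have q: "q < 1 / 2" using half by (simp add: q_def)
  have \<theta>: "q / (1 - q) < 1" using q by simp
  have "(\<lambda>j. zpos (Suc j)) sums (q / (1 - q))" using zpos_sums by (simp add: q_def sums_Suc_iff)
  then have "(\<Sum>j. z (Suc j)) < 1" using \<theta> by (simp add: sums_iff zpos_def del: zseq.simps)
  from correlation_asymptotics_inverse[OF \<gamma> zseq_nonneg zseq_summable _ this zcorr_of_nat zc]
  have "(\<lambda>n. z n / \<gamma> n) \<longlonglongrightarrow> L * (1 - q)" using zseq_sums by (simp add: sums_iff q_def)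
  then have "(\<lambda>n. zpos n / \<gamma> n) \<longlonglongrightarrow> L * (1 - q)"
    by (rule tendsto_ratio_change_finite[where N = 1]) (simp add: zpos_def)
  from renewal_asymptotics[OF \<gamma>(1) zpos_nonneg zpos_0 zpos_sums[folded q_def] \<theta> this kern_renewal]
  have "(\<lambda>n. kern n / \<gamma> n) \<longlonglongrightarrow> L * (1 - q) / (1 + q / (1 - q))\<^sup>2" by simp
  moreover have "1 + q / (1 - q) = 1 / (1 - q)" using q by (simp add: field_simps)
  ultimately have "(\<lambda>n. kern n / \<gamma> n) \<longlonglongrightarrow> L * (1 - q) ^ 3"
    by (simp add: power2_eq_square power3_eq_cube mult.assoc)
  then have "(\<lambda>n. (l * b n) / \<gamma> n) \<longlonglongrightarrow> L * (1 - q) ^ 3"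
    by (rule tendsto_ratio_change_finite[where N = 1]) (simp add: kern_def)
  then have "(\<lambda>n. (l * b n) / \<gamma> n / l) \<longlonglongrightarrow> L * (1 - q) ^ 3 / l"
    using l_pos by (intro tendsto_divide tendsto_const) auto
  then show ?thesis using l_pos by (simp add: q_def)
qed

lemma zseq_pos:
  assumes "\<And>n. 1 \<le> n \<Longrightarrow> 0 < b n"
  shows "0 < z n"
proof (cases "n = 0")
  case False
  have "0 < kern n" using False assms[of n] l_pos by (simp add: kern_def)
  also have "kern n \<le> zpos n"
    using zpos_renewal[of n] by (simp add: sum_nonneg kern_nonneg zpos_nonneg)
  finally show ?thesis using False by (simp add: zpos_def)
qed simp

end

section \<open>Square-integrable random variables\<close>

definition L2 :: "'a measure \<Rightarrow> ('a \<Rightarrow> real) \<Rightarrow> bool" where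
  "L2 M U \<longleftrightarrow> U \<in> borel_measurable M \<and> integrable M (\<lambda>\<omega>. (U \<omega>)\<^sup>2)"

lemma L2_measurable [measurable_dest]: "L2 M U \<Longrightarrow> U \<in> borel_measurable M"
  by (simp add: L2_def)

lemma L2_square: "L2 M U \<Longrightarrow> integrable M (\<lambda>\<omega>. (U \<omega>)\<^sup>2)"
  by (simp add: L2_def)

lemma L2_mult_integrable:
  assumes "L2 M U" "L2 M V"
  shows "integrable M (\<lambda>\<omega>. U \<omega> * V \<omega>)"
proof (rule Bochner_Integration.integrable_bound)
  show "integrable M (\<lambda>\<omega>. (U \<omega>)\<^sup>2 + (V \<omega>)\<^sup>2)" using assms by (auto simp: L2_def)
  show "(\<lambda>\<omega>. U \<omega> * V \<omega>) \<in> borel_measurable M" using assms by (auto simp: L2_def)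
  have "\<bar>u * v\<bar> \<le> u\<^sup>2 + v\<^sup>2" for u v :: real
  proof -
    have "2 * (\<bar>u\<bar> * \<bar>v\<bar>) \<le> u\<^sup>2 + v\<^sup>2" using sum_squares_bound[of "\<bar>u\<bar>" "\<bar>v\<bar>"] by (simp add: mult.assoc)
    moreover have "0 \<le> \<bar>u\<bar> * \<bar>v\<bar>" by simp
    ultimately show ?thesis unfolding abs_mult by linarith
  qed
  then show "AE \<omega> in M. norm (U \<omega> * V \<omega>) \<le> norm ((U \<omega>)\<^sup>2 + (V \<omega>)\<^sup>2)" by (simp add: abs_mult)
qed

lemma L2_add:
  assumes "L2 M U" "L2 M V"
  shows "L2 M (\<lambda>\<omega>. U \<omega> + V \<omega>)"
proof -
  have "integrable M (\<lambda>\<omega>. (U \<omega>)\<^sup>2 + (V \<omega>)\<^sup>2 + 2 * (U \<omega> * V \<omega>))"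
    using assms L2_mult_integrable[OF assms] by (auto simp: L2_def)
  then show ?thesis using assms by (auto simp: L2_def power2_sum mult.assoc)
qed

lemma L2_cmult: "L2 M U \<Longrightarrow> L2 M (\<lambda>\<omega>. c * U \<omega>)"
  by (auto simp: L2_def power_mult_distrib)

lemma L2_sum: "(\<And>i. i \<in> I \<Longrightarrow> L2 M (f i)) \<Longrightarrow> L2 M (\<lambda>\<omega>. \<Sum>i\<in>I. f i \<omega>)"
proof (induction I rule: infinite_finite_induct)
  case (insert x F)
  then show ?case using L2_add[of M "f x" "\<lambda>\<omega>. \<Sum>i\<in>F. f i \<omega>"] by simp
qed (auto simp: L2_def)

lemma L2_abs: "L2 M U \<Longrightarrow> L2 M (\<lambda>\<omega>. \<bar>U \<omega>\<bar>)"
  by (auto simp: L2_def)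

lemma L2_diff: "L2 M U \<Longrightarrow> L2 M V \<Longrightarrow> L2 M (\<lambda>\<omega>. U \<omega> - V \<omega>)"
  using L2_add[of M U "\<lambda>\<omega>. (-1) * V \<omega>"] L2_cmult[of M V "-1"] by simp

lemma L2_dominated:
  assumes "L2 M V" "U \<in> borel_measurable M" "AE \<omega> in M. \<bar>U \<omega>\<bar> \<le> \<bar>V \<omega>\<bar>"
  shows "L2 M U"
  unfolding L2_def
proof
  show "integrable M (\<lambda>\<omega>. (U \<omega>)\<^sup>2)"
    by (rule Bochner_Integration.integrable_bound[OF L2_square[OF assms(1)]])
       (use assms in \<open>auto simp: abs_le_square_iff\<close>)
qed (rule assms)

lemma Cauchy_Schwarz_L2:
  assumes U: "L2 M U" and V: "L2 M V"
    and \<alpha>: "(\<integral>\<omega>. (U \<omega>)\<^sup>2 \<partial>M) \<le> \<alpha>\<^sup>2" "0 \<le> \<alpha>" and \<beta>: "(\<integral>\<omega>. (V \<omega>)\<^sup>2 \<partial>M) \<le> \<beta>\<^sup>2" "0 \<le> \<beta>"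
  shows "(\<integral>\<omega>. \<bar>U \<omega> * V \<omega>\<bar> \<partial>M) \<le> \<alpha> * \<beta>"
proof -
  note [measurable] = L2_measurable[OF U] L2_measurable[OF V]
  have "ennreal ((\<integral>\<omega>. \<bar>U \<omega> * V \<omega>\<bar> \<partial>M)\<^sup>2) = (\<integral>\<^sup>+\<omega>. ennreal \<bar>U \<omega>\<bar> * ennreal \<bar>V \<omega>\<bar> \<partial>M)\<^sup>2"
  proof -
    have "(\<integral>\<^sup>+\<omega>. ennreal \<bar>U \<omega>\<bar> * ennreal \<bar>V \<omega>\<bar> \<partial>M) = (\<integral>\<^sup>+\<omega>. ennreal \<bar>U \<omega> * V \<omega>\<bar> \<partial>M)"
      by (simp only: ennreal_mult[OF abs_ge_zero abs_ge_zero, symmetric] abs_mult)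
    also have "\<dots> = ennreal (\<integral>\<omega>. \<bar>U \<omega> * V \<omega>\<bar> \<partial>M)"
      by (rule nn_integral_eq_integral[OF integrable_abs[OF L2_mult_integrable[OF U V]]]) simp
    finally show ?thesis by (simp add: ennreal_power)
  qed
  also have "\<dots> \<le> (\<integral>\<^sup>+\<omega>. (ennreal \<bar>U \<omega>\<bar>)\<^sup>2 \<partial>M) * (\<integral>\<^sup>+\<omega>. (ennreal \<bar>V \<omega>\<bar>)\<^sup>2 \<partial>M)"
    by (rule Cauchy_Schwarz_nn_integral) auto
  also have "\<dots> = ennreal ((\<integral>\<omega>. (U \<omega>)\<^sup>2 \<partial>M) * (\<integral>\<omega>. (V \<omega>)\<^sup>2 \<partial>M))"
    using L2_square[OF U] L2_square[OF V]
    by (simp add: ennreal_power nn_integral_eq_integral ennreal_mult)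
  finally have "(\<integral>\<omega>. \<bar>U \<omega> * V \<omega>\<bar> \<partial>M)\<^sup>2 \<le> (\<integral>\<omega>. (U \<omega>)\<^sup>2 \<partial>M) * (\<integral>\<omega>. (V \<omega>)\<^sup>2 \<partial>M)"
    by (subst (asm) ennreal_le_iff) auto
  also have "\<dots> \<le> \<alpha>\<^sup>2 * \<beta>\<^sup>2" by (intro mult_mono \<alpha> \<beta>) auto
  finally have "(\<integral>\<omega>. \<bar>U \<omega> * V \<omega>\<bar> \<partial>M)\<^sup>2 \<le> (\<alpha> * \<beta>)\<^sup>2" by (simp add: power_mult_distrib)
  then show ?thesis by (rule power2_le_imp_le) (use \<alpha> \<beta> in simp)
qed

context prob_space
begin

lemma L2_integrable: "L2 M U \<Longrightarrow> integrable M U"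
  by (auto simp: L2_def intro: square_integrable_imp_integrable)

lemma L2_const: "L2 M (\<lambda>_. c)"
  by (simp add: L2_def)

lemma L2_abs_le:
  assumes "L2 M U" "(\<integral>\<omega>. (U \<omega>)\<^sup>2 \<partial>M) \<le> \<alpha>\<^sup>2" "0 \<le> \<alpha>"
  shows "(\<integral>\<omega>. \<bar>U \<omega>\<bar> \<partial>M) \<le> \<alpha>"
  using Cauchy_Schwarz_L2[OF assms(1) L2_const[of 1] assms(2,3), of 1] by (simp add: prob_space)

context
  fixes \<beta> :: "nat \<Rightarrow> real" and Y :: "nat \<Rightarrow> 'a \<Rightarrow> real" and C :: real
  assumes \<beta>: "\<And>j. 0 \<le> \<beta> j" "summable \<beta>" and Y: "\<And>j. L2 M (Y j)"
    and C: "\<And>j. (\<integral>\<omega>. (Y j \<omega>)\<^sup>2 \<partial>M) \<le> C\<^sup>2" "0 \<le> C"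
begin

text \<open>
  The expectation of \<open>\<Sum>j. \<beta> j * \<bar>Y j\<bar>\<close> is at most \<open>(\<Sum>j. \<beta> j) * C\<close>.  With the next two lemmas this makes
  the series in the volatility manageable: it may be integrated term by term against square-integrable
  factors, and it is square integrable itself.
\<close>
lemma L2_series_abs_summable: "AE \<omega> in M. summable (\<lambda>j. \<beta> j * \<bar>Y j \<omega>\<bar>)"
proof -
  note [measurable] = L2_measurable[OF Y]
  have "(\<integral>\<^sup>+\<omega>. (\<Sum>j. ennreal (\<beta> j * \<bar>Y j \<omega>\<bar>)) \<partial>M) = (\<Sum>j. \<integral>\<^sup>+\<omega>. ennreal (\<beta> j * \<bar>Y j \<omega>\<bar>) \<partial>M)"
    by (rule nn_integral_suminf) auto
  also have "\<dots> \<le> (\<Sum>j. ennreal (\<beta> j * C))"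
  proof (rule suminf_le)
    fix j
    have "(\<integral>\<^sup>+\<omega>. ennreal (\<beta> j * \<bar>Y j \<omega>\<bar>) \<partial>M) = ennreal (\<integral>\<omega>. \<beta> j * \<bar>Y j \<omega>\<bar> \<partial>M)"
      by (rule nn_integral_eq_integral) (use L2_integrable[OF Y] \<beta> in auto)
    also have "(\<integral>\<omega>. \<beta> j * \<bar>Y j \<omega>\<bar> \<partial>M) = \<beta> j * (\<integral>\<omega>. \<bar>Y j \<omega>\<bar> \<partial>M)" by simp
    also have "\<dots> \<le> \<beta> j * C" by (intro mult_left_mono L2_abs_le Y C \<beta>)
    finally show "(\<integral>\<^sup>+\<omega>. ennreal (\<beta> j * \<bar>Y j \<omega>\<bar>) \<partial>M) \<le> ennreal (\<beta> j * C)"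
      by (simp add: ennreal_leI)
  qed auto
  also have "\<dots> < \<infinity>"
    by (subst suminf_ennreal2) (use \<beta> C in \<open>auto intro: summable_mult2\<close>)
  finally have "AE \<omega> in M. (\<Sum>j. ennreal (\<beta> j * \<bar>Y j \<omega>\<bar>)) \<noteq> \<infinity>"
    by (intro nn_integral_PInf_AE) auto
  then show ?thesis
    by eventually_elim (rule summable_suminf_not_top, auto simp: \<beta>)
qed

lemma L2_series_inner:
  assumes W: "L2 M W" and D: "(\<integral>\<omega>. (W \<omega>)\<^sup>2 \<partial>M) \<le> D\<^sup>2" "0 \<le> D"
  shows "integrable M (\<lambda>\<omega>. W \<omega> * (\<Sum>j. \<beta> j * Y j \<omega>))"
    and "(\<integral>\<omega>. W \<omega> * (\<Sum>j. \<beta> j * Y j \<omega>) \<partial>M) = (\<Sum>j. \<beta> j * (\<integral>\<omega>. W \<omega> * Y j \<omega> \<partial>M))"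
    and "(\<integral>\<omega>. \<bar>W \<omega> * (\<Sum>j. \<beta> j * Y j \<omega>)\<bar> \<partial>M) \<le> D * C * (\<Sum>j. \<beta> j)"
    and "summable (\<lambda>j. \<beta> j * (\<integral>\<omega>. W \<omega> * Y j \<omega> \<partial>M))"
proof -
  define f where "f j \<omega> = \<beta> j * (W \<omega> * Y j \<omega>)" for j \<omega>
  have i: "integrable M (f j)" for j
    unfolding f_def using L2_mult_integrable[OF W Y] by simp
  have as: "AE \<omega> in M. summable (\<lambda>j. norm (f j \<omega>))"
    using L2_series_abs_summable
  proof eventually_elim
    case (elim \<omega>)
    from summable_mult[OF this, of "\<bar>W \<omega>\<bar>"] show ?case
      by (simp add: f_def abs_mult \<beta>(1) mult_ac)
  qed
  have nb: "(\<integral>\<omega>. norm (f j \<omega>) \<partial>M) \<le> \<beta> j * (D * C)" for j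
  proof -
    have "(\<integral>\<omega>. norm (f j \<omega>) \<partial>M) = \<beta> j * (\<integral>\<omega>. \<bar>W \<omega> * Y j \<omega>\<bar> \<partial>M)"
    proof -
      have "norm (f j \<omega>) = \<beta> j * \<bar>W \<omega> * Y j \<omega>\<bar>" for \<omega>
        unfolding f_def real_norm_def abs_mult[of "\<beta> j"] by (simp only: abs_of_nonneg[OF \<beta>(1)])
      then show ?thesis by (simp only: Bochner_Integration.integral_mult_right_zero)
    qed
    also have "\<dots> \<le> \<beta> j * (D * C)" by (intro mult_left_mono Cauchy_Schwarz_L2 W Y D C \<beta>)
    finally show ?thesis .
  qed
  have ns: "summable (\<lambda>j. \<integral>\<omega>. norm (f j \<omega>) \<partial>M)"
  proof (rule summable_comparison_test'[OF summable_mult2[OF \<beta>(2), of "D * C"], of 0])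
    fix j :: nat
    have "0 \<le> (\<integral>\<omega>. norm (f j \<omega>) \<partial>M)" by (rule Bochner_Integration.integral_nonneg) (rule norm_ge_zero)
    then show "norm (\<integral>\<omega>. norm (f j \<omega>) \<partial>M) \<le> \<beta> j * (D * C)"
      using nb[of j] by (simp only: real_norm_def abs_of_nonneg)
  qed
  have ae: "AE \<omega> in M. (\<Sum>j. f j \<omega>) = W \<omega> * (\<Sum>j. \<beta> j * Y j \<omega>)"
    using L2_series_abs_summable
  proof eventually_elim
    case (elim \<omega>)
    then have "summable (\<lambda>j. \<bar>\<beta> j * Y j \<omega>\<bar>)" by (simp add: abs_mult \<beta>(1))
    then have "summable (\<lambda>j. \<beta> j * Y j \<omega>)" by (rule summable_rabs_cancel)
    from suminf_mult[OF this, of "W \<omega>"] show ?case by (simp add: f_def mult.left_commute)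
  qed
  note [measurable] = L2_measurable[OF Y] L2_measurable[OF W]
  have fm [measurable]: "f j \<in> borel_measurable M" for j unfolding f_def by measurable
  have isum: "integrable M (\<lambda>\<omega>. \<Sum>j. f j \<omega>)" by (rule integrable_suminf[OF i as ns])
  show int: "integrable M (\<lambda>\<omega>. W \<omega> * (\<Sum>j. \<beta> j * Y j \<omega>))"
    by (rule integrable_cong_AE_imp[OF isum _ ae]) measurable
  have "(\<integral>\<omega>. W \<omega> * (\<Sum>j. \<beta> j * Y j \<omega>) \<partial>M) = (\<integral>\<omega>. (\<Sum>j. f j \<omega>) \<partial>M)"
    by (rule integral_cong_AE) (use ae in auto)
  also have "\<dots> = (\<Sum>j. \<integral>\<omega>. f j \<omega> \<partial>M)" by (rule integral_suminf[OF i as ns])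
  finally show "(\<integral>\<omega>. W \<omega> * (\<Sum>j. \<beta> j * Y j \<omega>) \<partial>M) = (\<Sum>j. \<beta> j * (\<integral>\<omega>. W \<omega> * Y j \<omega> \<partial>M))"
    by (simp add: f_def)
  show "summable (\<lambda>j. \<beta> j * (\<integral>\<omega>. W \<omega> * Y j \<omega> \<partial>M))"
    using summable_integral[OF i as ns] by (simp add: f_def)
  have isn: "integrable M (\<lambda>\<omega>. \<Sum>j. norm (f j \<omega>))"
    by (rule integrable_suminf) (use i as ns in auto)
  have "(\<integral>\<omega>. \<bar>W \<omega> * (\<Sum>j. \<beta> j * Y j \<omega>)\<bar> \<partial>M) \<le> (\<integral>\<omega>. (\<Sum>j. norm (f j \<omega>)) \<partial>M)"
  proof (rule integral_mono_AE)
    show "integrable M (\<lambda>\<omega>. \<bar>W \<omega> * (\<Sum>j. \<beta> j * Y j \<omega>)\<bar>)" using int by simp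
    show "AE \<omega> in M. \<bar>W \<omega> * (\<Sum>j. \<beta> j * Y j \<omega>)\<bar> \<le> (\<Sum>j. norm (f j \<omega>))"
      using ae as
    proof eventually_elim
      case (elim \<omega>)
      then show ?case using summable_norm[of "\<lambda>j. f j \<omega>"] by simp
    qed
  qed (rule isn)
  also have "\<dots> = (\<Sum>j. \<integral>\<omega>. norm (f j \<omega>) \<partial>M)"
    by (rule integral_suminf) (use i as ns in auto)
  also have "\<dots> \<le> (\<Sum>j. \<beta> j * (D * C))" by (intro suminf_le nb ns summable_mult2 \<beta>)
  also have "\<dots> = D * C * (\<Sum>j. \<beta> j)" using suminf_mult2[OF \<beta>(2), of "D * C"] by (simp add: mult.commute)
  finally show "(\<integral>\<omega>. \<bar>W \<omega> * (\<Sum>j. \<beta> j * Y j \<omega>)\<bar> \<partial>M) \<le> D * C * (\<Sum>j. \<beta> j)" .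
qed

text \<open>
  The partial sums of \<open>\<beta> j * \<bar>Y j\<bar>\<close> have second moments bounded by \<open>((\<Sum>j. \<beta> j) * C)\<^sup>2\<close>; Fatou's lemma
  carries the bound over to the limit.
\<close>
lemma L2_series: "L2 M (\<lambda>\<omega>. \<Sum>j. \<beta> j * Y j \<omega>)"
proof -
  note [measurable] = L2_measurable[OF Y]
  define T where "T N \<omega> = (\<Sum>j<N. \<beta> j * \<bar>Y j \<omega>\<bar>)" for N \<omega>
  have Tm [measurable]: "T N \<in> borel_measurable M" for N unfolding T_def by measurable
  have TL: "L2 M (T N)" for N unfolding T_def by (intro L2_sum L2_cmult L2_abs Y)
  define D where "D = (\<Sum>j. \<beta> j) * C"
  have ET: "(\<integral>\<omega>. (T N \<omega>)\<^sup>2 \<partial>M) \<le> D\<^sup>2" for N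
  proof -
    have "(\<integral>\<omega>. (T N \<omega>)\<^sup>2 \<partial>M) = (\<integral>\<omega>. (\<Sum>i<N. \<Sum>j<N. \<beta> i * \<beta> j * \<bar>Y i \<omega> * Y j \<omega>\<bar>) \<partial>M)"
      unfolding T_def power2_eq_square sum_product abs_mult by (simp only: mult.assoc mult.left_commute)
    also have "\<dots> = (\<Sum>i<N. \<Sum>j<N. \<beta> i * \<beta> j * (\<integral>\<omega>. \<bar>Y i \<omega> * Y j \<omega>\<bar> \<partial>M))"
    proof -
      have i: "integrable M (\<lambda>\<omega>. \<beta> i * \<beta> j * \<bar>Y i \<omega> * Y j \<omega>\<bar>)" for i j
        by (intro integrable_mult_right integrable_abs L2_mult_integrable Y)
      show ?thesis
        by (simp only: Bochner_Integration.integral_sum[OF Bochner_Integration.integrable_sum[OF i]]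
            Bochner_Integration.integral_sum[OF i] Bochner_Integration.integral_mult_right_zero)
    qed
    also have "\<dots> \<le> (\<Sum>i<N. \<Sum>j<N. \<beta> i * \<beta> j * (C * C))"
      by (intro sum_mono mult_left_mono Cauchy_Schwarz_L2 Y C mult_nonneg_nonneg \<beta>)
    also have "\<dots> = (\<Sum>j<N. \<beta> j) * (\<Sum>j<N. \<beta> j) * (C * C)" by (subst sum_product) (simp only: sum_distrib_right)
    also have "\<dots> = ((\<Sum>j<N. \<beta> j) * C)\<^sup>2" by (simp add: power2_eq_square mult_ac)
    also have "\<dots> \<le> D\<^sup>2" unfolding D_def
      by (intro power_mono mult_right_mono sum_le_suminf mult_nonneg_nonneg sum_nonneg \<beta> C) auto
    finally show ?thesis .
  qed
  have conv: "AE \<omega> in M. (\<lambda>N. T N \<omega>) \<longlonglongrightarrow> (\<Sum>j. \<beta> j * \<bar>Y j \<omega>\<bar>)"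
    using L2_series_abs_summable unfolding T_def by eventually_elim (rule summable_LIMSEQ)
  have "(\<integral>\<^sup>+\<omega>. ennreal ((\<Sum>j. \<beta> j * \<bar>Y j \<omega>\<bar>)\<^sup>2) \<partial>M) = (\<integral>\<^sup>+\<omega>. liminf (\<lambda>N. ennreal ((T N \<omega>)\<^sup>2)) \<partial>M)"
  proof (rule nn_integral_cong_AE)
    show "AE \<omega> in M. ennreal ((\<Sum>j. \<beta> j * \<bar>Y j \<omega>\<bar>)\<^sup>2) = liminf (\<lambda>N. ennreal ((T N \<omega>)\<^sup>2))"
      using conv
    proof eventually_elim
      case (elim \<omega>)
      then have "(\<lambda>N. ennreal ((T N \<omega>)\<^sup>2)) \<longlonglongrightarrow> ennreal ((\<Sum>j. \<beta> j * \<bar>Y j \<omega>\<bar>)\<^sup>2)"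
        by (intro tendsto_ennrealI tendsto_power)
      then show ?case by (intro lim_imp_Liminf[symmetric]) auto
    qed
  qed
  also have "\<dots> \<le> liminf (\<lambda>N. \<integral>\<^sup>+\<omega>. ennreal ((T N \<omega>)\<^sup>2) \<partial>M)" by (rule nn_integral_liminf) auto
  also have "\<dots> \<le> liminf (\<lambda>N. ennreal (D\<^sup>2))"
    by (intro Liminf_mono always_eventually allI)
       (use L2_square[OF TL] ET in \<open>auto simp: nn_integral_eq_integral intro!: ennreal_leI\<close>)
  also have "\<dots> < \<infinity>" by (simp add: Liminf_const)
  finally have fin: "(\<integral>\<^sup>+\<omega>. ennreal ((\<Sum>j. \<beta> j * \<bar>Y j \<omega>\<bar>)\<^sup>2) \<partial>M) < \<infinity>" .
  have "L2 M (\<lambda>\<omega>. \<Sum>j. \<beta> j * \<bar>Y j \<omega>\<bar>)"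
    unfolding L2_def by (intro conjI integrableI_bounded) (use fin in auto)
  then show ?thesis
  proof (rule L2_dominated)
    show "AE \<omega> in M. \<bar>\<Sum>j. \<beta> j * Y j \<omega>\<bar> \<le> \<bar>\<Sum>j. \<beta> j * \<bar>Y j \<omega>\<bar>\<bar>"
      using L2_series_abs_summable
    proof eventually_elim
      case (elim \<omega>)
      then show ?case using summable_rabs[of "\<lambda>j. \<beta> j * Y j \<omega>"] by (simp add: abs_mult \<beta>(1))
    qed
  qed measurable
qed

end

lemma L2_orthogonal_sum:
  assumes "finite I" and L: "\<And>i. i \<in> I \<Longrightarrow> L2 M (D i)"
    and orth: "\<And>i j. i \<in> I \<Longrightarrow> j \<in> I \<Longrightarrow> i \<noteq> j \<Longrightarrow> (\<integral>\<omega>. D i \<omega> * D j \<omega> \<partial>M) = 0"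
  shows "(\<integral>\<omega>. (\<Sum>i\<in>I. c i * D i \<omega>)\<^sup>2 \<partial>M) = (\<Sum>i\<in>I. (c i)\<^sup>2 * (\<integral>\<omega>. (D i \<omega>)\<^sup>2 \<partial>M))"
proof -
  have "(\<integral>\<omega>. (\<Sum>i\<in>I. c i * D i \<omega>)\<^sup>2 \<partial>M) = (\<integral>\<omega>. (\<Sum>i\<in>I. \<Sum>j\<in>I. (c i * c j) * (D i \<omega> * D j \<omega>)) \<partial>M)"
    by (simp add: power2_eq_square sum_product mult_ac)
  also have "\<dots> = (\<Sum>i\<in>I. \<Sum>j\<in>I. (c i * c j) * (\<integral>\<omega>. D i \<omega> * D j \<omega> \<partial>M))"
    using L2_mult_integrable[OF L L] by simp
  also have "\<dots> = (\<Sum>i\<in>I. \<Sum>j\<in>I. if j = i then (c i)\<^sup>2 * (\<integral>\<omega>. (D i \<omega>)\<^sup>2 \<partial>M) else 0)"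
    by (intro sum.cong refl) (auto simp: orth power2_eq_square)
  also have "\<dots> = (\<Sum>i\<in>I. (c i)\<^sup>2 * (\<integral>\<omega>. (D i \<omega>)\<^sup>2 \<partial>M))" using \<open>finite I\<close> by simp
  finally show ?thesis .
qed

end

section \<open>Independent noise and its past\<close>

locale iid_sequence = prob_space M for M :: "'a measure" +
  fixes \<xi> :: "int \<Rightarrow> 'a \<Rightarrow> real"
  assumes iid: "iid_noise M \<xi>"
begin

abbreviation "l \<equiv> lam1 M \<xi>"
abbreviation "sd \<equiv> noise_sd M \<xi>"

lemma noise_measurable [measurable]: "\<xi> k \<in> borel_measurable M"
  using iid by (auto simp: iid_noise_def indep_vars_def)

lemma noise_transfer:
  assumes [measurable]: "g \<in> borel_measurable (borel :: real measure)" and "integrable M (\<lambda>\<omega>. g (\<xi> 0 \<omega>) :: real)"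
  shows "integrable M (\<lambda>\<omega>. g (\<xi> k \<omega>))" "(\<integral>\<omega>. g (\<xi> k \<omega>) \<partial>M) = (\<integral>\<omega>. g (\<xi> 0 \<omega>) \<partial>M)"
proof -
  have d: "distr M borel (\<xi> k) = distr M borel (\<xi> 0)" using iid unfolding iid_noise_def by blast
  have "integrable (distr M borel (\<xi> 0)) g" using assms by (simp add: integrable_distr_eq)
  then have "integrable (distr M borel (\<xi> k)) g" by (simp only: d)
  then show "integrable M (\<lambda>\<omega>. g (\<xi> k \<omega>))" by (simp add: integrable_distr_eq)
  have "(\<integral>\<omega>. g (\<xi> k \<omega>) \<partial>M) = integral\<^sup>L (distr M borel (\<xi> k)) g" by (simp add: integral_distr)
  also have "\<dots> = (\<integral>\<omega>. g (\<xi> 0 \<omega>) \<partial>M)" by (simp add: d integral_distr)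
  finally show "(\<integral>\<omega>. g (\<xi> k \<omega>) \<partial>M) = (\<integral>\<omega>. g (\<xi> 0 \<omega>) \<partial>M)" .
qed

lemma noise_L2: "L2 M (\<xi> k)"
  using noise_transfer(1)[of "\<lambda>x. x\<^sup>2" k] iid by (auto simp: L2_def iid_noise_def)

lemma noise_mean: "(\<integral>\<omega>. \<xi> k \<omega> \<partial>M) = l"
  using noise_transfer(2)[of "\<lambda>x. x" k] L2_integrable[OF noise_L2] by (simp add: lam1_def)

definition lam2 :: real where "lam2 = (\<integral>\<omega>. (\<xi> 0 \<omega>)\<^sup>2 \<partial>M)"

lemma noise_second_moment: "(\<integral>\<omega>. (\<xi> k \<omega>)\<^sup>2 \<partial>M) = lam2"
  using noise_transfer(2)[of "\<lambda>x. x\<^sup>2" k] L2_square[OF noise_L2] by (simp add: lam2_def)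

lemma centered_L2: "L2 M (\<lambda>\<omega>. \<xi> k \<omega> - l)"
  by (intro L2_diff noise_L2 L2_const)

lemma noise_variance: "(\<integral>\<omega>. (\<xi> k \<omega> - l)\<^sup>2 \<partial>M) = sd\<^sup>2"
  using noise_transfer(2)[of "\<lambda>x. (x - l)\<^sup>2" k] L2_square[OF centered_L2]
  by (simp add: noise_sd_def)

lemma lam2_eq: "lam2 = sd\<^sup>2 + l\<^sup>2"
proof -
  have "sd\<^sup>2 = (\<integral>\<omega>. (\<xi> 0 \<omega>)\<^sup>2 + l\<^sup>2 - (2 * l) * \<xi> 0 \<omega> \<partial>M)"
    unfolding noise_variance[of 0, symmetric] by (simp add: power2_diff mult_ac)
  also have "\<dots> = lam2 + l\<^sup>2 - (2 * l) * l"
    using L2_square[OF noise_L2] L2_integrable[OF noise_L2]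
    by (simp add: noise_second_moment noise_mean prob_space)
  finally show ?thesis by (simp add: power2_eq_square)
qed

lemma noise_nonneg: "AE \<omega> in M. \<forall>k. 0 \<le> \<xi> k \<omega>"
  using iid by (simp add: AE_all_countable iid_noise_def)

text \<open>
  Measurability with respect to the noise strictly before time \<open>k\<close>, in the factorised form that the
  independence of disjoint blocks of the family delivers.
\<close>
definition past :: "int \<Rightarrow> ('a \<Rightarrow> real) \<Rightarrow> bool" where
  "past k W \<longleftrightarrow> (\<exists>F\<in>borel_measurable (PiM {..<k} (\<lambda>_. borel)). W = (\<lambda>\<omega>. F (\<lambda>i\<in>{..<k}. \<xi> i \<omega>)))"

lemma past_const: "past k (\<lambda>_. c)"
  unfolding past_def by (intro bexI[of _ "\<lambda>_. c"]) auto

lemma past_noise: "i < k \<Longrightarrow> past k (\<xi> i)"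
  unfolding past_def by (intro bexI[of _ "\<lambda>f. f i"]) auto

lemma past_add:
  assumes "past k U" "past k V"
  shows "past k (\<lambda>\<omega>. U \<omega> + V \<omega>)"
proof -
  from assms obtain F G where "F \<in> borel_measurable (PiM {..<k} (\<lambda>_. borel))" "G \<in> borel_measurable (PiM {..<k} (\<lambda>_. borel))"
    "U = (\<lambda>\<omega>. F (\<lambda>i\<in>{..<k}. \<xi> i \<omega>))" "V = (\<lambda>\<omega>. G (\<lambda>i\<in>{..<k}. \<xi> i \<omega>))"
    unfolding past_def by blast
  then show ?thesis unfolding past_def by (intro bexI[of _ "\<lambda>f. F f + G f"]) auto
qed

lemma past_mult:
  assumes "past k U" "past k V"
  shows "past k (\<lambda>\<omega>. U \<omega> * V \<omega>)"
proof -
  from assms obtain F G where "F \<in> borel_measurable (PiM {..<k} (\<lambda>_. borel))" "G \<in> borel_measurable (PiM {..<k} (\<lambda>_. borel))"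
    "U = (\<lambda>\<omega>. F (\<lambda>i\<in>{..<k}. \<xi> i \<omega>))" "V = (\<lambda>\<omega>. G (\<lambda>i\<in>{..<k}. \<xi> i \<omega>))"
    unfolding past_def by blast
  then show ?thesis unfolding past_def by (intro bexI[of _ "\<lambda>f. F f * G f"]) auto
qed

lemma past_sum: "(\<And>i. i \<in> I \<Longrightarrow> past k (f i)) \<Longrightarrow> past k (\<lambda>\<omega>. \<Sum>i\<in>I. f i \<omega>)"
proof (induction I rule: infinite_finite_induct)
  case (insert x F)
  then show ?case using past_add[of k "f x" "\<lambda>\<omega>. \<Sum>i\<in>F. f i \<omega>"] by simp
qed (simp_all add: past_const)

lemma past_diff: "past k U \<Longrightarrow> past k V \<Longrightarrow> past k (\<lambda>\<omega>. U \<omega> - V \<omega>)"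
  using past_add[of k U "\<lambda>\<omega>. (-1) * V \<omega>"] past_mult[OF past_const[of k "-1"], of V] by simp

lemma past_independent:
  assumes g [measurable]: "g \<in> borel_measurable (borel :: real measure)" and "integrable M (\<lambda>\<omega>. g (\<xi> 0 \<omega>) :: real)"
    and W: "past k W" "integrable M W"
  shows "integrable M (\<lambda>\<omega>. g (\<xi> k \<omega>) * W \<omega>)"
    and "(\<integral>\<omega>. g (\<xi> k \<omega>) * W \<omega> \<partial>M) = (\<integral>\<omega>. g (\<xi> 0 \<omega>) \<partial>M) * (\<integral>\<omega>. W \<omega> \<partial>M)"
proof -
  from W(1) obtain F where F: "F \<in> borel_measurable (PiM {..<k} (\<lambda>_. borel))" "W = (\<lambda>\<omega>. F (\<lambda>i\<in>{..<k}. \<xi> i \<omega>))"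
    unfolding past_def by blast
  have "indep_vars (\<lambda>_. borel) \<xi> UNIV" using iid by (simp add: iid_noise_def)
  then have "indep_var (PiM {k} (\<lambda>_. borel)) (\<lambda>\<omega>. \<lambda>i\<in>{k}. \<xi> i \<omega>) (PiM {..<k} (\<lambda>_. borel)) (\<lambda>\<omega>. \<lambda>i\<in>{..<k}. \<xi> i \<omega>)"
    by (rule indep_var_restrict) auto
  moreover have "(\<lambda>f. g (f k)) \<in> borel_measurable (PiM {k} (\<lambda>_. borel))" by measurable
  ultimately have "indep_var borel ((\<lambda>f. g (f k)) \<circ> (\<lambda>\<omega>. \<lambda>i\<in>{k}. \<xi> i \<omega>)) borel (F \<circ> (\<lambda>\<omega>. \<lambda>i\<in>{..<k}. \<xi> i \<omega>))"
    using F(1) by (rule indep_var_compose)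
  then have ind: "indep_var borel (\<lambda>\<omega>. g (\<xi> k \<omega>)) borel W" by (simp add: F(2) comp_def)
  note t = noise_transfer[OF assms(1,2), of k]
  show "integrable M (\<lambda>\<omega>. g (\<xi> k \<omega>) * W \<omega>)" by (rule indep_var_integrable[OF ind t(1) W(2)])
  show "(\<integral>\<omega>. g (\<xi> k \<omega>) * W \<omega> \<partial>M) = (\<integral>\<omega>. g (\<xi> 0 \<omega>) \<partial>M) * (\<integral>\<omega>. W \<omega> \<partial>M)"
    by (simp only: indep_var_lebesgue_integral[OF ind t(1) W(2)] t(2))
qed

lemma noise_past_mean:
  assumes "past k W" "integrable M W"
  shows "(\<integral>\<omega>. \<xi> k \<omega> * W \<omega> \<partial>M) = l * (\<integral>\<omega>. W \<omega> \<partial>M)"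
  using past_independent(2)[of "\<lambda>x. x", OF _ _ assms] L2_integrable[OF noise_L2] by (simp add: lam1_def)

lemma centered_past_mean:
  assumes "past k W" "integrable M W"
  shows "(\<integral>\<omega>. (\<xi> k \<omega> - l) * W \<omega> \<partial>M) = 0"
  using past_independent(2)[of "\<lambda>x. x - l", OF _ _ assms] L2_integrable[OF centered_L2] L2_integrable[OF noise_L2]
  by (simp add: noise_mean prob_space)

lemma noise_past_L2:
  assumes "past k W" "L2 M W"
  shows "L2 M (\<lambda>\<omega>. \<xi> k \<omega> * W \<omega>)" "(\<integral>\<omega>. (\<xi> k \<omega> * W \<omega>)\<^sup>2 \<partial>M) = lam2 * (\<integral>\<omega>. (W \<omega>)\<^sup>2 \<partial>M)"
proof -
  have "past k (\<lambda>\<omega>. (W \<omega>)\<^sup>2)" using past_mult[OF assms(1) assms(1)] by (simp add: power2_eq_square)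
  from past_independent[of "\<lambda>x. x\<^sup>2", OF _ _ this L2_square[OF assms(2)]] L2_square[OF noise_L2] L2_measurable[OF assms(2)]
  show "L2 M (\<lambda>\<omega>. \<xi> k \<omega> * W \<omega>)" "(\<integral>\<omega>. (\<xi> k \<omega> * W \<omega>)\<^sup>2 \<partial>M) = lam2 * (\<integral>\<omega>. (W \<omega>)\<^sup>2 \<partial>M)"
    by (simp_all add: L2_def power_mult_distrib lam2_def)
qed

lemma centered_past_L2:
  assumes "past k W" "L2 M W"
  shows "L2 M (\<lambda>\<omega>. (\<xi> k \<omega> - l) * W \<omega>)" "(\<integral>\<omega>. ((\<xi> k \<omega> - l) * W \<omega>)\<^sup>2 \<partial>M) = sd\<^sup>2 * (\<integral>\<omega>. (W \<omega>)\<^sup>2 \<partial>M)"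
proof -
  have "past k (\<lambda>\<omega>. (W \<omega>)\<^sup>2)" using past_mult[OF assms(1) assms(1)] by (simp add: power2_eq_square)
  from past_independent[of "\<lambda>x. (x - l)\<^sup>2", OF _ _ this L2_square[OF assms(2)]] L2_square[OF centered_L2] L2_measurable[OF assms(2)]
  show "L2 M (\<lambda>\<omega>. (\<xi> k \<omega> - l) * W \<omega>)" "(\<integral>\<omega>. ((\<xi> k \<omega> - l) * W \<omega>)\<^sup>2 \<partial>M) = sd\<^sup>2 * (\<integral>\<omega>. (W \<omega>)\<^sup>2 \<partial>M)"
    by (simp_all add: L2_def power_mult_distrib noise_variance)
qed

end

section \<open>The Green function of the random recursion\<close>

text \<open>
  The Green function: \<open>green b u k i\<close> is the sum over all paths from \<open>k\<close> down to \<open>k - i\<close> of the products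
  of coefficients \<open>b\<close> over the jumps and of values \<open>u\<close> at the points visited.  The recursion is on the
  first jump, of length \<open>Suc i - m\<close>.
\<close>
fun green :: "(nat \<Rightarrow> real) \<Rightarrow> (int \<Rightarrow> real) \<Rightarrow> int \<Rightarrow> nat \<Rightarrow> real" where
  "green b u k 0 = u k"
| "green b u k (Suc i) = u k * (\<Sum>m\<le>i. b (Suc i - m) * green b u (k - int (Suc i - m)) m)"

text \<open>
  Decomposition of a sum over paths of length at most \<open>n\<close> according to the first jump.  It is used with
  constant \<open>A\<close> for the truncated solution, and with the tails of a solution as \<open>A\<close> for the remainder.
\<close>
lemma green_sum:
  "(\<Sum>i\<le>n. green b u k i * A (n - i) (k - int i)) =
     u k * (A n k + (\<Sum>j<n. b (Suc j) *
       (\<Sum>i\<le>n - Suc j. green b u (k - int (Suc j)) i * A (n - Suc j - i) (k - int (Suc j) - int i))))"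
proof -
  define T where "T j i = b (Suc j) * (green b u (k - int (Suc j)) i * A (n - Suc j - i) (k - int (Suc j) - int i))" for j i
  have "(\<Sum>i\<le>n. green b u k i * A (n - i) (k - int i)) =
      u k * A n k + (\<Sum>p<n. green b u k (Suc p) * A (n - Suc p) (k - int (Suc p)))"
    unfolding lessThan_Suc_atMost[symmetric] by (subst sum.lessThan_Suc_shift) simp
  also have "(\<Sum>p<n. green b u k (Suc p) * A (n - Suc p) (k - int (Suc p))) = (\<Sum>p<n. \<Sum>m\<le>p. u k * T (p - m) m)"
  proof (intro sum.cong refl)
    fix p assume "p \<in> {..<n}"
    have "T (p - m) m = b (Suc p - m) * green b u (k - int (Suc p - m)) m * A (n - Suc p) (k - int (Suc p))" if "m \<le> p" for m
    proof -
      have "Suc (p - m) = Suc p - m" "n - Suc (p - m) - m = n - Suc p"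
        and "k - int (Suc (p - m)) - int m = k - int (Suc p)" using that \<open>p \<in> _\<close> by (auto simp: of_nat_diff)
      then show ?thesis unfolding T_def by (simp only: mult.assoc)
    qed
    then show "green b u k (Suc p) * A (n - Suc p) (k - int (Suc p)) = (\<Sum>m\<le>p. u k * T (p - m) m)"
      by (simp add: sum_distrib_left sum_distrib_right mult.assoc)
  qed
  also have "(\<Sum>p<n. \<Sum>m\<le>p. u k * T (p - m) m) = (\<Sum>(p, m)\<in>Sigma {..<n} (\<lambda>p. {..p}). u k * T (p - m) m)"
    by (rule sum.Sigma) auto
  also have "\<dots> = (\<Sum>(j, i)\<in>Sigma {..<n} (\<lambda>j. {..n - Suc j}). u k * T j i)"
    by (rule sum.reindex_bij_witness[of _ "\<lambda>(j, i). (j + i, i)" "\<lambda>(p, m). (p - m, m)"]) auto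
  also have "\<dots> = (\<Sum>j<n. \<Sum>i\<le>n - Suc j. u k * T j i)"
    by (rule sum.Sigma[symmetric]) auto
  finally show ?thesis by (simp add: T_def sum_distrib_left distrib_left)
qed

text \<open>
  Iteration of the equation for a single path \<open>u\<close> of the noise: from each point \<open>k - i\<close> the jumps that
  stay within distance \<open>n\<close> of \<open>k\<close> have been expanded, the longer ones remain as a tail.
\<close>
lemma green_expansion:
  fixes u v :: "int \<Rightarrow> real"
  assumes s: "\<And>k. summable (\<lambda>j. b (Suc j) * v (k - int (Suc j)))"
    and v: "\<And>k. v k = (a + (\<Sum>j. b (Suc j) * v (k - int (Suc j)))) * u k"
  shows "v k = (\<Sum>i\<le>n. green b u k i * (a + (\<Sum>j. b (Suc (j + (n - i))) * v (k - int i - int (Suc (j + (n - i)))))))"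
proof (induction n arbitrary: k rule: less_induct)
  case (less n)
  define A where "A p q = a + (\<Sum>j. b (Suc (j + p)) * v (q - int (Suc (j + p))))" for p q
  have IH: "v q = (\<Sum>i\<le>p. green b u q i * A (p - i) (q - int i))" if "p < n" for p q
    unfolding A_def by (rule less.IH[OF that])
  have "v k = u k * (a + (\<Sum>j. b (Suc j) * v (k - int (Suc j))))" by (subst v) (rule mult.commute)
  also have "(\<Sum>j. b (Suc j) * v (k - int (Suc j))) =
      (\<Sum>j. b (Suc (j + n)) * v (k - int (Suc (j + n)))) + (\<Sum>j<n. b (Suc j) * v (k - int (Suc j)))"
    by (rule suminf_split_initial_segment[OF s])
  also have "a + \<dots> = A n k + (\<Sum>j<n. b (Suc j) * v (k - int (Suc j)))" by (simp add: A_def)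
  also have "(\<Sum>j<n. b (Suc j) * v (k - int (Suc j))) = (\<Sum>j<n. b (Suc j) *
      (\<Sum>i\<le>n - Suc j. green b u (k - int (Suc j)) i * A (n - Suc j - i) (k - int (Suc j) - int i)))"
  proof (intro sum.cong refl)
    fix j assume "j \<in> {..<n}"
    then have "n - Suc j < n" by auto
    from IH[OF this] show "b (Suc j) * v (k - int (Suc j)) = b (Suc j) *
      (\<Sum>i\<le>n - Suc j. green b u (k - int (Suc j)) i * A (n - Suc j - i) (k - int (Suc j) - int i))"
      by (rule arg_cong)
  qed
  also have "u k * (A n k + \<dots>) = (\<Sum>i\<le>n. green b u k i * A (n - i) (k - int i))"
    by (rule green_sum[symmetric])
  finally show ?case unfolding A_def .
qed

locale arch_model = iid_sequence M \<xi> for M :: "'a measure" and \<xi> +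
  fixes b :: "nat \<Rightarrow> real"
  assumes l_pos: "0 < lam1 M \<xi>" and sd_pos: "0 < noise_sd M \<xi>"
    and b_nonneg: "\<And>j. 0 \<le> b (Suc j)" and b_summable: "summable (\<lambda>j. b (Suc j))"
    and lB: "lam1 M \<xi> * bsum b < 1" and Omega: "Omega M \<xi> b < 1"
begin

sublocale kernel "lam1 M \<xi>" b
  by unfold_locales (use l_pos b_nonneg b_summable lB in auto)

definition G :: "int \<Rightarrow> nat \<Rightarrow> 'a \<Rightarrow> real" where
  "G k i \<omega> = green b (\<lambda>j. \<xi> j \<omega>) k i"

lemma G_0: "G k 0 \<omega> = \<xi> k \<omega>" by (simp add: G_def)

text \<open>
  For a fixed starting time \<open>m\<close>, the sequence \<open>n \<mapsto> G (m + n) n\<close> solves the homogeneous equation forward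
  in time; \<open>inp m n\<close> is its volatility, a function of the noise before time \<open>m + n\<close>.
\<close>
definition inp :: "int \<Rightarrow> nat \<Rightarrow> 'a \<Rightarrow> real" where
  "inp m n \<omega> = (\<Sum>j<n. b (n - j) * G (m + int j) j \<omega>)"

lemma G_step: "0 < n \<Longrightarrow> G (m + int n) n \<omega> = \<xi> (m + int n) \<omega> * inp m n \<omega>"
proof -
  assume "0 < n"
  then obtain i where n: "n = Suc i" by (cases n) auto
  have "m + int (Suc i) - int (Suc i - j) = m + int j" if "j \<le> i" for j using that by (simp add: of_nat_diff)
  then show ?thesis unfolding n G_def inp_def green.simps lessThan_Suc_atMost by simp
qed

lemma G_past_L2: "(k < k' \<longrightarrow> past k' (G k i)) \<and> L2 M (G k i)"
proof (induction i arbitrary: k k' rule: less_induct)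
  case (less i)
  show ?case
  proof (cases "i = 0")
    case True
    have "G k 0 = \<xi> k" by (rule ext) (rule G_0)
    then show ?thesis using True noise_L2 past_noise by auto
  next
    case False
    define m where "m = k - int i"
    have k: "k = m + int i" by (simp add: m_def)
    have eq: "G k i = (\<lambda>\<omega>. \<xi> k \<omega> * inp m i \<omega>)" unfolding k using False by (intro ext G_step) simp
    have "past k'' (inp m i)" if "k \<le> k''" for k''
      unfolding inp_def[abs_def] using that less by (intro past_sum past_mult past_const) (auto simp: k)
    moreover have "L2 M (inp m i)"
      unfolding inp_def[abs_def] using less by (intro L2_sum L2_cmult) auto
    ultimately show ?thesis unfolding eq
      using noise_past_L2(1)[of k "inp m i"] by (auto intro: past_mult past_noise)
  qed
qed

lemma G_past: "k < k' \<Longrightarrow> past k' (G k i)" and G_L2: "L2 M (G k i)"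
  using G_past_L2 by auto

lemma inp_past: "past (m + int n) (inp m n)"
  unfolding inp_def[abs_def] by (intro past_sum past_mult past_const G_past) auto

lemma inp_L2: "L2 M (inp m n)"
  unfolding inp_def[abs_def] by (intro L2_sum L2_cmult G_L2)

text \<open>
  The martingale differences of the sequence \<open>n \<mapsto> G (m + n) n\<close>, preceded by its initial value.
\<close>
definition innov :: "int \<Rightarrow> nat \<Rightarrow> 'a \<Rightarrow> real" where
  "innov m n \<omega> = (if n = 0 then \<xi> m \<omega> else (\<xi> (m + int n) \<omega> - l) * inp m n \<omega>)"

lemma kern_inp: "(\<Sum>i\<le>n. kern i * G (m + int (n - i)) (n - i) \<omega>) = l * inp m n \<omega>"
proof -
  have "(\<Sum>i\<le>n. kern i * G (m + int (n - i)) (n - i) \<omega>) = (\<Sum>j\<le>n. kern (n - j) * G (m + int j) j \<omega>)"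
    by (rule sum.reindex_bij_witness[of _ "\<lambda>j. n - j" "\<lambda>j. n - j"]) auto
  also have "\<dots> = (\<Sum>j<n. kern (n - j) * G (m + int j) j \<omega>)"
    by (rule sum.mono_neutral_right) auto
  also have "\<dots> = l * inp m n \<omega>"
    by (simp add: inp_def sum_distrib_left kern_def mult.assoc)
  finally show ?thesis .
qed

lemma G_resolvent: "G (m + int n) n \<omega> = (\<Sum>i\<le>n. z i * innov m (n - i) \<omega>)"
proof (rule resolvent_solution)
  fix n
  show "G (m + int n) n \<omega> = innov m n \<omega> + (\<Sum>i\<le>n. kern i * G (m + int (n - i)) (n - i) \<omega>)"
  proof (cases "n = 0")
    case True
    then show ?thesis by (simp add: innov_def G_0)
  next
    case False
    then show ?thesis unfolding kern_inp by (simp add: innov_def G_step left_diff_distrib)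
  qed
qed

text \<open>
  The volatility as a combination of strictly earlier innovations: the term with index \<open>0\<close> of the
  resolvent identity for \<open>G\<close> is the current innovation.
\<close>
lemma inp_resolvent: "0 < n \<Longrightarrow> l * inp m n \<omega> = (\<Sum>i\<le>n. zpos i * innov m (n - i) \<omega>)"
proof -
  assume "0 < n"
  have "(\<Sum>i\<le>n. z i * innov m (n - i) \<omega>) = (\<Sum>i\<le>n. (if i = 0 then innov m n \<omega> else 0) + zpos i * innov m (n - i) \<omega>)"
    by (intro sum.cong) (auto simp: zpos_def)
  also have "\<dots> = innov m n \<omega> + (\<Sum>i\<le>n. zpos i * innov m (n - i) \<omega>)" by (simp add: sum.distrib)
  finally have "G (m + int n) n \<omega> = innov m n \<omega> + (\<Sum>i\<le>n. zpos i * innov m (n - i) \<omega>)"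
    by (simp only: G_resolvent)
  then show ?thesis using \<open>0 < n\<close> by (simp add: G_step innov_def left_diff_distrib)
qed

lemma innov_L2: "L2 M (innov m n)"
proof (cases "n = 0")
  case True
  then show ?thesis using noise_L2[of m] by (simp add: innov_def[abs_def])
next
  case False
  then show ?thesis using centered_past_L2(1)[OF inp_past inp_L2] by (simp add: innov_def[abs_def])
qed

lemma innov_past: "n < n' \<Longrightarrow> past (m + int n') (innov m n)"
proof (cases "n = 0")
  case True
  assume "n < n'"
  then show ?thesis using True past_noise[of m] by (simp add: innov_def[abs_def])
next
  case False
  assume "n < n'"
  have "past (m + int n') (inp m n)"
    unfolding inp_def[abs_def] using \<open>n < n'\<close> by (intro past_sum past_mult past_const G_past) auto
  then show ?thesis using False \<open>n < n'\<close>
    by (simp add: innov_def[abs_def] past_mult past_diff past_const past_noise)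
qed

lemma innov_orthogonal: "n \<noteq> n' \<Longrightarrow> (\<integral>\<omega>. innov m n \<omega> * innov m n' \<omega> \<partial>M) = 0"
proof (induction n n' rule: linorder_wlog)
  case (le n n')
  then have "n < n'" by simp
  have "(\<integral>\<omega>. (\<xi> (m + int n') \<omega> - l) * (inp m n' \<omega> * innov m n \<omega>) \<partial>M) = 0"
    by (intro centered_past_mean past_mult inp_past innov_past L2_mult_integrable inp_L2 innov_L2 \<open>n < n'\<close>)
  then show ?case using \<open>n < n'\<close> by (simp add: innov_def[of m n'] mult_ac)
next
  case (sym n n')
  then show ?case by (simp add: mult.commute)
qed

definition energy :: "int \<Rightarrow> nat \<Rightarrow> real" where
  "energy m n = (\<integral>\<omega>. (innov m n \<omega>)\<^sup>2 \<partial>M)"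

definition energy_kernel :: "nat \<Rightarrow> real" where
  "energy_kernel i = (sd / l)\<^sup>2 * (zpos i)\<^sup>2"

lemma energy_inp: "0 < n \<Longrightarrow> energy m n = sd\<^sup>2 * (\<integral>\<omega>. (inp m n \<omega>)\<^sup>2 \<partial>M)"
  using centered_past_L2(2)[OF inp_past inp_L2] by (simp add: energy_def innov_def)

text \<open>
  The second moment of an innovation is \<open>sd\<^sup>2\<close> times that of the volatility, which by orthogonality is a
  weighted sum of second moments of earlier innovations.
\<close>
lemma energy_renewal:
  "energy m n = (if n = 0 then lam2 else 0) + (\<Sum>i\<le>n. energy_kernel i * energy m (n - i))"
proof (cases "n = 0")
  case True
  then show ?thesis by (simp add: energy_def innov_def noise_second_moment energy_kernel_def)
next
  case False
  have "l\<^sup>2 * (\<integral>\<omega>. (inp m n \<omega>)\<^sup>2 \<partial>M) = (\<integral>\<omega>. (l * inp m n \<omega>)\<^sup>2 \<partial>M)" by (simp add: power_mult_distrib)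
  also have "\<dots> = (\<integral>\<omega>. (\<Sum>i\<le>n. zpos i * innov m (n - i) \<omega>)\<^sup>2 \<partial>M)" using False by (simp add: inp_resolvent)
  also have "\<dots> = (\<Sum>i\<le>n. (zpos i)\<^sup>2 * (\<integral>\<omega>. (innov m (n - i) \<omega>)\<^sup>2 \<partial>M))"
    by (rule L2_orthogonal_sum) (auto intro!: innov_L2 innov_orthogonal)
  also have "\<dots> = (\<Sum>i\<le>n. (zpos i)\<^sup>2 * energy m (n - i))" by (simp add: energy_def)
  finally have "(\<integral>\<omega>. (inp m n \<omega>)\<^sup>2 \<partial>M) = (\<Sum>i\<le>n. (zpos i)\<^sup>2 * energy m (n - i)) / l\<^sup>2"
    using l_pos by (simp add: field_simps)
  then show ?thesis using False
    by (simp add: energy_inp energy_kernel_def sum_distrib_left sum_divide_distrib power_divide mult.assoc)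
qed

lemma energy_nonneg: "0 \<le> energy m n"
  unfolding energy_def by simp

lemma energy_shift: "energy m n = energy 0 n"
proof (induction n rule: less_induct)
  case (less n)
  have "(\<Sum>i\<le>n. energy_kernel i * energy m (n - i)) = (\<Sum>i\<le>n. energy_kernel i * energy 0 (n - i))"
  proof (intro sum.cong refl)
    fix i assume "i \<in> {..n}"
    then show "energy_kernel i * energy m (n - i) = energy_kernel i * energy 0 (n - i)"
      using less[of "n - i"] by (cases "i = 0") (auto simp: energy_kernel_def)
  qed
  then show ?case by (subst (1 2) energy_renewal) (simp only:)
qed

text \<open>
  The total mass of the renewal kernel is the square of \<open>Omega\<close>, so this is where the condition
  \<open>Omega < 1\<close> enters.
\<close>
lemma sqrt_energy_summable: "summable (\<lambda>n. sqrt (energy 0 n))"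
proof (rule sqrt_renewal_summable[where p = energy_kernel and c = lam2])
  have zl: "zpos n \<le> 1 / (1 - l * bsum b)" for n
    using zseq_le[of n] l_bsum by (auto simp: zpos_def)
  have zp: "summable (\<lambda>n. (zpos n)\<^sup>2)"
  proof (rule summable_comparison_test'[OF summable_mult2[OF sums_summable[OF zpos_sums], of "1 / (1 - l * bsum b)"], of 0])
    fix n :: nat
    show "norm ((zpos n)\<^sup>2) \<le> zpos n * (1 / (1 - l * bsum b))"
      using zpos_nonneg[of n] zl[of n] by (simp add: power2_eq_square mult_left_mono del: times_divide_eq_right)
  qed
  show "0 \<le> energy_kernel n" for n by (simp add: energy_kernel_def)
  show "summable energy_kernel" unfolding energy_kernel_def[abs_def] by (intro summable_mult zp)
  show "summable (\<lambda>n. sqrt (energy_kernel n))"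
  proof -
    have "(\<lambda>n. sqrt (energy_kernel n)) = (\<lambda>n. sd / l * zpos n)"
      using l_pos sd_pos zpos_nonneg by (auto simp: energy_kernel_def real_sqrt_mult)
    then show ?thesis using summable_mult[OF sums_summable[OF zpos_sums]] by simp
  qed
  show "(\<Sum>n. energy_kernel n) < 1"
  proof -
    have "(\<Sum>n. (zpos n)\<^sup>2) = (\<Sum>n. (z (Suc n))\<^sup>2)"
      using suminf_split_head[OF zp] by (simp add: zpos_def)
    moreover have nn: "0 \<le> (\<Sum>n. (zpos n)\<^sup>2)" by (intro suminf_nonneg zp) simp
    moreover have "(\<Sum>n. energy_kernel n) = (sd / l)\<^sup>2 * (\<Sum>n. (zpos n)\<^sup>2)"
      unfolding energy_kernel_def by (rule suminf_mult[OF zp])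
    ultimately have "(\<Sum>n. energy_kernel n) = (Omega M \<xi> b)\<^sup>2"
      unfolding Omega_def by (simp add: power_mult_distrib power_divide del: zseq.simps)
    moreover have "0 \<le> Omega M \<xi> b"
      unfolding Omega_def using nn l_pos sd_pos \<open>(\<Sum>n. (zpos n)\<^sup>2) = (\<Sum>n. (z (Suc n))\<^sup>2)\<close>
      by (simp del: zseq.simps)
    ultimately show ?thesis using Omega by (simp add: power_less_one_iff abs_square_less_1)
  qed
  show "0 \<le> energy 0 n" for n by (rule energy_nonneg)
  show "energy 0 n = (if n = 0 then lam2 else 0) + (\<Sum>i\<le>n. energy_kernel i * energy 0 (n - i))" for n
    by (rule energy_renewal)
  show "0 \<le> lam2" by (simp add: lam2_def)
qed

text \<open>
  A bound, independent of \<open>k\<close>, for the \<open>L\<^sup>2\<close> norm of \<open>G k n\<close>.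
\<close>
definition gbound :: "nat \<Rightarrow> real" where
  "gbound n = sqrt (lam2 / sd\<^sup>2) * sqrt (energy 0 n)"

lemma gbound_nonneg: "0 \<le> gbound n"
  by (simp add: gbound_def energy_nonneg lam2_def)

lemma gbound_summable: "summable gbound"
  unfolding gbound_def[abs_def] by (intro summable_mult sqrt_energy_summable)

lemma G_second_moment: "(\<integral>\<omega>. (G k n \<omega>)\<^sup>2 \<partial>M) \<le> (gbound n)\<^sup>2"
proof -
  define m where "m = k - int n"
  have k: "k = m + int n" by (simp add: m_def)
  have ratio: "1 \<le> lam2 / sd\<^sup>2" using sd_pos by (simp add: lam2_eq)
  have gb: "(gbound n)\<^sup>2 = lam2 / sd\<^sup>2 * energy m n"
    using ratio energy_nonneg by (simp add: gbound_def power_mult_distrib energy_shift[of m])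
  show ?thesis
  proof (cases "n = 0")
    case True
    have "(\<integral>\<omega>. (G k n \<omega>)\<^sup>2 \<partial>M) = energy m n" using True by (simp add: G_0 k energy_def innov_def)
    also have "\<dots> \<le> lam2 / sd\<^sup>2 * energy m n" using mult_right_mono[OF ratio energy_nonneg] by simp
    finally show ?thesis by (simp only: gb)
  next
    case False
    have "(\<integral>\<omega>. (G k n \<omega>)\<^sup>2 \<partial>M) = lam2 * (\<integral>\<omega>. (inp m n \<omega>)\<^sup>2 \<partial>M)"
      unfolding k using noise_past_L2(2)[OF inp_past inp_L2] False by (simp add: G_step)
    also have "\<dots> = lam2 / sd\<^sup>2 * energy m n" using False sd_pos by (simp add: energy_inp)
    finally show ?thesis by (simp only: gb)
  qed
qed

end

section \<open>The stationary solution\<close>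

locale arch_process = arch_model M \<xi> b for M :: "'a measure" and \<xi> b +
  fixes a :: real and X :: "int \<Rightarrow> 'a \<Rightarrow> real"
  assumes a_pos: "0 < a" and solution: "arch_solution M \<xi> a b X" and stationary: "weakly_stationary M X"
begin

lemma X_L2: "L2 M (X k)"
  using stationary by (auto simp: weakly_stationary_def L2_def)

lemma X_measurable [measurable]: "X k \<in> borel_measurable M"
  using X_L2 by (rule L2_measurable)

definition \<mu> :: real where "\<mu> = (\<integral>\<omega>. X 0 \<omega> \<partial>M)"

lemma X_mean: "(\<integral>\<omega>. X k \<omega> \<partial>M) = \<mu>"
  using stationary unfolding weakly_stationary_def \<mu>_def by blast

lemma covariance_X: "covariance M (X k) (X m) = (\<integral>\<omega>. X k \<omega> * X m \<omega> \<partial>M) - \<mu>\<^sup>2"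
proof -
  have "covariance M (X k) (X m) = (\<integral>\<omega>. X k \<omega> * X m \<omega> - \<mu> * X k \<omega> - \<mu> * X m \<omega> + \<mu> * \<mu> \<partial>M)"
    by (simp add: covariance_def X_mean algebra_simps)
  also have "\<dots> = (\<integral>\<omega>. X k \<omega> * X m \<omega> \<partial>M) - \<mu> * \<mu> - \<mu> * \<mu> + \<mu> * \<mu>"
    using L2_mult_integrable[OF X_L2 X_L2] L2_integrable[OF X_L2] by (simp add: X_mean prob_space)
  finally show ?thesis by (simp add: power2_eq_square)
qed

abbreviation "\<rho> \<equiv> autocov M X"

lemma autocov_inner: "(\<integral>\<omega>. X k \<omega> * X m \<omega> \<partial>M) = \<rho> (m - k) + \<mu>\<^sup>2"
proof -
  have "covariance M (X k) (X (k + (m - k))) = \<rho> (m - k)"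
    using stationary unfolding weakly_stationary_def autocov_def by blast
  then show ?thesis using covariance_X[of k m] by simp
qed

lemma autocov_minus: "\<rho> (- n) = \<rho> n"
  using autocov_inner[of 0 n] autocov_inner[of n 0] by (simp add: mult.commute)

text \<open>
  The \<open>L\<^sup>2\<close> norm of the solution at any time.
\<close>
definition C :: real where "C = sqrt (\<integral>\<omega>. (X 0 \<omega>)\<^sup>2 \<partial>M)"

lemma C_nonneg: "0 \<le> C" by (simp add: C_def)

lemma X_second_moment: "(\<integral>\<omega>. (X k \<omega>)\<^sup>2 \<partial>M) = C\<^sup>2"
proof -
  have "C\<^sup>2 = (\<integral>\<omega>. (X 0 \<omega>)\<^sup>2 \<partial>M)" by (simp add: C_def)
  then show ?thesis using autocov_inner[of k k] autocov_inner[of 0 0] by (simp add: power2_eq_square)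
qed

lemma X_second_moment_le: "(\<integral>\<omega>. (X k \<omega>)\<^sup>2 \<partial>M) \<le> C\<^sup>2" by (simp add: X_second_moment)

lemma inner_bound: "\<bar>\<integral>\<omega>. X k \<omega> * X m \<omega> \<partial>M\<bar> \<le> C * C"
  by (rule order_trans[OF integral_abs_bound])
     (intro Cauchy_Schwarz_L2 X_L2 X_second_moment_le C_nonneg)

lemma autocov_bound: "\<bar>\<rho> n\<bar> \<le> C * C + \<mu>\<^sup>2"
proof -
  have "\<bar>\<rho> n + \<mu>\<^sup>2\<bar> \<le> C * C" using inner_bound[of 0 n] autocov_inner[of 0 n] by simp
  moreover have "0 \<le> \<mu>\<^sup>2" by simp
  ultimately show ?thesis by linarith
qed

lemma solution_AE:
  "AE \<omega> in M. \<forall>k. summable (\<lambda>j. b (Suc j) * X (k - int (Suc j)) \<omega>) \<and> X k \<omega> = varsig a b X k \<omega> * \<xi> k \<omega>"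
  using solution by (simp add: arch_solution_def AE_all_countable)

definition tail :: "nat \<Rightarrow> int \<Rightarrow> 'a \<Rightarrow> real" where
  "tail p k \<omega> = (\<Sum>j. b (Suc (j + p)) * X (k - int (Suc (j + p))) \<omega>)"

lemma tail_coeff_summable: "summable (\<lambda>j. b (Suc (j + p)))"
  using b_summable summable_iff_shift[of "\<lambda>j. b (Suc j)" p] by simp

lemma tail_L2: "L2 M (tail p k)"
  unfolding tail_def[abs_def]
  by (rule L2_series[where \<beta> = "\<lambda>j. b (Suc (j + p))" and Y = "\<lambda>j. X (k - int (Suc (j + p)))" and C = C])
     (rule b_nonneg tail_coeff_summable X_L2 X_second_moment_le C_nonneg)+

lemma tail_inner:
  assumes "L2 M W" "(\<integral>\<omega>. (W \<omega>)\<^sup>2 \<partial>M) \<le> D\<^sup>2" "0 \<le> D"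
  shows "(\<integral>\<omega>. W \<omega> * tail p k \<omega> \<partial>M) = (\<Sum>j. b (Suc (j + p)) * (\<integral>\<omega>. W \<omega> * X (k - int (Suc (j + p))) \<omega> \<partial>M))"
    and "(\<integral>\<omega>. \<bar>W \<omega> * tail p k \<omega>\<bar> \<partial>M) \<le> D * C * (\<Sum>j. b (Suc (j + p)))"
  unfolding tail_def
  by (rule L2_series_inner(2,3)[where \<beta> = "\<lambda>j. b (Suc (j + p))" and Y = "\<lambda>j. X (k - int (Suc (j + p)))" and C = C and W = W and D = D];
      rule b_nonneg tail_coeff_summable X_L2 X_second_moment_le C_nonneg assms)+

text \<open>
  The part of the iterated equation that depends on the noise between the times \<open>k - n\<close> and \<open>k\<close> only.
\<close>
definition S :: "nat \<Rightarrow> int \<Rightarrow> 'a \<Rightarrow> real" where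
  "S n k \<omega> = (\<Sum>i\<le>n. G k i \<omega> * a)"

lemma S_L2: "L2 M (S n k)"
  unfolding S_def[abs_def] using L2_sum[of "{..n}" M "\<lambda>i \<omega>. a * G k i \<omega>"] L2_cmult[OF G_L2] by (simp add: mult.commute)

text \<open>
  The remainder pairs Green functions with tails of the solution.  These may be dependent, as nothing
  is known yet about causality, so each product is estimated by Cauchy-Schwarz.
\<close>
lemma S_error: "(\<integral>\<omega>. \<bar>X k \<omega> - S n k \<omega>\<bar> \<partial>M) \<le> (\<Sum>i\<le>n. gbound i * (C * (\<Sum>j. b (Suc (j + (n - i))))))"
proof -
  let ?T = "\<lambda>i \<omega>. \<bar>G k i \<omega> * tail (n - i) (k - int i) \<omega>\<bar>"
  have i: "integrable M (\<lambda>\<omega>. \<bar>G k i \<omega> * tail p m \<omega>\<bar>)" for i p m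
    by (intro integrable_abs L2_mult_integrable G_L2 tail_L2)
  have "(\<integral>\<omega>. \<bar>X k \<omega> - S n k \<omega>\<bar> \<partial>M) \<le> (\<integral>\<omega>. (\<Sum>i\<le>n. ?T i \<omega>) \<partial>M)"
  proof (rule integral_mono_AE)
    show "integrable M (\<lambda>\<omega>. \<bar>X k \<omega> - S n k \<omega>\<bar>)"
      by (intro integrable_abs L2_integrable L2_diff X_L2 S_L2)
    show "integrable M (\<lambda>\<omega>. \<Sum>i\<le>n. ?T i \<omega>)"
      by (intro Bochner_Integration.integrable_sum i)
    show "AE \<omega> in M. \<bar>X k \<omega> - S n k \<omega>\<bar> \<le> (\<Sum>i\<le>n. ?T i \<omega>)"
      using solution_AE
    proof eventually_elim
      case (elim \<omega>)
      then have s: "\<And>k. summable (\<lambda>j. b (Suc j) * X (k - int (Suc j)) \<omega>)"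
        and e: "\<And>k. X k \<omega> = (a + (\<Sum>j. b (Suc j) * X (k - int (Suc j)) \<omega>)) * \<xi> k \<omega>"
        unfolding varsig_def by blast+
      have "X k \<omega> = (\<Sum>i\<le>n. G k i \<omega> * (a + tail (n - i) (k - int i) \<omega>))"
        unfolding G_def tail_def by (rule green_expansion[OF s e])
      then have "X k \<omega> - S n k \<omega> = (\<Sum>i\<le>n. G k i \<omega> * tail (n - i) (k - int i) \<omega>)"
        by (simp add: S_def distrib_left sum.distrib)
      then show ?case by (simp only: sum_abs)
    qed
  qed
  also have "\<dots> = (\<Sum>i\<le>n. \<integral>\<omega>. ?T i \<omega> \<partial>M)"
    by (rule Bochner_Integration.integral_sum) (rule i)
  also have "\<dots> \<le> (\<Sum>i\<le>n. gbound i * (C * (\<Sum>j. b (Suc (j + (n - i))))))"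
    unfolding mult.assoc[symmetric] by (intro sum_mono tail_inner(2) G_L2 G_second_moment gbound_nonneg)
  finally show ?thesis .
qed

lemma S_L1_limit: "(\<lambda>n. \<integral>\<omega>. \<bar>X k \<omega> - S n k \<omega>\<bar> \<partial>M) \<longlonglongrightarrow> 0"
proof (rule tendsto_sandwich[OF always_eventually always_eventually tendsto_const])
  show "\<forall>n. 0 \<le> (\<integral>\<omega>. \<bar>X k \<omega> - S n k \<omega>\<bar> \<partial>M)" by simp
  show "\<forall>n. (\<integral>\<omega>. \<bar>X k \<omega> - S n k \<omega>\<bar> \<partial>M) \<le> (\<Sum>i\<le>n. gbound i * (C * (\<Sum>j. b (Suc (j + (n - i))))))"
    by (intro allI S_error)
  have "(\<lambda>n. \<Sum>j. b (Suc (j + n))) \<longlonglongrightarrow> 0" by (rule suminf_exist_split2[OF b_summable])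
  from tendsto_mult[OF tendsto_const[of C] this]
  have "(\<lambda>n. C * (\<Sum>j. b (Suc (j + n)))) \<longlonglongrightarrow> 0" by simp
  from convolution_tendsto_zero[OF gbound_nonneg gbound_summable this]
  show "(\<lambda>n. \<Sum>i\<le>n. gbound i * (C * (\<Sum>j. b (Suc (j + (n - i)))))) \<longlonglongrightarrow> 0" .
qed

lemma G_nonneg: "AE \<omega> in M. \<forall>k i. 0 \<le> G k i \<omega>"
  using noise_nonneg
proof eventually_elim
  case (elim \<omega>)
  have "0 \<le> green b (\<lambda>j. \<xi> j \<omega>) k i" for k i
  proof (induction i arbitrary: k rule: less_induct)
    case (less i)
    show ?case
    proof (cases i)
      case 0
      then show ?thesis using elim by simp
    next
      case (Suc m)
      have "0 \<le> b (Suc m - j)" if "j \<le> m" for j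
        using b_nonneg[of "m - j"] that by (simp add: Suc_diff_le)
      then show ?thesis unfolding Suc green.simps using less elim Suc
        by (intro mult_nonneg_nonneg sum_nonneg) auto
    qed
  qed
  then show ?case by (simp add: G_def)
qed

text \<open>
  The approximations increase with \<open>n\<close> because the noise is non-negative, so convergence in \<open>L\<^sup>1\<close>
  improves to monotone convergence almost surely.  In particular the solution is causal and
  non-negative.
\<close>
lemma S_limit: "AE \<omega> in M. \<forall>k. (\<lambda>n. S n k \<omega>) \<longlonglongrightarrow> X k \<omega> \<and> (\<forall>n. 0 \<le> S n k \<omega> \<and> S n k \<omega> \<le> X k \<omega>)"
proof (subst AE_all_countable, rule allI)
  fix k
  have "\<exists>r. strict_mono r \<and> (AE \<omega> in M. (\<lambda>n. X k \<omega> - S (r n) k \<omega>) \<longlonglongrightarrow> 0)"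
    by (rule tendsto_L1_AE_subseq) (use S_L1_limit[of k] in \<open>auto intro!: L2_integrable L2_diff X_L2 S_L2\<close>)
  then obtain r :: "nat \<Rightarrow> nat" where r: "strict_mono r" "AE \<omega> in M. (\<lambda>n. X k \<omega> - S (r n) k \<omega>) \<longlonglongrightarrow> 0" by blast
  show "AE \<omega> in M. (\<lambda>n. S n k \<omega>) \<longlonglongrightarrow> X k \<omega> \<and> (\<forall>n. 0 \<le> S n k \<omega> \<and> S n k \<omega> \<le> X k \<omega>)"
    using r(2) G_nonneg
  proof eventually_elim
    case (elim \<omega>)
    have inc: "incseq (\<lambda>n. S n k \<omega>)"
      unfolding S_def using elim(2) a_pos by (intro incseq_SucI) simp
    have nn: "0 \<le> S n k \<omega>" for n unfolding S_def using elim(2) a_pos by (intro sum_nonneg) simp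
    have sub: "(\<lambda>n. S (r n) k \<omega>) \<longlonglongrightarrow> X k \<omega>"
      using tendsto_diff[OF tendsto_const[of "X k \<omega>"] elim(1)] by simp
    have le: "S n k \<omega> \<le> X k \<omega>" for n
    proof (rule LIMSEQ_le_const[OF sub], intro exI allI impI)
      fix m assume "n \<le> m"
      then show "S n k \<omega> \<le> S (r m) k \<omega>"
        using incseqD[OF inc] seq_suble[OF r(1), of m] by (meson order_trans)
    qed
    have "(\<lambda>n. S n k \<omega>) \<longlonglongrightarrow> (SUP n. S n k \<omega>)"
      using le by (intro LIMSEQ_incseq_SUP inc) (auto simp: bdd_above_def)
    moreover from LIMSEQ_subseq_LIMSEQ[OF this r(1)] have "(\<lambda>n. S (r n) k \<omega>) \<longlonglongrightarrow> (SUP n. S n k \<omega>)"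
      by (simp add: comp_def)
    ultimately show ?case using LIMSEQ_unique[OF sub] nn le by simp
  qed
qed

lemma X_nonneg: "AE \<omega> in M. \<forall>k. 0 \<le> X k \<omega>"
  using S_limit by eventually_elim (meson order_trans)

text \<open>
  The volatility of the truncated solution.
\<close>
definition vol :: "nat \<Rightarrow> int \<Rightarrow> 'a \<Rightarrow> real" where
  "vol n k \<omega> = a + (\<Sum>j<n. b (Suc j) * S (n - Suc j) (k - int (Suc j)) \<omega>)"

lemma S_step: "S n k \<omega> = \<xi> k \<omega> * vol n k \<omega>"
  unfolding S_def vol_def G_def using green_sum[of b "\<lambda>j. \<xi> j \<omega>" k "\<lambda>_ _. a" n] by simp

lemma S_past: "k < k' \<Longrightarrow> past k' (S n k)"
  unfolding S_def[abs_def] by (intro past_sum past_mult past_const G_past)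

lemma vol_past: "past k (vol n k)"
  unfolding vol_def[abs_def] by (intro past_add past_sum past_mult past_const S_past) simp

lemma vol_L2: "L2 M (vol n k)"
  unfolding vol_def[abs_def] by (intro L2_add L2_const L2_sum L2_cmult S_L2)

text \<open>
  A formal consequence of \<open>\<xi> k\<close> being independent of the past: for the approximations this is
  \<open>noise_past_mean\<close>, and the limit is taken by dominated convergence under the integrals and by
  Tannery's theorem in the series.  The two instances needed are \<open>V = 1\<close> and \<open>V = X m\<close> with \<open>m < k\<close>.
\<close>
lemma moment_equation:
  assumes W: "\<And>n. past k (W n)" "\<And>n. L2 M (W n)" "L2 M V"
    and lim: "AE \<omega> in M. (\<lambda>n. W n \<omega>) \<longlonglongrightarrow> V \<omega> \<and> (\<forall>n. 0 \<le> W n \<omega> \<and> W n \<omega> \<le> V \<omega>)"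
  shows "(\<integral>\<omega>. X k \<omega> * V \<omega> \<partial>M) =
     l * (a * (\<integral>\<omega>. V \<omega> \<partial>M) + (\<Sum>j. b (Suc j) * (\<integral>\<omega>. X (k - int (Suc j)) \<omega> * V \<omega> \<partial>M)))"
proof -
  let ?I = "\<lambda>j n. \<integral>\<omega>. S (n - Suc j) (k - int (Suc j)) \<omega> * W n \<omega> \<partial>M"
  let ?D = "C * sqrt (\<integral>\<omega>. (V \<omega>)\<^sup>2 \<partial>M)"
  note [measurable] = L2_measurable[OF W(2)] L2_measurable[OF W(3)] L2_measurable[OF S_L2]
  have Wlim: "(\<lambda>n. \<integral>\<omega>. W n \<omega> \<partial>M) \<longlonglongrightarrow> (\<integral>\<omega>. V \<omega> \<partial>M)"
  proof (rule integral_dominated_convergence[where w = V])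
    show "integrable M V" by (rule L2_integrable[OF W(3)])
    show "AE \<omega> in M. (\<lambda>n. W n \<omega>) \<longlonglongrightarrow> V \<omega>" using lim by eventually_elim blast
    show "AE \<omega> in M. norm (W n \<omega>) \<le> V \<omega>" for n using lim by eventually_elim simp
  qed measurable
  have SW: "(\<lambda>n. \<integral>\<omega>. S (n - p) m \<omega> * W n \<omega> \<partial>M) \<longlonglongrightarrow> (\<integral>\<omega>. X m \<omega> * V \<omega> \<partial>M)" for m p
  proof (rule integral_dominated_convergence[where w = "\<lambda>\<omega>. X m \<omega> * V \<omega>"])
    show "integrable M (\<lambda>\<omega>. X m \<omega> * V \<omega>)" by (intro L2_mult_integrable X_L2 W)
    show "AE \<omega> in M. (\<lambda>n. S (n - p) m \<omega> * W n \<omega>) \<longlonglongrightarrow> X m \<omega> * V \<omega>"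
      using S_limit lim
    proof eventually_elim
      case (elim \<omega>)
      then have "(\<lambda>n. S n m \<omega>) \<longlonglongrightarrow> X m \<omega>" by blast
      from filterlim_compose[OF this filterlim_minus_const_nat_at_top] 
      show ?case using elim by (intro tendsto_mult) auto
    qed
    show "AE \<omega> in M. norm (S (n - p) m \<omega> * W n \<omega>) \<le> X m \<omega> * V \<omega>" for n
      using S_limit lim
    proof eventually_elim
      case (elim \<omega>)
      have "0 \<le> S (n - p) m \<omega>" "S (n - p) m \<omega> \<le> X m \<omega>" "0 \<le> W n \<omega>" "W n \<omega> \<le> V \<omega>" using elim by blast+
      then show ?case by (simp add: abs_mult mult_mono)
    qed
  qed measurable
  have SWb: "\<bar>\<integral>\<omega>. S p m \<omega> * W n \<omega> \<partial>M\<bar> \<le> ?D" for p m n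
  proof -
    have "\<bar>\<integral>\<omega>. S p m \<omega> * W n \<omega> \<partial>M\<bar> \<le> (\<integral>\<omega>. \<bar>S p m \<omega> * W n \<omega>\<bar> \<partial>M)" by (rule integral_abs_bound)
    also have "\<dots> \<le> (\<integral>\<omega>. \<bar>X m \<omega> * V \<omega>\<bar> \<partial>M)"
    proof (rule integral_mono_AE)
      show "AE \<omega> in M. \<bar>S p m \<omega> * W n \<omega>\<bar> \<le> \<bar>X m \<omega> * V \<omega>\<bar>"
        using S_limit lim
      proof eventually_elim
        case (elim \<omega>)
        have "0 \<le> S p m \<omega>" "S p m \<omega> \<le> X m \<omega>" "0 \<le> W n \<omega>" "W n \<omega> \<le> V \<omega>" using elim by blast+
        then show ?case unfolding abs_mult by (intro mult_mono) auto
      qed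
    qed (intro integrable_abs L2_mult_integrable S_L2 X_L2 W)+
    also have "\<dots> \<le> ?D"
      by (rule Cauchy_Schwarz_L2[OF X_L2 W(3) X_second_moment_le C_nonneg]) auto
    finally show ?thesis .
  qed
  define f where "f j n = (if j < n then b (Suc j) * ?I j n else 0)" for j n
  have flim: "(\<lambda>n. \<Sum>j. f j n) \<longlonglongrightarrow> (\<Sum>j. b (Suc j) * (\<integral>\<omega>. X (k - int (Suc j)) \<omega> * V \<omega> \<partial>M))"
  proof (rule tannery_sequential)
    fix j
    have "(\<lambda>n. b (Suc j) * ?I j n) \<longlonglongrightarrow>
        b (Suc j) * (\<integral>\<omega>. X (k - int (Suc j)) \<omega> * V \<omega> \<partial>M)"
      by (intro tendsto_intros SW)
    moreover have "\<forall>\<^sub>F n in sequentially. b (Suc j) * ?I j n = f j n"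
      using eventually_gt_at_top[of j] by eventually_elim (simp add: f_def)
    ultimately show "f j \<longlonglongrightarrow> b (Suc j) * (\<integral>\<omega>. X (k - int (Suc j)) \<omega> * V \<omega> \<partial>M)"
      by (rule Lim_transform_eventually)
  next
    show "summable (\<lambda>j. b (Suc j) * ?D)" by (intro summable_mult2 b_summable)
    have "\<bar>f j n\<bar> \<le> b (Suc j) * ?D" for j n
    proof -
      have "\<bar>b (Suc j) * ?I j n\<bar> \<le> b (Suc j) * ?D"
        unfolding abs_mult[of "b _"] abs_of_nonneg[OF b_nonneg] by (intro mult_left_mono SWb b_nonneg)
      moreover have "0 \<le> b (Suc j) * ?D"
        by (intro mult_nonneg_nonneg b_nonneg C_nonneg) simp
      ultimately show ?thesis by (simp add: f_def)
    qed
    then show "\<forall>\<^sub>F n in sequentially. \<forall>j. \<bar>f j n\<bar> \<le> b (Suc j) * ?D" by simp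
  qed
  have eq: "(\<integral>\<omega>. S n k \<omega> * W n \<omega> \<partial>M) = l * (a * (\<integral>\<omega>. W n \<omega> \<partial>M) + (\<Sum>j. f j n))" for n
  proof -
    have "(\<integral>\<omega>. S n k \<omega> * W n \<omega> \<partial>M) = (\<integral>\<omega>. \<xi> k \<omega> * (vol n k \<omega> * W n \<omega>) \<partial>M)"
      by (simp add: S_step mult.assoc)
    also have "\<dots> = l * (\<integral>\<omega>. vol n k \<omega> * W n \<omega> \<partial>M)"
      by (intro noise_past_mean past_mult vol_past W L2_mult_integrable vol_L2)
    also have "(\<integral>\<omega>. vol n k \<omega> * W n \<omega> \<partial>M) =
        (\<integral>\<omega>. a * W n \<omega> + (\<Sum>j<n. b (Suc j) * (S (n - Suc j) (k - int (Suc j)) \<omega> * W n \<omega>)) \<partial>M)"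
      by (simp add: vol_def distrib_right sum_distrib_right mult.assoc)
    also have "\<dots> = a * (\<integral>\<omega>. W n \<omega> \<partial>M) +
        (\<Sum>j<n. b (Suc j) * ?I j n)"
      using L2_mult_integrable[OF S_L2 W(2)] L2_integrable[OF W(2)] by simp
    also have "(\<Sum>j<n. b (Suc j) * ?I j n) = (\<Sum>j<n. f j n)"
      by (simp add: f_def)
    also have "(\<Sum>j<n. f j n) = (\<Sum>j. f j n)" by (rule suminf_finite[symmetric]) (auto simp: f_def)
    finally show ?thesis .
  qed
  have "(\<lambda>n. \<integral>\<omega>. S n k \<omega> * W n \<omega> \<partial>M) \<longlonglongrightarrow>
      l * (a * (\<integral>\<omega>. V \<omega> \<partial>M) + (\<Sum>j. b (Suc j) * (\<integral>\<omega>. X (k - int (Suc j)) \<omega> * V \<omega> \<partial>M)))"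
    unfolding eq by (intro tendsto_intros Wlim flim)
  moreover have "(\<lambda>n. \<integral>\<omega>. S n k \<omega> * W n \<omega> \<partial>M) \<longlonglongrightarrow> (\<integral>\<omega>. X k \<omega> * V \<omega> \<partial>M)"
    using SW[of 0 k] by simp
  ultimately show ?thesis by (rule LIMSEQ_unique[rotated])
qed

lemma mean_equation: "\<mu> = l * (a + bsum b * \<mu>)"
proof -
  have "(\<integral>\<omega>. X 0 \<omega> * 1 \<partial>M) = l * (a * (\<integral>\<omega>. 1 \<partial>M) + (\<Sum>j. b (Suc j) * (\<integral>\<omega>. X (0 - int (Suc j)) \<omega> * 1 \<partial>M)))"
    by (rule moment_equation[where W = "\<lambda>_ _. 1"]) (auto intro: past_const L2_const)
  also have "\<dots> = l * (a + (\<Sum>j. b (Suc j) * \<mu>))" by (simp add: X_mean prob_space)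
  also have "(\<Sum>j. b (Suc j) * \<mu>) = bsum b * \<mu>" unfolding bsum_def by (rule suminf_mult2[OF b_summable, symmetric])
  finally show ?thesis by (simp add: X_mean)
qed

lemma inner_equation:
  assumes "m < k"
  shows "(\<integral>\<omega>. X k \<omega> * X m \<omega> \<partial>M) = l * (a * \<mu> + (\<Sum>j. b (Suc j) * (\<integral>\<omega>. X (k - int (Suc j)) \<omega> * X m \<omega> \<partial>M)))"
proof -
  have "AE \<omega> in M. (\<lambda>n. S n m \<omega>) \<longlonglongrightarrow> X m \<omega> \<and> (\<forall>n. 0 \<le> S n m \<omega> \<and> S n m \<omega> \<le> X m \<omega>)"
    using S_limit by eventually_elim blast
  from moment_equation[OF S_past[OF assms] S_L2 X_L2 this] show ?thesis by (simp only: X_mean)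
qed

lemma autocov_series_summable: "summable (\<lambda>j. b (Suc j) * \<rho> (n - int (Suc j)))"
  by (rule summable_comparison_test'[OF summable_mult2[OF b_summable, of "C * C + \<mu>\<^sup>2"], of 0])
     (use autocov_bound b_nonneg in \<open>simp add: abs_mult mult_left_mono del: of_nat_Suc\<close>)

lemma inner_series:
  "l * (a * \<mu> + (\<Sum>j. b (Suc j) * (\<integral>\<omega>. X (k - int (Suc j)) \<omega> * X m \<omega> \<partial>M))) =
     l * (\<Sum>j. b (Suc j) * \<rho> (k - m - int (Suc j))) + \<mu>\<^sup>2"
proof -
  let ?T = "\<Sum>j. b (Suc j) * (\<integral>\<omega>. X (k - int (Suc j)) \<omega> * X m \<omega> \<partial>M)"
  let ?R = "\<Sum>j. b (Suc j) * \<rho> (k - m - int (Suc j))"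
  have "(\<integral>\<omega>. X (k - int (Suc j)) \<omega> * X m \<omega> \<partial>M) = \<rho> (k - m - int (Suc j)) + \<mu>\<^sup>2" for j
    using autocov_inner[of "k - int (Suc j)" m] autocov_minus[of "k - m - int (Suc j)"]
    by (simp add: algebra_simps)
  then have "?T =
      (\<Sum>j. b (Suc j) * \<rho> (k - m - int (Suc j)) + b (Suc j) * \<mu>\<^sup>2)"
    by (simp only: distrib_left)
  also have "\<dots> = ?R + bsum b * \<mu>\<^sup>2"
    unfolding bsum_def
    by (simp only: suminf_add[OF autocov_series_summable summable_mult2[OF b_summable], symmetric] suminf_mult2[OF b_summable, symmetric])
  finally have "l * (a * \<mu> + ?T) =
      l * ?R + (l * (a + bsum b * \<mu>)) * \<mu>"
    by (simp add: algebra_simps power2_eq_square)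
  then show ?thesis by (simp only: mean_equation[symmetric] power2_eq_square)
qed

lemma autocov_yule_walker:
  assumes "1 \<le> n"
  shows "\<rho> n = (\<Sum>j. l * b (Suc j) * \<rho> (n - int (Suc j)))"
proof -
  have "\<rho> n + \<mu>\<^sup>2 = (\<integral>\<omega>. X n \<omega> * X 0 \<omega> \<partial>M)" using autocov_inner[of n 0] autocov_minus[of n] by simp
  also have "\<dots> = l * (\<Sum>j. b (Suc j) * \<rho> (n - 0 - int (Suc j))) + \<mu>\<^sup>2"
    using assms by (subst inner_equation) (simp, rule inner_series)
  finally have "\<rho> n = l * (\<Sum>j. b (Suc j) * \<rho> (n - int (Suc j)))" by simp
  then show ?thesis by (simp only: mult.assoc suminf_mult[OF autocov_series_summable])
qed

abbreviation "\<nu> \<equiv> nu M \<xi> a b X"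

text \<open>
  The variance of the innovation, the factor between \<open>\<rho>\<close> and \<open>zcorr\<close>.
\<close>
definition V :: real where "V = (\<integral>\<omega>. (\<nu> 0 \<omega>)\<^sup>2 \<partial>M)"

lemma nu_tail: "\<nu> k \<omega> = X k \<omega> - l * (a + tail 0 k \<omega>)"
  by (simp add: nu_def varsig_def tail_def)

lemma nu_L2: "L2 M (\<nu> k)"
  unfolding nu_tail[abs_def] by (intro L2_diff X_L2 L2_cmult L2_add L2_const tail_L2)

lemma nu_inner:
  assumes W: "L2 M W"
  shows "(\<integral>\<omega>. \<nu> k \<omega> * W \<omega> \<partial>M) = (\<integral>\<omega>. X k \<omega> * W \<omega> \<partial>M) -
     l * (a * (\<integral>\<omega>. W \<omega> \<partial>M) + (\<Sum>j. b (Suc j) * (\<integral>\<omega>. X (k - int (Suc j)) \<omega> * W \<omega> \<partial>M)))"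
proof -
  have D: "(\<integral>\<omega>. (W \<omega>)\<^sup>2 \<partial>M) \<le> (sqrt (\<integral>\<omega>. (W \<omega>)\<^sup>2 \<partial>M))\<^sup>2" by simp
  have "(\<integral>\<omega>. W \<omega> * tail 0 k \<omega> \<partial>M) = (\<Sum>j. b (Suc j) * (\<integral>\<omega>. X (k - int (Suc j)) \<omega> * W \<omega> \<partial>M))"
    using tail_inner(1)[OF W D, of 0 k] by (simp add: mult.commute)
  moreover have "(\<integral>\<omega>. \<nu> k \<omega> * W \<omega> \<partial>M) =
      (\<integral>\<omega>. X k \<omega> * W \<omega> - l * (a * W \<omega> + W \<omega> * tail 0 k \<omega>) \<partial>M)"
    unfolding nu_tail by (simp add: algebra_simps)
  moreover have "\<dots> = (\<integral>\<omega>. X k \<omega> * W \<omega> \<partial>M) - l * (a * (\<integral>\<omega>. W \<omega> \<partial>M) + (\<integral>\<omega>. W \<omega> * tail 0 k \<omega> \<partial>M))"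
    using L2_mult_integrable[OF X_L2 W, of k] L2_mult_integrable[OF W tail_L2, of 0 k] L2_integrable[OF W] by simp
  ultimately show ?thesis by simp
qed

lemma nu_mean: "(\<integral>\<omega>. \<nu> k \<omega> \<partial>M) = 0"
proof -
  have "(\<Sum>j. b (Suc j) * \<mu>) = bsum b * \<mu>" unfolding bsum_def by (rule suminf_mult2[OF b_summable, symmetric])
  then have "(\<integral>\<omega>. \<nu> k \<omega> \<partial>M) = \<mu> - l * (a + bsum b * \<mu>)"
    using nu_inner[OF L2_const[of 1], of k] by (simp add: X_mean prob_space)
  then show ?thesis by (simp only: mean_equation[symmetric] diff_self)
qed

lemma nu_X_orthogonal: "m < k \<Longrightarrow> (\<integral>\<omega>. \<nu> k \<omega> * X m \<omega> \<partial>M) = 0"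
  using nu_inner[OF X_L2[of m], of k] inner_equation[of m k] by (simp add: X_mean)

text \<open>
  In the expectation of \<open>\<nu> 0 * \<nu> 0\<close>, one factor is expanded; all terms but the one with \<open>X 0\<close> vanish since
  \<open>\<nu> 0\<close> has mean zero and is orthogonal to the earlier values of the solution.
\<close>
lemma V_eq: "V = \<rho> 0 - (\<Sum>j. l * b (Suc j) * \<rho> (- int (Suc j)))"
proof -
  have "V = (\<integral>\<omega>. \<nu> 0 \<omega> * \<nu> 0 \<omega> \<partial>M)" by (simp add: V_def power2_eq_square)
  also have "\<dots> = (\<integral>\<omega>. X 0 \<omega> * \<nu> 0 \<omega> \<partial>M) - l * (a * 0 + (\<Sum>j. b (Suc j) * (\<integral>\<omega>. X (0 - int (Suc j)) \<omega> * \<nu> 0 \<omega> \<partial>M)))"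
    by (simp only: nu_inner[OF nu_L2] nu_mean)
  also have "(\<Sum>j. b (Suc j) * (\<integral>\<omega>. X (0 - int (Suc j)) \<omega> * \<nu> 0 \<omega> \<partial>M)) = (\<Sum>j. b (Suc j) * 0)"
    using nu_X_orthogonal[of _ 0] by (simp add: mult.commute[of "X _ _"] del: of_nat_Suc)
  finally have "V = (\<integral>\<omega>. \<nu> 0 \<omega> * X 0 \<omega> \<partial>M)" by (simp add: mult.commute)
  also have "\<dots> = (\<integral>\<omega>. X 0 \<omega> * X 0 \<omega> \<partial>M) - (l * (\<Sum>j. b (Suc j) * \<rho> (0 - 0 - int (Suc j))) + \<mu>\<^sup>2)"
    by (simp only: nu_inner[OF X_L2] X_mean inner_series)
  also have "\<dots> = \<rho> 0 - l * (\<Sum>j. b (Suc j) * \<rho> (0 - int (Suc j)))"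
    using autocov_inner[of 0 0] by simp
  also have "l * (\<Sum>j. b (Suc j) * \<rho> (0 - int (Suc j))) = (\<Sum>j. l * (b (Suc j) * \<rho> (0 - int (Suc j))))"
    by (rule suminf_mult[OF autocov_series_summable, symmetric])
  finally show ?thesis by (simp add: mult.assoc)
qed

text \<open>
  As \<open>X\<close> is non-negative, the volatility is at least \<open>a\<close>, hence \<open>\<bar>\<nu> 0\<bar>\<close> is at least
  \<open>a * \<bar>\<xi> 0 - l\<bar>\<close>.
\<close>
lemma V_pos: "0 < V"
proof -
  have "a\<^sup>2 * sd\<^sup>2 = (\<integral>\<omega>. a\<^sup>2 * (\<xi> 0 \<omega> - l)\<^sup>2 \<partial>M)" by (simp add: noise_variance)
  also have "\<dots> \<le> (\<integral>\<omega>. (\<nu> 0 \<omega>)\<^sup>2 \<partial>M)"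
  proof (rule integral_mono_AE)
    show "integrable M (\<lambda>\<omega>. a\<^sup>2 * (\<xi> 0 \<omega> - l)\<^sup>2)" using L2_square[OF centered_L2] by simp
    show "integrable M (\<lambda>\<omega>. (\<nu> 0 \<omega>)\<^sup>2)" by (rule L2_square[OF nu_L2])
    show "AE \<omega> in M. a\<^sup>2 * (\<xi> 0 \<omega> - l)\<^sup>2 \<le> (\<nu> 0 \<omega>)\<^sup>2"
      using solution_AE X_nonneg
    proof eventually_elim
      case (elim \<omega>)
      let ?v = "varsig a b X 0 \<omega>"
      have "0 \<le> (\<Sum>j. b (Suc j) * X (0 - int (Suc j)) \<omega>)"
        using elim by (intro suminf_nonneg mult_nonneg_nonneg b_nonneg) blast+
      then have "a \<le> ?v" by (simp add: varsig_def)
      then have "a\<^sup>2 \<le> ?v\<^sup>2" using a_pos by (intro power_mono) auto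
      moreover have "\<nu> 0 \<omega> = ?v * (\<xi> 0 \<omega> - l)"
        using elim(1) unfolding nu_def by (simp add: right_diff_distrib mult.commute)
      ultimately show ?case by (simp add: power_mult_distrib mult_right_mono)
    qed
  qed
  finally have "a\<^sup>2 * sd\<^sup>2 \<le> V" by (simp add: V_def)
  moreover have "0 < a\<^sup>2 * sd\<^sup>2" using a_pos sd_pos by simp
  ultimately show ?thesis by linarith
qed

theorem autocov_formula: "\<rho> n = V * zcorr n"
  unfolding V_eq by (rule yule_walker_solution[OF autocov_minus autocov_bound autocov_yule_walker])

end

section \<open>The equivalence\<close>

theorem theorem5:
  fixes M :: "'a measure" and \<xi> X :: "int \<Rightarrow> 'a \<Rightarrow> real"
    and a c :: real and b :: "nat \<Rightarrow> real"
  assumes "prob_space M"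
    and "iid_noise M \<xi>"
    and "0 < lam1 M \<xi>" and "0 < noise_sd M \<xi>"
    and "0 < a"
    and "\<forall>j\<ge>1. 0 \<le> b j" and "\<exists>j\<ge>1. b j \<noteq> 0"
    and "summable (\<lambda>j. b (Suc j))" and "lam1 M \<xi> * bsum b < 1 / 2"
    and "Omega M \<xi> b < 1"
    and "arch_solution M \<xi> a b X" and "weakly_stationary M X"
    and "0 < c"
  shows
    "(b(0 := c) \<in> Wdown 1 \<longleftrightarrow>
        (\<lambda>n. autocov M X (int n)) \<in> Wdown 1 \<and> (\<forall>n\<ge>1. 0 < b n)) \<and>
     ((\<lambda>n. autocov M X (int n)) \<in> Wdown 1 \<longrightarrow>
        (\<exists>g\<in>Wdown 1. \<forall>\<^sub>F n in sequentially. b n = g n)) \<and>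
     (b(0 := c) \<in> Wdown 1 \<or> (\<lambda>n. autocov M X (int n)) \<in> Wdown 1 \<longrightarrow>
        autocov M X summable_on UNIV \<and>
        (\<lambda>n. autocov M X (int n) / b n) \<longlonglongrightarrow>
          lam1 M \<xi> / (1 - lam1 M \<xi> * bsum b) * (\<Sum>\<^sub>\<infinity>j\<in>UNIV. autocov M X j) \<and>
        lam1 M \<xi> / (1 - lam1 M \<xi> * bsum b) * (\<Sum>\<^sub>\<infinity>j\<in>UNIV. autocov M X j) =
          lam1 M \<xi> * (\<integral>\<omega>. (nu M \<xi> a b X 0 \<omega>)\<^sup>2 \<partial>M) / (1 - lam1 M \<xi> * bsum b) ^ 3)"
proof -
  interpret prob_space M by fact
  interpret arch_process M \<xi> b a X
    by unfold_locales (use assms in auto)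
  define q where "q = lam1 M \<xi> * bsum b"
  have q: "q < 1 / 2" using assms by (simp add: q_def)
  \<comment> \<open>The limit of \<open>autocov M X n / b n\<close>.\<close>
  define K where "K = V * lam1 M \<xi> / (1 - q) ^ 3"
  have "0 < K" using V_pos l_pos q by (simp add: K_def)
  let ?r = "\<lambda>n. autocov M X (int n)"

  have forward: "(\<lambda>n. b n / \<gamma> n) \<longlonglongrightarrow> 1 \<and> (\<lambda>n. ?r n / \<gamma> n) \<longlonglongrightarrow> K"
    if \<gamma>: "\<gamma> \<in> Wclass 1" "decseq \<gamma>" "(\<lambda>n. (b(0 := c)) n / \<gamma> n) \<longlonglongrightarrow> 1" for \<gamma>
  proof -
    have b: "(\<lambda>n. b n / \<gamma> n) \<longlonglongrightarrow> 1"
      by (rule tendsto_ratio_change_finite[OF \<gamma>(3), of 1]) simp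
    have "(\<lambda>n. V * (zcorr (int n) / \<gamma> n)) \<longlonglongrightarrow> V * (lam1 M \<xi> * 1 / (1 - lam1 M \<xi> * bsum b) ^ 3)"
      by (intro tendsto_mult tendsto_const zcorr_asymptotics \<gamma> b)
    then show ?thesis using b by (simp add: autocov_formula K_def q_def)
  qed
  have backward: "(\<lambda>n. b n / \<gamma> n) \<longlonglongrightarrow> 1 / K"
    if \<gamma>: "\<gamma> \<in> Wclass 1" "decseq \<gamma>" "(\<lambda>n. ?r n / \<gamma> n) \<longlonglongrightarrow> 1" for \<gamma>
  proof -
    have "(\<lambda>n. ?r n / \<gamma> n / V) \<longlonglongrightarrow> 1 / V" by (intro tendsto_divide tendsto_const \<gamma>) (use V_pos in auto)
    then have "(\<lambda>n. zcorr (int n) / \<gamma> n) \<longlonglongrightarrow> 1 / V" using V_pos by (simp add: autocov_formula)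
    from coefficient_asymptotics[OF \<gamma>(1,2) assms(9) this]
    show ?thesis by (simp add: K_def q_def mult.commute)
  qed

  have pos_r: "0 < ?r n" if "\<forall>n\<ge>1. 0 < b n" for n
    using zcorr_pos[OF zseq_pos, of n] that V_pos by (simp add: autocov_formula)
  have b_to_r: "?r \<in> Wdown 1 \<and> (\<forall>n\<ge>1. 0 < b n)" if B: "b(0 := c) \<in> Wdown 1"
  proof -
    obtain \<gamma> where \<gamma>: "\<gamma> \<in> Wclass 1" "decseq \<gamma>" "(\<lambda>n. (b(0 := c)) n / \<gamma> n) \<longlonglongrightarrow> 1"
      using Wdown_obtain[OF B] by blast
    have "0 < (b(0 := c)) n" for n using B by (simp add: Wdown_def Wclass_def)
    then have bpos: "\<forall>n\<ge>1. 0 < b n" by (metis fun_upd_other not_one_le_zero)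
    show ?thesis
      using Wdown_asymp_equiv[OF \<gamma>(1,2) pos_r[OF bpos] conjunct2[OF forward[OF \<gamma>]] \<open>0 < K\<close>] bpos by blast
  qed
  have r_to_b: "g \<in> Wdown 1"
    if R: "?r \<in> Wdown 1" and g: "\<And>n. 0 < g n" "\<And>n. N \<le> n \<Longrightarrow> b n = g n" for g N
  proof -
    obtain \<gamma> where \<gamma>: "\<gamma> \<in> Wclass 1" "decseq \<gamma>" "(\<lambda>n. ?r n / \<gamma> n) \<longlonglongrightarrow> 1"
      using Wdown_obtain[OF R] by blast
    have "(\<lambda>n. g n / \<gamma> n) \<longlonglongrightarrow> 1 / K"
      by (rule tendsto_ratio_change_finite[OF backward[OF \<gamma>] g(2)])
    then show ?thesis by (rule Wdown_asymp_equiv[OF \<gamma>(1,2) g(1)]) (use \<open>0 < K\<close> in simp)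
  qed
  have eventually_pos: "\<forall>\<^sub>F n in sequentially. 0 < b n" if R: "?r \<in> Wdown 1"
  proof -
    obtain \<gamma> where \<gamma>: "\<gamma> \<in> Wclass 1" "decseq \<gamma>" "(\<lambda>n. ?r n / \<gamma> n) \<longlonglongrightarrow> 1"
      using Wdown_obtain[OF R] by blast
    have "\<forall>\<^sub>F n in sequentially. 0 < b n / \<gamma> n"
      by (rule order_tendstoD(1)[OF backward[OF \<gamma>]]) (use \<open>0 < K\<close> in simp)
    then show ?thesis
      by eventually_elim (simp add: zero_less_divide_iff Wclass_pos[OF \<gamma>(1)] order_less_not_sym[OF Wclass_pos[OF \<gamma>(1)]])
  qed

  have one: "b(0 := c) \<in> Wdown 1 \<longleftrightarrow> ?r \<in> Wdown 1 \<and> (\<forall>n\<ge>1. 0 < b n)"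
  proof
    assume R: "?r \<in> Wdown 1 \<and> (\<forall>n\<ge>1. 0 < b n)"
    show "b(0 := c) \<in> Wdown 1"
      by (rule r_to_b[of "b(0 := c)" 1]) (use R \<open>0 < c\<close> in auto)
  qed (rule b_to_r)
  have two: "\<exists>g\<in>Wdown 1. \<forall>\<^sub>F n in sequentially. b n = g n" if R: "?r \<in> Wdown 1"
  proof -
    obtain N where N: "\<And>n. N \<le> n \<Longrightarrow> 0 < b n"
      using eventually_pos[OF R] by (auto simp: eventually_sequentially)
    \<comment> \<open>Finitely many coefficients may vanish in this direction; they are replaced by \<open>1\<close>.\<close>
    define g where "g n = (if N \<le> n then b n else 1)" for n
    have "g \<in> Wdown 1" by (rule r_to_b[OF R, of g N]) (use N in \<open>auto simp: g_def\<close>)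
    moreover have "\<forall>\<^sub>F n in sequentially. b n = g n"
      using eventually_ge_at_top[of N] by eventually_elim (simp add: g_def)
    ultimately show ?thesis by blast
  qed
  have ratio: "(\<lambda>n. ?r n / b n) \<longlonglongrightarrow> K" if either: "b(0 := c) \<in> Wdown 1 \<or> ?r \<in> Wdown 1"
  proof -
    have "?r \<in> Wdown 1" using either b_to_r by blast
    then obtain \<gamma> where \<gamma>: "\<gamma> \<in> Wclass 1" "decseq \<gamma>" "(\<lambda>n. ?r n / \<gamma> n) \<longlonglongrightarrow> 1"
      by (rule Wdown_obtain)
    have "(\<lambda>n. (?r n / \<gamma> n) / (b n / \<gamma> n)) \<longlonglongrightarrow> 1 / (1 / K)"
      by (intro tendsto_divide \<gamma>(3) backward[OF \<gamma>]) (use \<open>0 < K\<close> in simp)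
    moreover have "(?r n / \<gamma> n) / (b n / \<gamma> n) = ?r n / b n" for n
      using Wclass_pos[OF \<gamma>(1), of n] by simp
    ultimately show ?thesis by (simp only: divide_divide_eq_right mult_1 div_by_1)
  qed
  have total: "(autocov M X has_sum (V * (1 / (1 - q))\<^sup>2)) UNIV"
    unfolding autocov_formula[abs_def] q_def by (intro has_sum_cmult_right zcorr_has_sum)
  have via_sum: "lam1 M \<xi> / (1 - q) * (\<Sum>\<^sub>\<infinity>j\<in>UNIV. autocov M X j) = K"
    unfolding infsumI[OF total] K_def by (simp add: power2_eq_square power3_eq_cube mult.assoc mult.commute)
  have via_nu: "lam1 M \<xi> * (\<integral>\<omega>. (nu M \<xi> a b X 0 \<omega>)\<^sup>2 \<partial>M) / (1 - q) ^ 3 = K"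
    by (simp add: K_def V_def mult.commute)
  show ?thesis
    unfolding q_def[symmetric] via_sum via_nu
    using one two ratio has_sum_imp_summable[OF total] by blast
qed

end
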